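(* Let $q=e^{-\mathrm i\theta_0}$ with $0<|\theta_0|<\pi$, and let $A,B$ be self-adjoint operators on a Hilbert space with $\ker A=\ker B=\{0\}$. Assume that both $\mathcal D_{q^2}(A^2,B)$ and $\mathcal D_q(A,B)$ are cores for $B$, and that there is a number $p\in\mathbb C\setminus\mathcal S(-q)$ such that $$qR_{\mu pq}(A)B\subseteq BR_{\mu p}(A)\quad\text{for all }\mu\in\mathbb R,\ \mu\neq0.$$ Then the pair $\{A,B\}$ belongs to the class $\mathcal C_1$.
   Context: For self-adjoint $X,Y$ and $p'\in\mathbb C$, $\mathcal D_{p'}(X,Y):=\{f\in\mathcal D(YX)\cap\mathcal D(XY): XYf=p'YXf\}$. $\theta_1:=\theta_0-\pi$ if $\theta_0>0$, $\theta_1:=\theta_0+\pi$ if $\theta_0<0$, so $-q=e^{-\mathrm i\theta_1}$ and $\overline{-q}=e^{\mathrm i\theta_1}$. $\mathcal S(-q)^+:=\{re^{\mathrm i\varphi}: r\ge0,\ \varphi\text{ between }0\text{ and }\theta_1\}$ and $\mathcal S(-q):=\mathcal S(-q)^+\cup(-\mathcal S(-q)^+)$. $R_\lambda(T)=(T-\lambda I)^{-1}$; $S\subseteq T$ means $T$ extends $S$. For self-adjoint $T$ with trivial kernel, $T=U_T|T|$ is the polar decomposition. A pair $\{A,B\}$ with $\ker A=\ker B=\{0\}$ belongs to class $\mathcal C_1$ if $|A|^{\mathrm it}B\subseteq e^{\theta_1t}B|A|^{\mathrm it}$ for all $t\in\mathbb R$ and $U_AU_B=-U_BU_A$. *)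

theory Defs
  imports "HOL-Analysis.Analysis"
begin

class chilbert = real_normed_vector + complete_space +
  fixes hscaleC :: "complex \<Rightarrow> 'a \<Rightarrow> 'a"
    and hinner  :: "'a \<Rightarrow> 'a \<Rightarrow> complex"
  assumes hscaleC_add_right: "hscaleC a (x + y) = hscaleC a x + hscaleC a y"
    and hscaleC_add_left: "hscaleC (a + b) x = hscaleC a x + hscaleC b x"
    and hscaleC_hscaleC: "hscaleC a (hscaleC b x) = hscaleC (a * b) x"
    and hscaleC_one: "hscaleC 1 x = x"
    and scaleR_hscaleC: "scaleR r x = hscaleC (complex_of_real r) x"
    and hinner_add_left: "hinner (x + y) z = hinner x z + hinner y z"
    and hinner_scaleC_left: "hinner (hscaleC a x) y = a * hinner x y"
    and hinner_commute: "hinner y x = cnj (hinner x y)"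
    and hinner_self: "hinner x x = complex_of_real ((norm x)\<^sup>2)"

text \<open>An operator is a pair (domain, action); the action outside the domain is irrelevant.\<close>

type_synonym 'a op = "'a set \<times> ('a \<Rightarrow> 'a)"

definition opdom :: "'a op \<Rightarrow> 'a set" where "opdom T = fst T"
definition opapp :: "'a op \<Rightarrow> 'a \<Rightarrow> 'a" where "opapp T = snd T"

definition linear_op :: "('a::chilbert) op \<Rightarrow> bool" where
  "linear_op T \<longleftrightarrow> 0 \<in> opdom T
     \<and> (\<forall>f\<in>opdom T. \<forall>g\<in>opdom T. f + g \<in> opdom T \<and> opapp T (f + g) = opapp T f + opapp T g)
     \<and> (\<forall>c. \<forall>f\<in>opdom T. hscaleC c f \<in> opdom T \<and> opapp T (hscaleC c f) = hscaleC c (opapp T f))"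

definition op_le :: "'a op \<Rightarrow> 'a op \<Rightarrow> bool" where
  "op_le S T \<longleftrightarrow> opdom S \<subseteq> opdom T \<and> (\<forall>f\<in>opdom S. opapp S f = opapp T f)"

definition op_eq :: "'a op \<Rightarrow> 'a op \<Rightarrow> bool" where
  "op_eq S T \<longleftrightarrow> op_le S T \<and> op_le T S"

definition op_comp :: "'a op \<Rightarrow> 'a op \<Rightarrow> 'a op" where
  "op_comp X Y = ({f \<in> opdom Y. opapp Y f \<in> opdom X}, \<lambda>f. opapp X (opapp Y f))"

definition op_smult :: "complex \<Rightarrow> ('a::chilbert) op \<Rightarrow> 'a op" where
  "op_smult c X = (opdom X, \<lambda>f. hscaleC c (opapp X f))"

definition op_of :: "('a \<Rightarrow> 'a) \<Rightarrow> 'a op" where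
  "op_of F = (UNIV, F)"

definition op_ker :: "('a::chilbert) op \<Rightarrow> 'a set" where
  "op_ker T = {f \<in> opdom T. opapp T f = 0}"

definition op_graph :: "'a op \<Rightarrow> ('a \<times> 'a) set" where
  "op_graph T = {(f, opapp T f) | f. f \<in> opdom T}"

definition selfadjoint :: "('a::chilbert) op \<Rightarrow> bool" where
  "selfadjoint T \<longleftrightarrow> linear_op T \<and> closure (opdom T) = UNIV
     \<and> (\<forall>g. g \<in> opdom T \<longleftrightarrow> (\<exists>h. \<forall>f\<in>opdom T. hinner (opapp T f) g = hinner f h))
     \<and> (\<forall>f\<in>opdom T. \<forall>g\<in>opdom T. hinner (opapp T f) g = hinner f (opapp T g))"

definition resolvent :: "complex \<Rightarrow> ('a::chilbert) op \<Rightarrow> 'a op" where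
  "resolvent z T = ((\<lambda>f. opapp T f - hscaleC z f) ` opdom T,
      \<lambda>g. THE f. f \<in> opdom T \<and> opapp T f - hscaleC z f = g)"

definition Dq :: "complex \<Rightarrow> ('a::chilbert) op \<Rightarrow> 'a op \<Rightarrow> 'a set" where
  "Dq p' X Y = {f \<in> opdom (op_comp Y X) \<inter> opdom (op_comp X Y).
      opapp (op_comp X Y) f = hscaleC p' (opapp (op_comp Y X) f)}"

definition is_core :: "('a::chilbert) set \<Rightarrow> 'a op \<Rightarrow> bool" where
  "is_core D B \<longleftrightarrow> D \<subseteq> opdom B \<and> closure (op_graph (D, opapp B)) = op_graph B"

definition bounded_op :: "(('a::chilbert) \<Rightarrow> 'a) \<Rightarrow> bool" where
  "bounded_op F \<longleftrightarrow> (\<forall>x y. F (x + y) = F x + F y) \<and> (\<forall>c x. F (hscaleC c x) = hscaleC c (F x))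
     \<and> (\<exists>K. \<forall>x. norm (F x) \<le> K * norm x)"

definition orth_proj :: "(('a::chilbert) \<Rightarrow> 'a) \<Rightarrow> bool" where
  "orth_proj P \<longleftrightarrow> bounded_op P \<and> (\<forall>x. P (P x) = P x) \<and> (\<forall>x y. hinner (P x) y = hinner x (P y))"

definition unitary_op :: "(('a::chilbert) \<Rightarrow> 'a) \<Rightarrow> bool" where
  "unitary_op U \<longleftrightarrow> bounded_op U \<and> surj U \<and> (\<forall>x y. hinner (U x) (U y) = hinner x y)"

definition pvm :: "(real set \<Rightarrow> ('a::chilbert) \<Rightarrow> 'a) \<Rightarrow> bool" where
  "pvm E \<longleftrightarrow> (\<forall>S\<in>sets borel. orth_proj (E S)) \<and> E UNIV = id
     \<and> (\<forall>S :: nat \<Rightarrow> real set. range S \<subseteq> sets borel \<longrightarrow> disjoint_family S \<longrightarrow>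
          (\<forall>f. (\<lambda>n. E (S n) f) sums E (\<Union>n. S n) f))"

definition spec_meas :: "(real set \<Rightarrow> ('a::chilbert) \<Rightarrow> 'a) \<Rightarrow> 'a \<Rightarrow> real measure" where
  "spec_meas E f = measure_of UNIV (sets borel) (\<lambda>S. ennreal (Re (hinner (E S f) f)))"

definition spectral_measure_of :: "('a::chilbert) op \<Rightarrow> (real set \<Rightarrow> 'a \<Rightarrow> 'a) \<Rightarrow> bool" where
  "spectral_measure_of T E \<longleftrightarrow> pvm E
     \<and> opdom T = {f. integrable (spec_meas E f) (\<lambda>x. x\<^sup>2)}
     \<and> (\<forall>f\<in>opdom T. hinner (opapp T f) f = complex_of_real (integral\<^sup>L (spec_meas E f) (\<lambda>x. x)))"

definition abs_pow_it :: "('a::chilbert) op \<Rightarrow> real \<Rightarrow> 'a \<Rightarrow> 'a" where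
  "abs_pow_it T t = (THE V. bounded_op V \<and> (\<exists>E. spectral_measure_of T E \<and>
      (\<forall>f. hinner (V f) f = integral\<^sup>L (spec_meas E f) (\<lambda>x. cis (t * ln \<bar>x\<bar>)))))"

definition positive_sa :: "('a::chilbert) op \<Rightarrow> bool" where
  "positive_sa P \<longleftrightarrow> selfadjoint P \<and> (\<forall>f\<in>opdom P. 0 \<le> Re (hinner (opapp P f) f))"

text \<open>Unitary part U_T of the polar decomposition T = U_T |T| (T self-adjoint, trivial kernel).\<close>
definition polar_U :: "('a::chilbert) op \<Rightarrow> 'a \<Rightarrow> 'a" where
  "polar_U T = (THE U. unitary_op U \<and> (\<exists>P. positive_sa P \<and> op_eq T (op_comp (op_of U) P)))"

definition theta1 :: "real \<Rightarrow> real" where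
  "theta1 \<theta>0 = (if \<theta>0 > 0 then \<theta>0 - pi else \<theta>0 + pi)"

definition sector_plus :: "real \<Rightarrow> complex set" where
  "sector_plus \<theta>0 = {complex_of_real r * cis \<phi> | r \<phi>.
      0 \<le> r \<and> min 0 (theta1 \<theta>0) \<le> \<phi> \<and> \<phi> \<le> max 0 (theta1 \<theta>0)}"

definition sector :: "real \<Rightarrow> complex set" where
  "sector \<theta>0 = sector_plus \<theta>0 \<union> uminus ` sector_plus \<theta>0"

definition class_C1 :: "real \<Rightarrow> ('a::chilbert) op \<Rightarrow> 'a op \<Rightarrow> bool" where
  "class_C1 \<theta>1 A B \<longleftrightarrow> op_ker A = {0} \<and> op_ker B = {0}
     \<and> (\<forall>t::real. op_le (op_comp (op_of (abs_pow_it A t)) B)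
                        (op_smult (complex_of_real (exp (\<theta>1 * t))) (op_comp B (op_of (abs_pow_it A t)))))
     \<and> (\<forall>f. polar_U A (polar_U B f) = - polar_U B (polar_U A f))"

end

theory Submission
  imports Defs "HOL-Probability.Probability"
begin

text \<open>
  Call a pair \<open>(F, G)\<close> of bounded Borel functions intertwining if \<open>G(A) B \<subseteq> B F(A)\<close>. Intertwining pairs
  form an algebra, and since \<open>B\<close> is closed and \<open>ker A = {0}\<close> they are closed under bounded pointwise
  limits off \<open>0\<close>. Replacing \<open>p\<close> by \<open>-p\<close> if necessary, \<open>p \<notin> S(-q)\<close> means \<open>Im p > 0 > Im (p q)\<close>.
  With \<open>\<kappa> = i / p\<close> the hypothesis says that \<open>(h(\<kappa> x), h(\<kappa> x / q))\<close> is intertwining for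
  \<open>h(z) = 1 / (z + i s)\<close>, \<open>s \<noteq> 0\<close> real; for \<open>x \<noteq> 0\<close> the points \<open>\<kappa> x\<close> and \<open>\<kappa> x / q\<close> lie in opposite open
  half-planes. Integrating \<open>i h\<close> over \<open>s > 0\<close> or over \<open>s < 0\<close> and exponentiating gives \<open>(\<plusminus> z)\<close> to the
  power \<open>i t\<close>, times a factor \<open>exp (\<plusminus> \<pi> t / 2)\<close> whose sign depends on the half-plane and on the ray.
  Linear combinations of the two rays give the pairs \<open>(|x|^(it), e^(-\<theta>1 t) |x|^(it))\<close> and \<open>(sgn, -sgn)\<close>.
  The first is the required relation for \<open>|A|^(it)\<close>; the second says \<open>U\<^sub>A B U\<^sub>A = -B\<close>, and uniqueness of
  the polar decomposition of \<open>B\<close> yields \<open>U\<^sub>A U\<^sub>B = -U\<^sub>B U\<^sub>A\<close>.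

  The spectral theorem for unbounded self-adjoint operators comes from the moments \<open>\<langle>U\<^sup>j f, f\<rangle>\<close> of the Cayley
  transform \<open>U\<close>: the Fejer means are nonnegative densities, Helly's theorem gives a limit measure on the
  circle, and the mean ergodic theorem shows that it does not charge the point corresponding to infinity.
\<close>

section \<open>Hilbert space preliminaries\<close>

text \<open>\<open>abs_pow_it\<close> and \<open>polar_U\<close> are definite descriptions over all
  spectral measures and all polar decompositions, so existence and uniqueness of both must be
  settled before anything can be computed. Hence one abstract calculus, given by measures and a
  generating set of functions, serves twice: with Cayley monomials to construct a spectral measure,
  and with indicators to analyse an arbitrary one. The integrals of the pairs are never formed. A
  primitive of i / (z + i s) in s is Ln (z + i s), and along a geometric sequence of poles its
  increments are logarithms of 1 plus a multiple of h. These sums telescope exactly, so the ratio r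
  of the sequence can stay fixed, close enough to 1 for the power series of the logarithm, an
  operation that preserves intertwining pairs. Only the range of s grows. The angle \<theta>1 enters
  through -1/q = e^(i \<theta>1): up to sign the second line of points is the first one rotated by
  \<theta>1, and with both directions in the right half-plane the principal logarithms differ by
  exactly i \<theta>1.\<close>

lemma hinner_zero_left [simp]: "hinner 0 (y::'a::chilbert) = 0"
  using hinner_add_left[of 0 0 y] by simp

lemma hscaleC_zero_left [simp]: "hscaleC 0 (x::'a::chilbert) = 0"
  using hscaleC_add_left[of 0 0 x] by simp

lemma hscaleC_zero_right [simp]: "hscaleC c (0::'a::chilbert) = 0"
  using hscaleC_add_right[of c 0 0] by simp

lemma hscaleC_minus_one: "hscaleC (-1) (x::'a::chilbert) = - x"
proof -
  have "hscaleC (-1) x = (-1) *\<^sub>R x" by (simp only: scaleR_hscaleC) simp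
  then show ?thesis by simp
qed

lemma hscaleC_minus_right: "hscaleC c (- x::'a::chilbert) = - hscaleC c x"
proof -
  have "hscaleC c x + hscaleC c (- x) = 0" unfolding hscaleC_add_right[symmetric] by simp
  then show ?thesis by (rule minus_unique[symmetric])
qed

lemma hscaleC_minus_left: "hscaleC (- c) (x::'a::chilbert) = - hscaleC c x"
proof -
  have "hscaleC c x + hscaleC (- c) x = 0" unfolding hscaleC_add_left[symmetric] by simp
  then show ?thesis by (rule minus_unique[symmetric])
qed

lemma hscaleC_diff_right: "hscaleC c (x - y::'a::chilbert) = hscaleC c x - hscaleC c y"
  using hscaleC_add_right[of c x "-y"] by (simp add: hscaleC_minus_right)

lemma hinner_minus_left: "hinner (- x) (y::'a::chilbert) = - hinner x y"
  using hinner_scaleC_left[of "-1" x y] by (simp add: hscaleC_minus_one)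

lemma hinner_diff_left: "hinner (x - z) (y::'a::chilbert) = hinner x y - hinner z y"
  using hinner_add_left[of x "-z" y] by (simp add: hinner_minus_left)

lemma hinner_zero_right [simp]: "hinner (y::'a::chilbert) 0 = 0"
  by (subst hinner_commute) simp

lemma hinner_add_right: "hinner (x::'a::chilbert) (y + z) = hinner x y + hinner x z"
  by (simp add: hinner_commute[of x] hinner_add_left)

lemma hinner_scaleC_right: "hinner (x::'a::chilbert) (hscaleC c y) = cnj c * hinner x y"
  by (simp add: hinner_commute[of x] hinner_scaleC_left)

lemma hinner_minus_right: "hinner (x::'a::chilbert) (- y) = - hinner x y"
  by (simp add: hinner_commute[of x] hinner_minus_left)

lemma hinner_diff_right: "hinner (x::'a::chilbert) (y - z) = hinner x y - hinner x z"
  by (simp add: hinner_commute[of x] hinner_diff_left)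

lemmas hinner_linear = hinner_add_left hinner_add_right hinner_diff_left hinner_diff_right
  hinner_minus_left hinner_minus_right hinner_scaleC_left hinner_scaleC_right

lemma hinner_eq_0_iff [simp]: "hinner (x::'a::chilbert) x = 0 \<longleftrightarrow> x = 0"
  by (simp add: hinner_self)

lemma hinner_norm_sq: "(norm (x::'a::chilbert))\<^sup>2 = Re (hinner x x)"
  by (simp add: hinner_self)

lemma norm_hscaleC [simp]: "norm (hscaleC c (x::'a::chilbert)) = cmod c * norm x"
proof -
  have "complex_of_real ((norm (hscaleC c x))\<^sup>2) = (c * cnj c) * of_real ((norm x)\<^sup>2)"
    unfolding hinner_self[symmetric] by (simp add: hinner_scaleC_left hinner_scaleC_right)
  also have "\<dots> = of_real ((cmod c * norm x)\<^sup>2)"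
    by (simp add: complex_norm_square[symmetric] power_mult_distrib)
  finally have "(norm (hscaleC c x))\<^sup>2 = (cmod c * norm x)\<^sup>2"
    unfolding of_real_eq_iff .
  then show ?thesis by (simp add: power2_eq_iff_nonneg)
qed

text \<open>Subtracting from x its component along y leaves the squared distance from x to the line
  of y. This gives Cauchy-Schwarz as well as the orthogonality in the projection theorem. For y = 0
  division by zero yields 0 and both sides reduce to the squared norm of x.\<close>

lemma norm_diff_scaled_sq:
  "(norm (x - hscaleC (hinner x y / of_real ((norm y)\<^sup>2)) (y::'a::chilbert)))\<^sup>2
     = (norm x)\<^sup>2 - (cmod (hinner x y))\<^sup>2 / (norm y)\<^sup>2"
proof (cases "y = 0")
  case False
  define a where "a = hinner x y"
  define n where "n = complex_of_real ((norm y)\<^sup>2)"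
  have n: "n \<noteq> 0" "cnj n = n" "hinner y y = n" using False by (auto simp: n_def hinner_self)
  have ya: "hinner y x = cnj a" using hinner_commute a_def by blast
  have "complex_of_real ((norm (x - hscaleC (a / n) y))\<^sup>2)
      = hinner x x - cnj (a/n) * a - (a/n) * cnj a + (a/n) * cnj (a/n) * n"
    unfolding hinner_self[symmetric]
    by (simp add: hinner_linear a_def[symmetric] ya n algebra_simps)
  also have "\<dots> = hinner x x - (a * cnj a) / n"
    using n by (simp add: field_simps)
  also have "\<dots> = of_real ((norm x)\<^sup>2 - (cmod a)\<^sup>2 / (norm y)\<^sup>2)"
    by (simp add: n_def hinner_self complex_norm_square[symmetric])
  finally show ?thesis unfolding a_def n_def of_real_eq_iff .
qed simp

lemma hinner_cauchy_schwarz: "cmod (hinner (x::'a::chilbert) y) \<le> norm x * norm y"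
proof (cases "y = 0")
  case False
  have "0 \<le> (norm x)\<^sup>2 - (cmod (hinner x y))\<^sup>2 / (norm y)\<^sup>2"
    by (metis norm_diff_scaled_sq zero_le_power2)
  then have "(cmod (hinner x y))\<^sup>2 \<le> (norm x * norm y)\<^sup>2"
    using False by (simp add: field_simps power_mult_distrib)
  then show ?thesis by (rule power2_le_imp_le) simp
qed simp

lemma bounded_bilinear_hinner: "bounded_bilinear (hinner :: 'a::chilbert \<Rightarrow> 'a \<Rightarrow> complex)"
proof
  show "\<exists>K. \<forall>a b. norm (hinner a (b::'a)) \<le> norm a * norm b * K"
    by (rule exI[of _ 1]) (simp add: hinner_cauchy_schwarz)
qed (auto simp: hinner_linear scaleR_hscaleC scaleR_conv_of_real)

lemmas tendsto_hinner = bounded_bilinear.tendsto[OF bounded_bilinear_hinner]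

lemma tendsto_hscaleC:
  "(f \<longlongrightarrow> l) F \<Longrightarrow> ((\<lambda>x. hscaleC c (f x :: 'a::chilbert)) \<longlongrightarrow> hscaleC c l) F"
proof -
  have "bounded_linear (hscaleC c :: 'a \<Rightarrow> 'a)"
    by (rule bounded_linear_intro[where K = "cmod c"])
       (auto simp: hscaleC_add_right scaleR_hscaleC hscaleC_hscaleC mult.commute)
  then show "(f \<longlongrightarrow> l) F \<Longrightarrow> ((\<lambda>x. hscaleC c (f x)) \<longlongrightarrow> hscaleC c l) F"
    by (rule bounded_linear.tendsto)
qed

lemma hinner_eqI: "(\<And>g. hinner x g = hinner y g) \<Longrightarrow> x = (y::'a::chilbert)"
  by (metis hinner_diff_left hinner_eq_0_iff right_minus_eq)

lemma hinner_dense_eqI: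
  assumes "closure D = (UNIV :: 'a::chilbert set)" "\<And>g. g \<in> D \<Longrightarrow> hinner x g = hinner y g"
  shows "x = y"
proof (rule hinner_eqI)
  fix g :: 'a
  obtain s where s: "\<And>n. s n \<in> D" "s \<longlonglongrightarrow> g"
    using assms(1) closure_sequential[of g D] by auto
  have "(\<lambda>n. hinner x (s n)) \<longlonglongrightarrow> hinner x g" "(\<lambda>n. hinner y (s n)) \<longlonglongrightarrow> hinner y g"
    by (intro tendsto_hinner tendsto_const s)+
  then show "hinner x g = hinner y g" using assms(2) s(1) LIMSEQ_unique by force
qed

section \<open>Orthogonal projections and the Riesz representation\<close>

definition csubspace :: "'a::chilbert set \<Rightarrow> bool" where
  "csubspace M \<longleftrightarrow> 0 \<in> M \<and> (\<forall>x\<in>M. \<forall>y\<in>M. x + y \<in> M) \<and> (\<forall>c. \<forall>x\<in>M. hscaleC c x \<in> M)"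

lemma parallelogram: "(norm (x + y))\<^sup>2 + (norm (x - y::'a::chilbert))\<^sup>2 = 2 * (norm x)\<^sup>2 + 2 * (norm y)\<^sup>2"
  by (simp add: hinner_norm_sq hinner_linear)

text \<open>A minimizing sequence in M is Cauchy by the parallelogram law, because midpoints stay in
  M. Its limit m is a nearest point, and moving from m along v by the optimal multiple of v cannot
  decrease the distance, which forces orthogonality.\<close>

lemma orthogonal_projection_exists:
  fixes x :: "'a::chilbert"
  assumes M: "csubspace M" "closed M"
  shows "\<exists>m\<in>M. \<forall>u\<in>M. hinner (x - m) u = 0"
proof -
  have ne: "M \<noteq> {}" using M by (auto simp: csubspace_def)
  define d where "d = infdist x M"
  have d0: "0 \<le> d" by (simp add: d_def infdist_nonneg)
  have dle: "d\<^sup>2 \<le> (norm (x - u))\<^sup>2" if "u \<in> M" for u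
    using infdist_le[OF that, of x] d0 by (simp add: d_def dist_norm power_mono)
  have "\<exists>u\<in>M. (norm (x - u))\<^sup>2 < d\<^sup>2 + e" if "0 < e" for e
  proof -
    have "d < sqrt (d\<^sup>2 + e)" using d0 that by (simp add: real_less_rsqrt)
    moreover have "\<exists>u\<in>M. dist x u < s" if "d < s" for s
      using that cINF_less_iff[of M "dist x" s] ne unfolding d_def infdist_def
      by (auto intro!: bdd_belowI[of _ 0])
    ultimately obtain u where "u \<in> M" "norm (x - u) < sqrt (d\<^sup>2 + e)" by (auto simp: dist_norm)
    then have "(norm (x - u))\<^sup>2 < (sqrt (d\<^sup>2 + e))\<^sup>2"
      by (intro power_strict_mono) auto
    then show ?thesis using \<open>u \<in> M\<close> that by auto
  qed
  then have "\<exists>u. u \<in> M \<and> (norm (x - u))\<^sup>2 < d\<^sup>2 + inverse (real (Suc n))" for n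
    by (meson of_nat_0_less_iff positive_imp_inverse_positive zero_less_Suc)
  then obtain u where u: "\<And>n. u n \<in> M" "\<And>n. (norm (x - u n))\<^sup>2 < d\<^sup>2 + inverse (real (Suc n))" by metis
  \<comment> \<open>Parallelogram law for x - v and x - w; the midpoint of v and w has distance at
    least d from x.\<close>
  have key: "(norm (v - w))\<^sup>2 \<le> 2 * ((norm (x - v))\<^sup>2 - d\<^sup>2) + 2 * ((norm (x - w))\<^sup>2 - d\<^sup>2)"
    if "v \<in> M" "w \<in> M" for v w
  proof -
    have "hscaleC (1/2) (v + w) \<in> M" using M that by (simp add: csubspace_def)
    then have "d\<^sup>2 \<le> (norm (x - hscaleC (1/2) (v + w)))\<^sup>2" by (rule dle)
    also have "x - hscaleC (1/2) (v + w) = hscaleC (1/2) ((x - v) + (x - w))"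
    proof -
      have "hscaleC (1/2) (x + x) = x"
        by (simp add: hscaleC_add_right hscaleC_add_left[symmetric] hscaleC_one)
      moreover have "(x - v) + (x - w) = (x + x) - (v + w)" by simp
      ultimately show ?thesis by (simp only: hscaleC_diff_right)
    qed
    also have "(norm \<dots>)\<^sup>2 = (norm ((x - v) + (x - w)))\<^sup>2 / 4"
      by (simp add: power_mult_distrib power2_eq_square)
    finally have "4 * d\<^sup>2 \<le> (norm ((x - v) + (x - w)))\<^sup>2" by simp
    with parallelogram[of "x - v" "x - w"] show ?thesis
      by (simp add: norm_minus_commute)
  qed
  have "Cauchy u"
  proof (rule metric_CauchyI)
    fix e :: real assume "0 < e"
    then obtain N where N: "inverse (real (Suc N)) < e\<^sup>2 / 4"
      using reals_Archimedean[of "e\<^sup>2/4"] by auto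
    have "dist (u m) (u n) < e" if "m \<ge> N" "n \<ge> N" for m n
    proof -
      have "inverse (real (Suc m)) \<le> inverse (real (Suc N))" "inverse (real (Suc n)) \<le> inverse (real (Suc N))"
        using that by (auto simp: field_simps)
      \<comment> \<open>Both squared distances exceed \<open>D\<close> by less than a quarter of
        \<open>E\<close>, so the two doubled excesses add up to less than \<open>E\<close>.\<close>
      moreover have "s < E" if "s \<le> 2 * (a - D) + 2 * (b - D)" "a < D + i" "b < D + j"
        "k < E / 4" "i \<le> k" "j \<le> k" for s a b D i j k E :: real
        using that by (simp add: algebra_simps)
      ultimately have "(norm (u m - u n))\<^sup>2 < e\<^sup>2"
        using key[OF u(1)[of m] u(1)[of n]] u(2)[of m] u(2)[of n] N by blast
      then show ?thesis using \<open>0 < e\<close> by (simp add: dist_norm power2_less_imp_less)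
    qed
    then show "\<exists>N. \<forall>m\<ge>N. \<forall>n\<ge>N. dist (u m) (u n) < e" by blast
  qed
  then obtain m where m: "u \<longlonglongrightarrow> m" using Cauchy_convergent convergent_def by blast
  have mM: "m \<in> M" using closed_sequentially[OF M(2)] u(1) m by blast
  have "(\<lambda>n. (norm (x - u n))\<^sup>2) \<longlonglongrightarrow> (norm (x - m))\<^sup>2" by (intro tendsto_intros m)
  moreover have "(\<lambda>n. d\<^sup>2 + inverse (real (Suc n))) \<longlonglongrightarrow> d\<^sup>2 + 0"
    by (intro tendsto_add tendsto_const LIMSEQ_inverse_real_of_nat)
  ultimately have md: "(norm (x - m))\<^sup>2 \<le> d\<^sup>2"
    using u(2) by (intro LIMSEQ_le[of "\<lambda>n. (norm (x - u n))\<^sup>2"]) (auto intro: less_imp_le)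
  have "hinner (x - m) v = 0" if v: "v \<in> M" for v
  proof (cases "v = 0")
    case False
    let ?c = "hinner (x - m) v / of_real ((norm v)\<^sup>2)"
    have "m + hscaleC ?c v \<in> M" using M mM v by (auto simp: csubspace_def)
    from dle[OF this] have "d\<^sup>2 \<le> (norm ((x - m) - hscaleC ?c v))\<^sup>2" by (simp add: diff_diff_eq)
    also have "\<dots> = (norm (x - m))\<^sup>2 - (cmod (hinner (x - m) v))\<^sup>2 / (norm v)\<^sup>2"
      by (rule norm_diff_scaled_sq)
    finally have "(cmod (hinner (x - m) v))\<^sup>2 / (norm v)\<^sup>2 \<le> 0" using md by simp
    then have "(cmod (hinner (x - m) v))\<^sup>2 \<le> 0" using False by (simp add: field_simps)
    then show ?thesis by simp
  qed simp
  then show ?thesis using mM by blast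
qed

text \<open>The kernel of \<phi> is closed, so there is a nonzero z orthogonal to it. Every u
  differs from a multiple of z, with coefficient \<phi> u / \<phi> z, by an element of the kernel;
  taking the inner product with z expresses \<phi> u.\<close>

lemma riesz_representation:
  fixes \<phi> :: "'a::chilbert \<Rightarrow> complex"
  assumes add: "\<And>x y. \<phi> (x + y) = \<phi> x + \<phi> y" and sc: "\<And>c x. \<phi> (hscaleC c x) = c * \<phi> x"
    and bd: "\<And>x. cmod (\<phi> x) \<le> K * norm x"
  shows "\<exists>z. \<forall>u. \<phi> u = hinner u z"
proof (cases "\<forall>u. \<phi> u = 0")
  case True then show ?thesis by (intro exI[of _ 0]) simp
next
  case False
  then obtain x where x: "\<phi> x \<noteq> 0" by blast
  have "bounded_linear \<phi>"
    using add bd by (intro bounded_linear_intro[where K = K])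
      (auto simp: scaleR_hscaleC sc scaleR_conv_of_real mult.commute)
  then have cont: "continuous_on UNIV \<phi>" by (rule linear_continuous_on)
  define M where "M = {u. \<phi> u = 0}"
  have 0: "\<phi> 0 = 0" using sc[of 0 0] by simp
  have dif: "\<phi> (a - b) = \<phi> a - \<phi> b" for a b
    using add[of a "-b"] sc[of "-1" b] by (simp add: hscaleC_minus_one)
  have "csubspace M" by (auto simp: csubspace_def M_def add sc 0)
  moreover have "closed M"
    using continuous_closed_vimage[of "{0}" \<phi>] cont by (simp add: M_def vimage_def continuous_on_eq_continuous_at)
  ultimately obtain m where m: "m \<in> M" "\<forall>u\<in>M. hinner (x - m) u = 0"
    using orthogonal_projection_exists by blast
  define z where "z = x - m"
  have pz: "\<phi> z \<noteq> 0" using x m by (simp add: z_def dif M_def)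
  then have z0: "z \<noteq> 0" using 0 by auto
  define n where "n = complex_of_real ((norm z)\<^sup>2)"
  have n: "hinner z z = n" "n \<noteq> 0" "cnj n = n" using z0 by (auto simp: n_def hinner_self)
  have "\<phi> u = hinner u (hscaleC (cnj (\<phi> z) / n) z)" for u
  proof -
    have "u - hscaleC (\<phi> u / \<phi> z) z \<in> M" using pz by (simp add: M_def dif sc)
    then have "hinner z (u - hscaleC (\<phi> u / \<phi> z) z) = 0" using m z_def by blast
    then have "hinner (u - hscaleC (\<phi> u / \<phi> z) z) z = 0"
      by (subst hinner_commute) simp
    then have "hinner u z = \<phi> u / \<phi> z * n" by (simp add: hinner_linear n)
    then show ?thesis using pz n by (simp add: hinner_linear)
  qed
  then show ?thesis by blast
qed

section \<open>Sesquilinear forms and polarization\<close>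

definition sesquilinear :: "('a::chilbert \<Rightarrow> 'a \<Rightarrow> complex) \<Rightarrow> bool" where
  "sesquilinear s \<longleftrightarrow> (\<forall>f f' g. s (f + f') g = s f g + s f' g) \<and> (\<forall>c f g. s (hscaleC c f) g = c * s f g)
     \<and> (\<forall>f g g'. s f (g + g') = s f g + s f g') \<and> (\<forall>c f g. s f (hscaleC c g) = cnj c * s f g)"

lemma polarization:
  assumes "sesquilinear s"
  shows "4 * s f g = s (f + g) (f + g) - s (f - g) (f - g)
     + \<i> * s (f + hscaleC \<i> g) (f + hscaleC \<i> g) - \<i> * s (f - hscaleC \<i> g) (f - hscaleC \<i> g)"
proof -
  have m: "f - h = f + hscaleC (-1) h" for h by (simp add: hscaleC_minus_one)
  show ?thesis using assms unfolding m sesquilinear_def by (simp add: algebra_simps)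
qed

text \<open>Polarization and the parallelogram law give the non-homogeneous bound K (|f|^2 + |g|^2);
  normalizing f and g to unit length turns it into a product bound with constant 2 K.\<close>

lemma sesquilinear_bound:
  assumes s: "sesquilinear s" and K: "\<And>f. cmod (s f f) \<le> K * (norm (f::'a::chilbert))\<^sup>2"
  shows "cmod (s f g) \<le> 2 * K * norm f * norm g"
proof -
  have sc: "s (hscaleC c f) g = c * s f g" "s f (hscaleC c g) = cnj c * s f g" for c f g
    using s by (auto simp: sesquilinear_def)
  have 1: "cmod (s f g) \<le> K * ((norm f)\<^sup>2 + (norm g)\<^sup>2)" for f g
  proof -
    have "4 * cmod (s f g) = cmod (4 * s f g)" by (simp add: norm_mult)
    also have "\<dots> \<le> cmod (s (f + g) (f + g)) + cmod (s (f - g) (f - g))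
      + cmod (s (f + hscaleC \<i> g) (f + hscaleC \<i> g)) + cmod (s (f - hscaleC \<i> g) (f - hscaleC \<i> g))"
    proof -
      have "cmod (a - b + \<i> * c - \<i> * d) \<le> cmod a + cmod b + cmod c + cmod d" for a b c d
        using norm_triangle_ineq4[of "a - b + \<i> * c" "\<i> * d"] norm_triangle_ineq[of "a - b" "\<i> * c"]
          norm_triangle_ineq4[of a b] by (simp add: norm_mult)
      then show ?thesis unfolding polarization[OF s] .
    qed
    also have "\<dots> \<le> K * (norm (f + g))\<^sup>2 + K * (norm (f - g))\<^sup>2
      + K * (norm (f + hscaleC \<i> g))\<^sup>2 + K * (norm (f - hscaleC \<i> g))\<^sup>2"
      by (intro add_mono K)
    also have "\<dots> = K * ((norm (f + g))\<^sup>2 + (norm (f - g))\<^sup>2)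
      + K * ((norm (f + hscaleC \<i> g))\<^sup>2 + (norm (f - hscaleC \<i> g))\<^sup>2)" by (simp add: algebra_simps)
    also have "\<dots> = 4 * (K * ((norm f)\<^sup>2 + (norm g)\<^sup>2))"
      unfolding parallelogram by (simp add: algebra_simps)
    finally show ?thesis by simp
  qed
  show ?thesis
  proof (cases "f = 0 \<or> g = 0")
    case True
    then have "s f g = 0"
    proof
      assume "f = 0" then show ?thesis using sc(1)[of 0 0 g] by simp
    next
      assume "g = 0" then show ?thesis using sc(2)[of f 0 0] by simp
    qed
    then show ?thesis using True by auto
  next
    case False
    define f' where "f' = hscaleC (of_real (1 / norm f)) f"
    define g' where "g' = hscaleC (of_real (1 / norm g)) g"
    have "norm f' = 1" "norm g' = 1" using False by (auto simp: f'_def g'_def norm_divide)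
    with 1[of f' g'] have "cmod (s f' g') \<le> 2 * K" by simp
    moreover have "s f' g' = of_real (1 / norm f) * of_real (1 / norm g) * s f g"
      by (simp add: f'_def g'_def sc)
    ultimately show ?thesis using False by (simp add: norm_mult norm_divide field_simps)
  qed
qed

text \<open>For fixed f the Riesz theorem is applied to the conjugate of \<open>s f\<close>, which
  is linear because s is conjugate-linear in its second argument. Testing with g = T f bounds
  T.\<close>

lemma sesquilinear_represented:
  fixes s :: "'a::chilbert \<Rightarrow> 'a \<Rightarrow> complex"
  assumes s: "sesquilinear s" and K: "\<And>f. cmod (s f f) \<le> K * (norm f)\<^sup>2"
  shows "\<exists>T. bounded_op T \<and> (\<forall>f g. s f g = hinner (T f) g)"
proof -
  have bd: "cmod (s f g) \<le> (2 * K) * norm f * norm g" for f g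
    using sesquilinear_bound[OF s K] .
  have "\<exists>z. \<forall>g. cnj (s f g) = hinner g z" for f
    using s bd[of f]
    by (intro riesz_representation[where K = "2 * K * norm f"])
       (auto simp: sesquilinear_def mult.commute mult.left_commute)
  then obtain T where T: "\<And>f g. cnj (s f g) = hinner g (T f)" by metis
  have T': "s f g = hinner (T f) g" for f g
    using arg_cong[OF T[of f g], of cnj] by (simp add: hinner_commute[of "T f" g])
  have "norm (T f) \<le> 2 * K * norm f" for f
  proof (cases "T f = 0")
    case True
    \<comment> \<open>The sign of \<open>K\<close> is read off from the bound at \<open>f\<close>
      itself.\<close>
    have "0 \<le> K * (norm f)\<^sup>2" using K[of f] norm_ge_zero order_trans by blast
    then have "0 \<le> K * norm f" by (cases "f = 0") (auto simp: zero_le_mult_iff)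
    then show ?thesis using True by simp
  next
    case False
    have "(norm (T f))\<^sup>2 = cmod (s f (T f))" by (simp add: T' hinner_self norm_power)
    also have "\<dots> \<le> 2 * K * norm f * norm (T f)" by (rule bd)
    finally show ?thesis using False by (simp add: power2_eq_square)
  qed
  moreover have "T (x + y) = T x + T y" for x y
    by (rule hinner_eqI) (use s in \<open>simp add: hinner_linear T'[symmetric] sesquilinear_def\<close>)
  moreover have "T (hscaleC c x) = hscaleC c (T x)" for c x
    by (rule hinner_eqI) (use s in \<open>simp add: hinner_linear T'[symmetric] sesquilinear_def\<close>)
  ultimately have "bounded_op T" unfolding bounded_op_def by blast
  then show ?thesis using T' by blast
qed

section \<open>Bounded operators and their quadratic forms\<close>

lemma bounded_op_add: "bounded_op T \<Longrightarrow> T (x + y) = T x + T y"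
  and bounded_op_scale: "bounded_op T \<Longrightarrow> T (hscaleC c x) = hscaleC c (T x)"
  by (auto simp: bounded_op_def)

lemma bounded_op_zero: "bounded_op T \<Longrightarrow> T 0 = 0"
  using bounded_op_scale[of T 0 0] by simp

lemma bounded_op_minus: "bounded_op T \<Longrightarrow> T (- x) = - T x"
  using bounded_op_scale[of T "-1" x] by (simp add: hscaleC_minus_one)

lemma bounded_op_diff: "bounded_op T \<Longrightarrow> T (x - y) = T x - T y"
  using bounded_op_add[of T x "-y"] by (simp add: bounded_op_minus)

lemma bounded_op_bounded_linear: "bounded_op T \<Longrightarrow> bounded_linear T"
  unfolding bounded_op_def by (metis bounded_linear_intro mult.commute scaleR_hscaleC)

lemma bounded_op_tendsto: "bounded_op T \<Longrightarrow> (f \<longlongrightarrow> l) F \<Longrightarrow> ((\<lambda>x. T (f x)) \<longlongrightarrow> T l) F"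
  using bounded_linear.tendsto bounded_op_bounded_linear by blast

lemma bounded_op_bound:
  assumes "bounded_op T" obtains K where "0 \<le> K" "\<And>x. norm (T x) \<le> K * norm x"
proof -
  obtain K where K: "\<forall>x. norm (T x) \<le> K * norm x" using assms by (auto simp: bounded_op_def)
  have "norm (T x) \<le> max K 0 * norm x" for x
    using K by (meson max.cobounded1 mult_right_mono norm_ge_zero order_trans)
  then show ?thesis using that[of "max K 0"] by simp
qed

lemma bounded_op_id: "bounded_op (\<lambda>x. x)"
  by (auto simp: bounded_op_def intro: exI[of _ 1])

lemma bounded_op_comp:
  assumes "bounded_op S" "bounded_op T" shows "bounded_op (\<lambda>x. S (T x))"
proof -
  obtain K L where K: "0 \<le> K" "\<And>x. norm (S x) \<le> K * norm x" and L: "0 \<le> L" "\<And>x. norm (T x) \<le> L * norm x"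
    using assms bounded_op_bound by metis
  have "norm (S (T x)) \<le> (K * L) * norm x" for x
    using K(2)[of "T x"] mult_left_mono[OF L(2)[of x] K(1)] by (simp add: mult.assoc)
  then show ?thesis using assms unfolding bounded_op_def by auto
qed

lemma bounded_op_plus:
  assumes "bounded_op S" "bounded_op T" shows "bounded_op (\<lambda>x. S x + T x)"
proof -
  obtain K L where K: "\<And>x. norm (S x) \<le> K * norm x" and L: "\<And>x. norm (T x) \<le> L * norm x"
    using assms bounded_op_bound by metis
  have "norm (S x + T x) \<le> (K + L) * norm x" for x
    using norm_triangle_ineq[of "S x" "T x"] K[of x] L[of x] by (simp add: distrib_right)
  moreover have "S (x + y) + T (x + y) = S x + T x + (S y + T y)" for x y
    using assms by (simp add: bounded_op_add)
  moreover have "S (hscaleC c x) + T (hscaleC c x) = hscaleC c (S x + T x)" for c x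
    using assms by (simp add: bounded_op_scale hscaleC_add_right)
  ultimately show ?thesis unfolding bounded_op_def by blast
qed

lemma bounded_op_hscaleC: "bounded_op (\<lambda>x. hscaleC c x)"
  by (auto simp: bounded_op_def hscaleC_add_right hscaleC_hscaleC mult.commute intro!: exI[of _ "cmod c"])

lemma bounded_op_scaled: "bounded_op T \<Longrightarrow> bounded_op (\<lambda>x. hscaleC c (T x))"
  by (rule bounded_op_comp[OF bounded_op_hscaleC])

lemma sesquilinear_bounded_op: "bounded_op T \<Longrightarrow> sesquilinear (\<lambda>f g. hinner (T f) g)"
  by (simp add: sesquilinear_def bounded_op_add bounded_op_scale hinner_linear)

text \<open>Complex polarization recovers the operator from its diagonal. For this reason the
  calculus below works with one positive measure per vector instead of complex measures for pairs of
  vectors.\<close>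

lemma bounded_op_eq_quadratic:
  assumes "bounded_op S" "bounded_op T" "\<And>f. hinner (S f) f = hinner (T f) f"
  shows "S = T"
proof (rule ext, rule hinner_eqI)
  fix f g
  have "4 * hinner (S f) g = 4 * hinner (T f) g"
    using polarization[OF sesquilinear_bounded_op[OF assms(1)], of f g]
      polarization[OF sesquilinear_bounded_op[OF assms(2)], of f g] by (simp add: assms(3))
  then show "hinner (S f) g = hinner (T f) g" by simp
qed

lemma bounded_op_adjoint_quadratic:
  assumes "bounded_op S" "bounded_op T" "\<And>f. hinner (S f) f = cnj (hinner (T f) f)"
  shows "hinner (S f) g = hinner f (T g)"
proof -
  have s: "sesquilinear (\<lambda>f g. hinner f (T g))"
    using assms(2) by (simp add: sesquilinear_def bounded_op_add bounded_op_scale hinner_linear)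
  have "hinner (S h) h = hinner h (T h)" for h
    by (simp add: assms(3) hinner_commute[of h "T h"])
  then have "4 * hinner (S f) g = 4 * hinner f (T g)"
    using polarization[OF s, of f g] polarization[OF sesquilinear_bounded_op[OF assms(1)], of f g] by simp
  then show ?thesis by simp
qed

text \<open>The limit form is defined from the diagonal limits by polarization. It is sesquilinear
  because it is also the limit of the forms of the \<open>T n\<close>, and the diagonal bound makes
  it the form of an operator.\<close>

lemma quadratic_limit_represented:
  fixes T :: "nat \<Rightarrow> 'a::chilbert \<Rightarrow> 'a"
  assumes T: "\<And>n. bounded_op (T n)" and lim: "\<And>f. (\<lambda>n. hinner (T n f) f) \<longlonglongrightarrow> l f"
    and K: "\<And>f. cmod (l f) \<le> K * (norm f)\<^sup>2"
  shows "\<exists>S. bounded_op S \<and> (\<forall>f. hinner (S f) f = l f) \<and> (\<forall>f g. (\<lambda>n. hinner (T n f) g) \<longlonglongrightarrow> hinner (S f) g)"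
proof -
  define s where "s f g = (l (f + g) - l (f - g)
     + \<i> * l (f + hscaleC \<i> g) - \<i> * l (f - hscaleC \<i> g)) / 4" for f g
  have lims: "(\<lambda>n. hinner (T n f) g) \<longlonglongrightarrow> s f g" for f g
  proof -
    have "(\<lambda>n. (hinner (T n (f + g)) (f + g) - hinner (T n (f - g)) (f - g)
       + \<i> * hinner (T n (f + hscaleC \<i> g)) (f + hscaleC \<i> g)
       - \<i> * hinner (T n (f - hscaleC \<i> g)) (f - hscaleC \<i> g)) / 4) \<longlonglongrightarrow> s f g"
      unfolding s_def by (intro tendsto_intros lim) auto
    then show ?thesis
      unfolding polarization[OF sesquilinear_bounded_op[OF T], symmetric] by simp
  qed
  have "sesquilinear s"
    unfolding sesquilinear_def
  proof (intro conjI allI)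
    fix f f' g c
    have "(\<lambda>n. hinner (T n (f + f')) g) \<longlonglongrightarrow> s f g + s f' g"
      using tendsto_add[OF lims[of f g] lims[of f' g]] by (simp add: bounded_op_add[OF T] hinner_linear)
    then show "s (f + f') g = s f g + s f' g" using lims LIMSEQ_unique by blast
    have "(\<lambda>n. hinner (T n (hscaleC c f)) g) \<longlonglongrightarrow> c * s f g"
      using tendsto_mult_left[OF lims[of f g], of c] by (simp add: bounded_op_scale[OF T] hinner_linear)
    then show "s (hscaleC c f) g = c * s f g" using lims LIMSEQ_unique by blast
    have "(\<lambda>n. hinner (T n g) (f + f')) \<longlonglongrightarrow> s g f + s g f'"
      using tendsto_add[OF lims[of g f] lims[of g f']] by (simp add: hinner_linear)
    then show "s g (f + f') = s g f + s g f'" using lims LIMSEQ_unique by blast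
    have "(\<lambda>n. hinner (T n f) (hscaleC c g)) \<longlonglongrightarrow> cnj c * s f g"
      using tendsto_mult_left[OF lims[of f g], of "cnj c"] by (simp add: hinner_linear)
    then show "s f (hscaleC c g) = cnj c * s f g" using lims LIMSEQ_unique by blast
  qed
  moreover have sl: "s f f = l f" for f using lims lim LIMSEQ_unique by blast
  ultimately obtain S where "bounded_op S" "\<forall>f g. s f g = hinner (S f) g"
    using sesquilinear_represented[of s K] K by auto
  then show ?thesis using lims sl by metis
qed

section \<open>Bounded Borel functions and their bounded pointwise closures\<close>

definition bounded_borel :: "(real \<Rightarrow> complex) \<Rightarrow> bool" where
  "bounded_borel F \<longleftrightarrow> F \<in> borel_measurable borel \<and> (\<exists>K. \<forall>x. cmod (F x) \<le> K)"

lemma bounded_borelI: "F \<in> borel_measurable borel \<Longrightarrow> (\<And>x. cmod (F x) \<le> K) \<Longrightarrow> bounded_borel F"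
  by (auto simp: bounded_borel_def)

lemma bounded_borel_measurable: "bounded_borel F \<Longrightarrow> F \<in> borel_measurable borel"
  by (simp add: bounded_borel_def)

lemma bounded_borel_bound:
  assumes "bounded_borel F" obtains K where "0 \<le> K" "\<And>x. cmod (F x) \<le> K"
  using assms unfolding bounded_borel_def by (metis norm_ge_zero order_trans)

lemma bounded_borel_const [simp]: "bounded_borel (\<lambda>x. c)"
  by (rule bounded_borelI[of _ "cmod c"]) auto

lemma bounded_borel_add:
  assumes "bounded_borel F" "bounded_borel G" shows "bounded_borel (\<lambda>x. F x + G x)"
proof -
  obtain K L where "\<And>x. cmod (F x) \<le> K" "\<And>x. cmod (G x) \<le> L"
    using assms bounded_borel_bound by metis
  then have "cmod (F x + G x) \<le> K + L" for x by (meson add_mono norm_triangle_le)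
  then show ?thesis using assms
    by (intro bounded_borelI[of _ "K + L"] borel_measurable_add) (auto simp: bounded_borel_def)
qed

lemma bounded_borel_mult:
  assumes "bounded_borel F" "bounded_borel G" shows "bounded_borel (\<lambda>x. F x * G x)"
proof -
  obtain K L where K: "0 \<le> K" "\<And>x. cmod (F x) \<le> K" and L: "\<And>x. cmod (G x) \<le> L"
    using assms bounded_borel_bound by metis
  then have "cmod (F x * G x) \<le> K * L" for x by (simp add: norm_mult mult_mono)
  then show ?thesis using assms
    by (intro bounded_borelI[of _ "K * L"] borel_measurable_times) (auto simp: bounded_borel_def)
qed

lemma bounded_borel_diff:
  assumes "bounded_borel F" "bounded_borel G" shows "bounded_borel (\<lambda>x. F x - G x)"
  using bounded_borel_add[OF assms(1) bounded_borel_mult[OF bounded_borel_const[of "-1"] assms(2)]] by simp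

lemma bounded_borel_cnj:
  assumes "bounded_borel F" shows "bounded_borel (\<lambda>x. cnj (F x))"
proof -
  have "cnj \<in> borel_measurable borel" by (intro borel_measurable_continuous_onI continuous_intros)
  then have "(\<lambda>x. cnj (F x)) \<in> borel_measurable borel"
    using measurable_compose[OF bounded_borel_measurable[OF assms]] by blast
  then show ?thesis using assms by (simp add: bounded_borel_def)
qed

lemma bounded_borel_power: "bounded_borel F \<Longrightarrow> bounded_borel (\<lambda>x. F x ^ n)"
  by (induction n) (simp_all add: bounded_borel_mult)

lemma bounded_borel_indicator: "S \<in> sets borel \<Longrightarrow> bounded_borel (indicator S)"
  by (rule bounded_borelI[of _ 1]) (auto simp: indicator_def)

lemma bounded_borel_sum: "(\<And>i. i \<in> I \<Longrightarrow> bounded_borel (F i)) \<Longrightarrow> bounded_borel (\<lambda>x. \<Sum>i\<in>I. F i x)"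
proof (induction I rule: infinite_finite_induct)
  case (insert i I)
  have "bounded_borel (\<lambda>x. F i x + (\<Sum>i\<in>I. F i x))"
    by (rule bounded_borel_add[OF insert.prems insert.IH]) (simp_all add: insert.prems)
  then show ?case using insert.hyps by simp
qed simp_all

lemma bounded_borel_limit:
  assumes "\<And>n. bounded_borel (Fs n)" "\<And>n x. cmod (Fs n x) \<le> K" "\<And>x. (\<lambda>n. Fs n x) \<longlonglongrightarrow> F x"
  shows "bounded_borel F"
proof (rule bounded_borelI)
  show "F \<in> borel_measurable borel"
    by (rule borel_measurable_LIMSEQ_metric[OF bounded_borel_measurable[OF assms(1)] assms(3)])
  show "cmod (F x) \<le> K" for x
    by (rule LIMSEQ_le_const2[OF tendsto_norm[OF assms(3)]]) (simp add: assms(2))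
qed

definition bounded_closed :: "((real \<Rightarrow> complex) \<Rightarrow> bool) \<Rightarrow> bool" where
  "bounded_closed P \<longleftrightarrow> P (\<lambda>_. 0)
    \<and> (\<forall>F G. bounded_borel F \<longrightarrow> bounded_borel G \<longrightarrow> P F \<longrightarrow> P G \<longrightarrow> P (\<lambda>x. F x + G x))
    \<and> (\<forall>c F. bounded_borel F \<longrightarrow> P F \<longrightarrow> P (\<lambda>x. c * F x))
    \<and> (\<forall>Fs F K. (\<forall>n. bounded_borel (Fs n)) \<longrightarrow> bounded_borel F \<longrightarrow> (\<forall>n. P (Fs n)) \<longrightarrow> (\<forall>n x. cmod (Fs n x) \<le> K)
        \<longrightarrow> (\<forall>x. (\<lambda>n. Fs n x) \<longlonglongrightarrow> F x) \<longrightarrow> P F)"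

text \<open>The conclusion of the functional monotone class theorem is turned into a property of the
  generating set, so that one induction scheme can start from indicators, from half-lines or from
  Cayley monomials.\<close>

definition generates_borel :: "(real \<Rightarrow> complex) set \<Rightarrow> bool" where
  "generates_borel \<G> \<longleftrightarrow> (\<forall>G\<in>\<G>. bounded_borel G)
     \<and> (\<forall>P. bounded_closed P \<longrightarrow> (\<forall>G\<in>\<G>. P G) \<longrightarrow> (\<forall>F. bounded_borel F \<longrightarrow> P F))"

lemma bounded_closedI:
  assumes "P (\<lambda>_. 0)"
    "\<And>F G. bounded_borel F \<Longrightarrow> bounded_borel G \<Longrightarrow> P F \<Longrightarrow> P G \<Longrightarrow> P (\<lambda>x. F x + G x)"
    "\<And>c F. bounded_borel F \<Longrightarrow> P F \<Longrightarrow> P (\<lambda>x. c * F x)"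
    "\<And>Fs F K. (\<And>n. bounded_borel (Fs n)) \<Longrightarrow> bounded_borel F \<Longrightarrow> (\<And>n. P (Fs n)) \<Longrightarrow> (\<And>n x. cmod (Fs n x) \<le> K)
        \<Longrightarrow> (\<And>x. (\<lambda>n. Fs n x) \<longlonglongrightarrow> F x) \<Longrightarrow> P F"
  shows "bounded_closed P"
  unfolding bounded_closed_def
proof (intro conjI allI impI)
  fix Fs F K
  assume "\<forall>n. bounded_borel (Fs n)" "bounded_borel F" "\<forall>n. P (Fs n)" "\<forall>n x. cmod (Fs n x) \<le> K"
    "\<forall>x. (\<lambda>n. Fs n x) \<longlonglongrightarrow> F x"
  then show "P F" using assms(4)[of Fs F K] by blast
qed (use assms in blast)+

lemma bounded_closedD:
  assumes "bounded_closed P"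
  shows "P (\<lambda>_. 0)"
    "bounded_borel F \<Longrightarrow> bounded_borel G \<Longrightarrow> P F \<Longrightarrow> P G \<Longrightarrow> P (\<lambda>x. F x + G x)"
    "bounded_borel F \<Longrightarrow> P F \<Longrightarrow> P (\<lambda>x. c * F x)"
    "(\<And>n. bounded_borel (Fs n)) \<Longrightarrow> (\<And>n. P (Fs n)) \<Longrightarrow> (\<And>n x. cmod (Fs n x) \<le> K)
        \<Longrightarrow> (\<And>x. (\<lambda>n. Fs n x) \<longlonglongrightarrow> F x) \<Longrightarrow> P F"
proof -
  show "P (\<lambda>_. 0)" using assms by (simp add: bounded_closed_def)
  show "bounded_borel F \<Longrightarrow> bounded_borel G \<Longrightarrow> P F \<Longrightarrow> P G \<Longrightarrow> P (\<lambda>x. F x + G x)"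
    using assms unfolding bounded_closed_def by blast
  show "bounded_borel F \<Longrightarrow> P F \<Longrightarrow> P (\<lambda>x. c * F x)"
    using assms unfolding bounded_closed_def by blast
  show "P F" if "\<And>n. bounded_borel (Fs n)" "\<And>n. P (Fs n)" "\<And>n x. cmod (Fs n x) \<le> K"
    "\<And>x. (\<lambda>n. Fs n x) \<longlonglongrightarrow> F x"
    using assms that bounded_borel_limit[of Fs K F] unfolding bounded_closed_def by blast
qed

lemma bounded_closed_sum:
  assumes "bounded_closed P" "finite I" "\<And>i. i \<in> I \<Longrightarrow> bounded_borel (F i) \<and> P (F i)"
  shows "P (\<lambda>x. \<Sum>i\<in>I. F i x)"
  using assms(2,3)
proof (induction I)
  case empty then show ?case using bounded_closedD(1)[OF assms(1)] by simp
next
  case (insert i I)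
  then have "P (\<lambda>x. F i x + (\<Sum>i\<in>I. F i x))"
    by (intro bounded_closedD(2)[OF assms(1)] bounded_borel_sum) auto
  then show ?case using insert by simp
qed

lemma bounded_closed_diff:
  assumes "bounded_closed P" "bounded_borel F" "bounded_borel G" "P F" "P G"
  shows "P (\<lambda>x. F x - G x)"
  using bounded_closedD(2)[OF assms(1,2) bounded_borel_mult[OF bounded_borel_const[of "-1"] assms(3)] assms(4)
      bounded_closedD(3)[OF assms(1,3,5)]] by simp

lemma generates_borelD:
  "generates_borel \<G> \<Longrightarrow> bounded_closed P \<Longrightarrow> (\<And>G. G \<in> \<G> \<Longrightarrow> P G) \<Longrightarrow> bounded_borel F \<Longrightarrow> P F"
  unfolding generates_borel_def by blast

text \<open>Every bounded Borel function is a pointwise limit of simple functions dominated by twice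
  its absolute value.\<close>

lemma generates_borel_indicators: "generates_borel {indicator S | S. S \<in> sets borel}"
  unfolding generates_borel_def
proof (intro conjI allI impI ballI)
  fix P F assume P: "bounded_closed P" "\<forall>G\<in>{indicator S |S. S \<in> sets borel}. P G" and F: "bounded_borel F"
  obtain K where K: "\<And>x. cmod (F x) \<le> K" using F bounded_borel_bound by metis
  obtain s where s: "\<And>n. simple_function borel (s n)" "\<And>x. (\<lambda>n. s n x) \<longlonglongrightarrow> F x"
      "\<And>n x. dist (s n x) 0 \<le> 2 * dist (F x) 0"
    using borel_measurable_implies_sequence_metric[OF bounded_borel_measurable[OF F], of 0] by auto
  have "bounded_borel (s n) \<and> P (s n)" for n
  proof -
    have fin: "finite (range (s n))" using s(1)[of n] by (simp add: simple_function_def)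
    have eq: "s n = (\<lambda>x. \<Sum>y\<in>range (s n). y * indicator (s n -` {y}) x)"
    proof
      fix x
      have "(\<Sum>y\<in>range (s n). y * indicator (s n -` {y}) x) = (\<Sum>y\<in>range (s n). if y = s n x then y else 0)"
        by (intro sum.cong) (auto simp: indicator_def)
      then show "s n x = (\<Sum>y\<in>range (s n). y * indicator (s n -` {y}) x)" using fin by simp
    qed
    have m: "s n -` {y} \<in> sets borel" for y
      using measurable_sets[OF borel_measurable_simple_function[OF s(1)], of "{y}" n] by simp
    have b: "bounded_borel (\<lambda>x. y * indicator (s n -` {y}) x)" for y
      by (intro bounded_borel_mult bounded_borel_const bounded_borel_indicator m)
    have "P (\<lambda>x. y * indicator (s n -` {y}) x)" for y
      using P m by (intro bounded_closedD(3)[OF P(1)] bounded_borel_indicator) auto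
    then have "P (s n)"
      by (subst eq, intro bounded_closed_sum[OF P(1)] fin conjI b)
    moreover have "bounded_borel (s n)" by (subst eq) (rule bounded_borel_sum[OF b])
    ultimately show ?thesis by blast
  qed
  moreover have "cmod (s n x) \<le> 2 * K" for n x using s(3)[of n x] K[of x] by (simp add: dist_norm)
  ultimately show "P F" using bounded_closedD(4)[OF P(1), of s "2 * K" F] s(2) by blast
qed (auto intro: bounded_borel_indicator)

text \<open>Open half-lines are stable under intersection and generate the Borel sets, so Dynkin's
  pi-lambda theorem applies to the sets whose indicators satisfy P. The constant 1 handles
  complements.\<close>

lemma generates_borel_halflines: "generates_borel (insert (\<lambda>_. 1) (range (\<lambda>a. indicator {a<..})))"
  unfolding generates_borel_def
proof (intro conjI allI impI ballI)
  fix P F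
  assume P: "bounded_closed P" "\<forall>G\<in>insert (\<lambda>_. 1) (range (\<lambda>a::real. indicator {a<..})). P G"
    and F: "bounded_borel F"
  have eq: "sets (borel :: real measure) = sigma_sets UNIV (range greaterThan)"
    unfolding borel_Ioi by (simp add: sets_measure_of)
  have ind: "P (indicator S)" if "S \<in> sets borel" for S
  proof -
    have "Int_stable (range (greaterThan :: real \<Rightarrow> real set))"
      unfolding Int_stable_def
    proof (intro ballI)
      fix A B :: "real set" assume "A \<in> range greaterThan" "B \<in> range greaterThan"
      then obtain a b where "A = {a<..}" "B = {b<..}" by auto
      then have "A \<inter> B = {max a b<..}" by auto
      then show "A \<inter> B \<in> range greaterThan" by blast
    qed
    moreover have "range greaterThan \<subseteq> Pow (UNIV :: real set)" by simp
    moreover have "S \<in> sigma_sets UNIV (range greaterThan)" using that eq by simp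
    ultimately show ?thesis
    proof (induction S rule: sigma_sets_induct_disjoint)
      case (basic A) then show ?case using P(2) by auto
    next
      case empty
      then show ?case using bounded_closedD(1)[OF P(1)] by (simp add: indicator_def[abs_def])
    next
      case (compl A)
      then have "P (\<lambda>x. 1 - indicator A x)"
        using P(2) eq by (intro bounded_closed_diff[OF P(1)] bounded_borel_indicator) auto
      then show ?case by (simp add: indicator_compl Compl_eq_Diff_UNIV[symmetric])
    next
      case (union A)
      then have A: "\<And>i. A i \<in> sets borel" using eq by auto
      have e: "(\<Sum>i<n. indicator (A i) x) = (indicator (\<Union>i<n. A i) x :: complex)" for n x
        using union(1) by (intro indicator_UN_disjoint[symmetric]) (auto simp: disjoint_family_on_def)
      show ?case
      proof (rule bounded_closedD(4)[OF P(1)])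
        show "bounded_borel (\<lambda>x. \<Sum>i<n. indicator (A i) x)" for n
          by (intro bounded_borel_sum bounded_borel_indicator A)
        show "P (\<lambda>x. \<Sum>i<n. indicator (A i) x)" for n
          using A union by (intro bounded_closed_sum[OF P(1)]) (auto intro: bounded_borel_indicator)
        show "cmod (\<Sum>i<n. indicator (A i) x) \<le> 1" for n x
          unfolding e by (simp add: indicator_def)
        show "(\<lambda>n. \<Sum>i<n. indicator (A i) x) \<longlonglongrightarrow> (indicator (\<Union> (range A)) x :: complex)" for x
        proof -
          have i: "complex_of_real (indicator T x) = indicator T x" for T :: "real set" by (simp add: indicator_def)
          have "(\<lambda>i. indicator (A i) x :: real) sums indicator (\<Union>i. A i) x"
            using union(1) by (intro indicator_sums) (auto simp: disjoint_family_on_def)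
          then have "(\<lambda>i. complex_of_real (indicator (A i) x)) sums complex_of_real (indicator (\<Union>i. A i) x)"
            by (rule sums_of_real)
          then show ?thesis by (simp only: i sums_def)
        qed
      qed
    qed
  qed
  then show "P F"
    using generates_borelD[OF generates_borel_indicators P(1) _ F] by blast
qed (auto intro: bounded_borel_indicator)

section \<open>The Cayley function on the real line and its monomials\<close>

definition cayley :: "real \<Rightarrow> complex" where
  "cayley x = (of_real x - \<i>) / (of_real x + \<i>)"

lemma of_real_add_ii_nonzero [simp]:
  "complex_of_real x + \<i> \<noteq> 0" "\<i> + complex_of_real x \<noteq> 0" "complex_of_real x \<noteq> \<i>"
  by (auto simp: complex_eq_iff)

lemma norm_cayley [simp]: "cmod (cayley x) = 1"
proof -
  have "cmod (of_real x - \<i>) = cmod (of_real x + \<i>)" by (simp add: cmod_def)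
  then show ?thesis by (simp add: cayley_def norm_divide)
qed

lemma bounded_borel_cayley: "bounded_borel cayley"
proof (rule bounded_borelI[of _ 1])
  show "cayley \<in> borel_measurable borel"
    unfolding cayley_def[abs_def] by (intro borel_measurable_continuous_onI continuous_intros) simp
qed simp

lemma bounded_borel_cayley_power: "bounded_borel (\<lambda>x. cayley x ^ j * cnj (cayley x) ^ k)"
  by (intro bounded_borel_mult bounded_borel_power bounded_borel_cnj bounded_borel_cayley)

text \<open>The arguments of u and v lie strictly between -pi/2 and pi/2, so their difference stays
  in the principal strip.\<close>

lemma Ln_divide_right_half:
  assumes "0 < Re u" "0 < Re v" shows "Ln (u / v) = Ln u - Ln v"
proof (rule Ln_unique)
  have "u \<noteq> 0" "v \<noteq> 0" using assms by auto
  then show "exp (Ln u - Ln v) = u / v" by (simp add: exp_diff)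
  have "\<bar>Im (Ln u)\<bar> < pi/2" "\<bar>Im (Ln v)\<bar> < pi/2"
    using assms \<open>u \<noteq> 0\<close> \<open>v \<noteq> 0\<close> Re_Ln_pos_lt by blast+
  then show "- pi < Im (Ln u - Ln v)" "Im (Ln u - Ln v) \<le> pi" by auto
qed

text \<open>The closed unit disc touches the line Re z = 1 only at 1. Hence 1 - z stays in the right
  half-plane, where Ln is continuous.\<close>

lemma Re_one_minus_pos:
  assumes "cmod z \<le> 1" "z \<noteq> 1" shows "0 < Re (1 - z)"
proof (rule ccontr)
  assume "\<not> 0 < Re (1 - z)"
  then have 1: "1 \<le> Re z" by simp
  then have "Re z = 1" using complex_Re_le_cmod[of z] assms(1) by linarith
  moreover have "(Re z)\<^sup>2 + (Im z)\<^sup>2 \<le> 1" using assms(1) by (simp add: cmod_def)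
  ultimately have "Im z = 0" "Re z = 1" by simp_all
  then show False using assms(2) by (simp add: complex_eq_iff)
qed

text \<open>
  The Abel sums of the logarithmic series of \<open>1 - \<omega> cayley x\<close> are boundedly convergent, and the
  imaginary part of the limit for \<open>\<omega> = 1 / cayley a\<close>, minus the one for \<open>\<omega> = 1\<close>,
  has a single jump of height \<open>\<pi>\<close> at \<open>a\<close>.
\<close>

lemma generates_borel_cayley:
  "generates_borel (range (\<lambda>(j::nat, k::nat). (\<lambda>x. cayley x ^ j * cnj (cayley x) ^ k)))"
  unfolding generates_borel_def
proof (intro conjI allI impI ballI)
  fix P F
  assume P: "bounded_closed P"
    "\<forall>G\<in>range (\<lambda>(j::nat, k::nat). (\<lambda>x. cayley x ^ j * cnj (cayley x) ^ k)). P G" and F: "bounded_borel F"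
  have jk: "P (\<lambda>x. cayley x ^ j * cnj (cayley x) ^ k)" for j k using P(2) by force
  have bc: "bounded_borel (\<lambda>x. c * cayley x ^ j)" "bounded_borel (\<lambda>x. c * cnj (cayley x) ^ j)" for c j
    by (intro bounded_borel_mult bounded_borel_const bounded_borel_power bounded_borel_cnj bounded_borel_cayley)+
  have Pc: "P (\<lambda>x. c * cayley x ^ j)" "P (\<lambda>x. c * cnj (cayley x) ^ j)" for c j
    using bounded_closedD(3)[OF P(1) bounded_borel_cayley_power jk, of c j 0]
      bounded_closedD(3)[OF P(1) bounded_borel_cayley_power jk, of c 0 j] by simp_all
  have one: "P (\<lambda>x. c)" for c using Pc(1)[of c 0] by simp
  \<comment> \<open>Partial sums of Ln (1 - r \<omega> \<open>cayley x\<close>); the term k = 0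
    vanishes because division by zero gives zero.\<close>
  define s where "s r \<omega> n x = (\<Sum>k<n. (- ((of_real r * \<omega>) ^ k) / of_nat k) * cayley x ^ k)" for r \<omega> n x
  have abel: "bounded_borel (\<lambda>x. of_real (Im (Ln (1 - of_real r * \<omega> * cayley x))))
      \<and> P (\<lambda>x. of_real (Im (Ln (1 - of_real r * \<omega> * cayley x))))"
    if r: "0 < r" "r < 1" and \<omega>: "cmod \<omega> = 1" for r \<omega>
  proof -
    have bd: "cmod (s r \<omega> n x) \<le> 1 / (1 - r)" for n x
    proof -
      have "cmod (s r \<omega> n x) \<le> (\<Sum>k<n. r ^ k)"
        unfolding s_def
      proof (rule sum_norm_le)
        fix k
        have "cmod ((- ((of_real r * \<omega>) ^ k) / of_nat k) * cayley x ^ k) = r ^ k / of_nat k"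
          using r \<omega> by (simp add: norm_mult norm_divide norm_power)
        also have "\<dots> \<le> r ^ k" using r by (cases k) (auto simp: field_simps)
        finally show "cmod ((- ((of_real r * \<omega>) ^ k) / of_nat k) * cayley x ^ k) \<le> r ^ k" .
      qed
      also have "\<dots> \<le> 1 / (1 - r)"
        using r sum_le_suminf[of "\<lambda>k. r ^ k" "{..<n}"] by (simp add: suminf_geometric summable_geometric)
      finally show ?thesis .
    qed
    have lim: "(\<lambda>n. s r \<omega> n x) \<longlonglongrightarrow> Ln (1 - of_real r * \<omega> * cayley x)" for x
    proof -
      have "cmod (- (of_real r * \<omega> * cayley x)) < 1" using r \<omega> by (simp add: norm_mult)
      from Ln_series'[OF this] show ?thesis
        by (simp add: sums_def s_def power_mult_distrib)
    qed
    have bs: "bounded_borel (s r \<omega> n)" "P (s r \<omega> n)" for n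
      unfolding s_def[abs_def]
      by (intro bounded_borel_sum bc) (intro bounded_closed_sum[OF P(1)] conjI finite_lessThan bc Pc)
    have cs: "(\<lambda>x. cnj (s r \<omega> n x)) = (\<lambda>x. \<Sum>k<n. cnj (- ((of_real r * \<omega>) ^ k) / of_nat k) * cnj (cayley x) ^ k)" for n
      by (simp add: s_def)
    have bs': "bounded_borel (\<lambda>x. cnj (s r \<omega> n x))" "P (\<lambda>x. cnj (s r \<omega> n x))" for n
      unfolding cs by (intro bounded_borel_sum bc) (intro bounded_closed_sum[OF P(1)] conjI finite_lessThan bc Pc)
    have L: "bounded_borel (\<lambda>x. Ln (1 - of_real r * \<omega> * cayley x))" "P (\<lambda>x. Ln (1 - of_real r * \<omega> * cayley x))"
      using bounded_borel_limit[OF bs(1) bd lim] bounded_closedD(4)[OF P(1) bs bd lim] .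
    have bd': "cmod (cnj (s r \<omega> n x)) \<le> 1 / (1 - r)" for n x using bd by simp
    have lim': "(\<lambda>n. cnj (s r \<omega> n x)) \<longlonglongrightarrow> cnj (Ln (1 - of_real r * \<omega> * cayley x))" for x
      by (intro tendsto_cnj lim)
    have L': "bounded_borel (\<lambda>x. cnj (Ln (1 - of_real r * \<omega> * cayley x)))"
      "P (\<lambda>x. cnj (Ln (1 - of_real r * \<omega> * cayley x)))"
      using bounded_borel_limit[OF bs'(1) bd' lim'] bounded_closedD(4)[OF P(1) bs' bd' lim'] .
    \<comment> \<open>The imaginary part combines the logarithm with its conjugate, which is why the
      generating set contains powers of the conjugate Cayley function.\<close>
    have im: "of_real (Im z) = (1 / (2 * \<i>)) * (z - cnj z)" for z by (simp add: complex_eq_iff)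
    show ?thesis unfolding im
      by (intro conjI bounded_borel_mult bounded_borel_const bounded_borel_diff bounded_closedD(3)[OF P(1)]
          bounded_closed_diff[OF P(1)] L L')
  qed
  \<comment> \<open>At the singular point the Abel means are logarithms of the positive numbers 1 -
    r, so the imaginary parts there tend to 0.\<close>
  define \<Theta> where "\<Theta> \<omega> x = (if \<omega> * cayley x = 1 then 0 else Im (Ln (1 - \<omega> * cayley x)))" for \<omega> x
  have \<Theta>_le: "\<bar>\<Theta> \<omega> x\<bar> \<le> pi" for \<omega> x
    using mpi_less_Im_Ln[of "1 - \<omega> * cayley x"] Im_Ln_le_pi[of "1 - \<omega> * cayley x"]
    by (cases "1 - \<omega> * cayley x = 0") (auto simp: \<Theta>_def)
  have \<Theta>: "bounded_borel (\<lambda>x. of_real (\<Theta> \<omega> x))" "P (\<lambda>x. of_real (\<Theta> \<omega> x))" if \<omega>: "cmod \<omega> = 1" for \<omega>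
  proof -
    define r where "r n = 1 - inverse (real (Suc (Suc n)))" for n
    have r: "0 < r n" "r n < 1" for n by (auto simp: r_def field_simps)
    have rlim: "r \<longlonglongrightarrow> 1"
    proof -
      have "(\<lambda>n. 1 - inverse (real (Suc (Suc n)))) \<longlonglongrightarrow> 1 - 0"
        by (intro tendsto_diff tendsto_const LIMSEQ_Suc[OF LIMSEQ_inverse_real_of_nat])
      then show ?thesis by (simp add: r_def[abs_def])
    qed
    have lim: "(\<lambda>n. complex_of_real (Im (Ln (1 - of_real (r n) * \<omega> * cayley x)))) \<longlonglongrightarrow> of_real (\<Theta> \<omega> x)" for x
    proof (cases "\<omega> * cayley x = 1")
      case True
      have "1 - of_real (r n) * \<omega> * cayley x = of_real (1 - r n)" for n
        using True by (simp add: mult.assoc)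
      then have "Im (Ln (1 - of_real (r n) * \<omega> * cayley x)) = 0" for n
        using r[of n] by (simp only:) (rule Im_Ln_of_real, simp)
      then show ?thesis using True by (simp add: \<Theta>_def)
    next
      case False
      then have "0 < Re (1 - \<omega> * cayley x)" using \<omega> by (intro Re_one_minus_pos) (auto simp: norm_mult)
      then have nn: "1 - \<omega> * cayley x \<notin> \<real>\<^sub>\<le>\<^sub>0" by (auto simp: complex_nonpos_Reals_iff)
      have "(\<lambda>n. 1 - of_real (r n) * \<omega> * cayley x) \<longlonglongrightarrow> 1 - of_real 1 * \<omega> * cayley x"
        by (intro tendsto_intros rlim)
      then have "(\<lambda>n. Ln (1 - of_real (r n) * \<omega> * cayley x)) \<longlonglongrightarrow> Ln (1 - \<omega> * cayley x)"
        using nn by (intro tendsto_Ln) auto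
      then show ?thesis using False by (auto simp: \<Theta>_def intro!: tendsto_of_real tendsto_Im)
    qed
    have bd: "cmod (complex_of_real (Im (Ln (1 - of_real (r n) * \<omega> * cayley x)))) \<le> pi" for n x
    proof -
      have "cmod (of_real (r n) * \<omega> * cayley x) < 1" using \<omega> r[of n] by (simp add: norm_mult)
      then have "1 - of_real (r n) * \<omega> * cayley x \<noteq> 0" by auto
      then show ?thesis
        using mpi_less_Im_Ln[of "1 - of_real (r n) * \<omega> * cayley x"] Im_Ln_le_pi[of "1 - of_real (r n) * \<omega> * cayley x"]
        by auto
    qed
    show "bounded_borel (\<lambda>x. of_real (\<Theta> \<omega> x))" "P (\<lambda>x. of_real (\<Theta> \<omega> x))"
      using bounded_borel_limit[OF _ bd lim] bounded_closedD(4)[OF P(1) _ _ bd lim] abel[OF r \<omega>] by auto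
  qed
  \<comment> \<open>The numbers 1 - \<omega> \<open>cayley x\<close> for \<omega> = 1 /
    \<open>cayley a\<close> and for \<omega> = 1 have the quotient (a - x) / (a - i). Its argument
    is that of 1 / (a - i) for x < a and smaller by pi for x > a. Subtracting it from the value on
    the left and dividing by pi gives the indicator of x > a, except at x = a.\<close>
  define g where "g a x = (Im (Ln (1 / (of_real a - \<i>))) - (\<Theta> (1 / cayley a) x - \<Theta> 1 x)) / pi" for a x
  have g: "bounded_borel (\<lambda>x. of_real (g a x))" "P (\<lambda>x. of_real (g a x))" for a
  proof -
    have e: "complex_of_real (g a x) = (1 / complex_of_real pi) * (complex_of_real (Im (Ln (1 / (of_real a - \<i>))))
        - (complex_of_real (\<Theta> (1 / cayley a) x) - complex_of_real (\<Theta> 1 x)))" for x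
      by (simp add: g_def field_simps)
    have n: "cmod (1 / cayley a) = 1" "cmod 1 = 1" by (simp_all add: norm_divide)
    show "bounded_borel (\<lambda>x. of_real (g a x))" "P (\<lambda>x. of_real (g a x))"
      unfolding e
      by (intro bounded_borel_mult bounded_borel_const bounded_borel_diff bounded_closedD(3)[OF P(1)]
          bounded_closed_diff[OF P(1)] \<Theta> n one)+
  qed
  have gval: "g a x = indicator {a<..} x" if "x \<noteq> a" for a x
  proof -
    define u where "u = 1 - 1 / cayley a * cayley x"
    define v where "v = 1 - 1 * cayley x"
    have v: "v = 2 * \<i> / (of_real x + \<i>)" by (simp add: v_def cayley_def divide_simps)
    have c0: "cayley a \<noteq> 0" using norm_cayley[of a] by force
    have u: "u = v * ((of_real a - of_real x) / (of_real a - \<i>))"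
      unfolding v unfolding u_def cayley_def by (simp add: divide_simps) (simp add: algebra_simps)
    have v0: "v \<noteq> 0" by (simp add: v)
    have u0: "u \<noteq> 0" using that by (simp add: u v0)
    have Re: "0 < Re u" "0 < Re v" unfolding u_def v_def
      using u0 v0 by (intro Re_one_minus_pos; auto simp: norm_mult norm_divide u_def v_def)+
    have uv: "Im (Ln u) - Im (Ln v) = Im (Ln ((of_real a - of_real x) / (of_real a - \<i>)))"
      using Ln_divide_right_half[OF Re] u v0 by (metis minus_complex.sel(2) nonzero_mult_div_cancel_left)
    have "\<Theta> (1 / cayley a) x = Im (Ln u)" using u0 by (auto simp: \<Theta>_def u_def)
    moreover have "\<Theta> 1 x = Im (Ln v)" using v0 by (auto simp: \<Theta>_def v_def)
    ultimately have gg: "g a x = (Im (Ln (1 / (of_real a - \<i>)))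
        - Im (Ln ((of_real a - of_real x) / (of_real a - \<i>)))) / pi" by (simp add: g_def uv)
    define w where "w = 1 / (complex_of_real a - \<i>)"
    have w0: "w \<noteq> 0" by (simp add: w_def)
    have Imw: "0 < Im w" by (simp add: w_def Im_divide) (metis add.commute less_add_one add_pos_nonneg zero_le_power2 zero_less_one)
    show ?thesis
    proof (cases "x < a")
      case True
      have "(of_real a - of_real x) / (of_real a - \<i>) = of_real (a - x) * w" by (simp add: w_def)
      then have "Im (Ln ((of_real a - of_real x) / (of_real a - \<i>))) = Im (Ln w)"
        using Ln_times_of_real[of "a - x" w] Im_Ln_of_real[of "a - x"] w0 True by (simp del: of_real_diff)
      then show ?thesis using True by (simp add: gg w_def)
    next
      case False
      have "(of_real a - of_real x) / (of_real a - \<i>) = of_real (x - a) * (- w)"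
        by (simp only: w_def of_real_diff mult_minus_right times_divide_eq_right mult_1_right
            minus_divide_left minus_diff_eq)
      then have "Im (Ln ((of_real a - of_real x) / (of_real a - \<i>))) = Im (Ln (- w))"
        using Ln_times_of_real[of "x - a" "- w"] Im_Ln_of_real[of "x - a"] w0 False that by (simp del: of_real_diff)
      also have "\<dots> = Im (Ln w) - pi" using Ln_minus[OF w0] Imw by simp
      finally show ?thesis using False that by (simp add: gg w_def)
    qed
  qed
  have "P (indicator {a<..})" for a
  proof (rule bounded_closedD(4)[OF P(1) g])
    \<comment> \<open>The value of \<open>g a\<close> at a itself is not controlled. With jump
      points \<open>A n\<close> decreasing to a, every x \<le> a lies strictly to the left of all
      jumps and every x > a is eventually to their right.\<close>
    define A where "A n = a + inverse (real (Suc n))" for n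
    have A: "a < A n" for n by (simp add: A_def)
    have Alim: "A \<longlonglongrightarrow> a" using tendsto_add[OF tendsto_const LIMSEQ_inverse_real_of_nat, of a] by (simp add: A_def[abs_def])
    show "cmod (of_real (g (A n) x)) \<le> 3" for n x
    proof -
      have "\<bar>Im (Ln (1 / (of_real (A n) - \<i>)))\<bar> \<le> pi"
        using mpi_less_Im_Ln[of "1 / (of_real (A n) - \<i>)"] Im_Ln_le_pi[of "1 / (of_real (A n) - \<i>)"] by simp
      \<comment> \<open>Three imaginary parts of logarithms, each at most pi in absolute
        value.\<close>
      then have "\<bar>Im (Ln (1 / (of_real (A n) - \<i>))) - (\<Theta> (1 / cayley (A n)) x - \<Theta> 1 x)\<bar> \<le> 3 * pi"
        using \<Theta>_le[of "1 / cayley (A n)" x] \<Theta>_le[of 1 x] by linarith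
      then have "\<bar>g (A n) x\<bar> \<le> 3" by (simp add: g_def abs_divide pos_divide_le_eq)
      then show ?thesis by simp
    qed
    show "(\<lambda>n. complex_of_real (g (A n) x)) \<longlonglongrightarrow> indicator {a<..} x" for x
    proof (cases "a < x")
      case True
      then have "\<forall>\<^sub>F n in sequentially. A n < x" using Alim order_tendstoD(2) by blast
      then have "\<forall>\<^sub>F n in sequentially. complex_of_real (g (A n) x) = indicator {a<..} x"
        by eventually_elim (use True gval in auto)
      then show ?thesis by (rule tendsto_eventually)
    next
      case False
      then have "complex_of_real (g (A n) x) = indicator {a<..} x" for n
        using A[of n] gval[of x "A n"] by auto
      then show ?thesis by simp
    qed
  qed
  then show "P F"
    using generates_borelD[OF generates_borel_halflines P(1) _ F] one[of 1] by auto
qed (auto intro: bounded_borel_cayley_power)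

lemma generates_borel_bounded: "generates_borel \<G> \<Longrightarrow> G \<in> \<G> \<Longrightarrow> bounded_borel G"
  by (simp add: generates_borel_def)

section \<open>Measures from the moments of an isometry\<close>

lemma bounded_op_funpow: "bounded_op U \<Longrightarrow> bounded_op (U ^^ k)"
proof (induction k)
  case 0 then show ?case using bounded_op_id by (simp add: id_def)
next
  case (Suc k) then show ?case using bounded_op_comp[of U "U ^^ k"] by (simp add: comp_def)
qed

lemma isometry_funpow:
  fixes U :: "'a::chilbert \<Rightarrow> 'a"
  assumes "\<And>x y. hinner (U x) (U y) = hinner x y"
  shows "hinner ((U ^^ (k + j)) x) ((U ^^ (l + j)) y) = hinner ((U ^^ k) x) ((U ^^ l) y)"
proof (induction j)
  case (Suc j)
  have "(U ^^ (m + Suc j)) z = U ((U ^^ (m + j)) z)" for m z by simp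
  then show ?case using Suc assms by (simp only:)
qed simp

lemma hinner_sum_left: "hinner (\<Sum>k\<in>I. f k) (y::'a::chilbert) = (\<Sum>k\<in>I. hinner (f k) y)"
  by (induction I rule: infinite_finite_induct) (simp_all add: hinner_add_left)

lemma hinner_sum_right: "hinner (y::'a::chilbert) (\<Sum>k\<in>I. f k) = (\<Sum>k\<in>I. hinner y (f k))"
  by (induction I rule: infinite_finite_induct) (simp_all add: hinner_add_right)

section \<open>Fejer densities and the trigonometric moment problem\<close>

lemma integral_cis_period:
  "has_bochner_integral lborel (\<lambda>t. indicator {0..2 * pi} t *\<^sub>R cis (of_int m * t))
     (if m = 0 then complex_of_real (2 * pi) else 0)"
proof -
  have c: "continuous_on {0..2 * pi} (\<lambda>t. cis (of_int m * t))" by (intro continuous_intros)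
  have i: "integrable lborel (\<lambda>t. indicator {0..2 * pi} t *\<^sub>R cis (of_int m * t))"
    using borel_integrable_atLeastAtMost'[OF c] by (simp add: set_integrable_def)
  have "integral\<^sup>L lborel (\<lambda>t. indicator {0..2 * pi} t *\<^sub>R cis (of_int m * t))
     = (if m = 0 then complex_of_real (2 * pi) else 0)"
  proof (cases "m = 0")
    case True
    have "integral\<^sup>L lborel (\<lambda>t. indicator {0..2 * pi} t *\<^sub>R cis (of_int m * t))
       = complex_of_real (2 * pi) - complex_of_real 0"
      using True by (intro integral_FTC_atLeastAtMost c)
        (auto intro!: derivative_eq_intros simp: has_vector_derivative_of_real[OF DERIV_ident, simplified])
    then show ?thesis using True by simp
  next
    case False
    define F where "F t = cis (of_int m * t) / (\<i> * of_int m)" for t :: real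
    have d: "(F has_vector_derivative cis (of_int m * t)) (at t within S)" for t S
    proof -
      have "((\<lambda>z. exp (\<i> * of_int m * z) / (\<i> * of_int m)) has_field_derivative exp (\<i> * of_int m * of_real t)) (at (of_real t))"
        using False by (auto intro!: derivative_eq_intros)
      from has_vector_derivative_real_field[OF this, of S] show ?thesis
        by (simp add: F_def[abs_def] cis_conv_exp mult.assoc)
    qed
    have "integral\<^sup>L lborel (\<lambda>t. indicator {0..2 * pi} t *\<^sub>R cis (of_int m * t)) = F (2 * pi) - F 0"
      by (intro integral_FTC_atLeastAtMost c d) auto
    also have "cis (of_int m * (2 * pi)) = 1"
      using cis_multiple_2pi[of "of_int m"] by (simp add: mult.commute mult.left_commute)
    then have "F (2 * pi) - F 0 = 0" by (simp add: F_def)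
    finally show ?thesis using False by simp
  qed
  then show ?thesis using i has_bochner_integral_iff by blast
qed

text \<open>The Fejer mean of the Fourier series with coefficients <U^j f, f>, in the closed form
  that shows nonnegativity: when U is an isometry, the expanded double sum over k and l depends only
  on the moments at k - l.\<close>

definition fejer :: "('a::chilbert \<Rightarrow> 'a) \<Rightarrow> 'a \<Rightarrow> nat \<Rightarrow> real \<Rightarrow> real" where
  "fejer U f n t = (norm (\<Sum>k<n. hscaleC (cis (- real k * t)) ((U ^^ k) f)))\<^sup>2 / (2 * pi * real n)"

lemma fejer_expand:
  "complex_of_real (fejer U f n t) = (\<Sum>k<n. \<Sum>l<n.
     (hinner ((U ^^ k) f) ((U ^^ l) f) / (2 * of_real pi * of_nat n)) * cis (of_int (int l - int k) * t))"
proof -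
  have "complex_of_real ((norm (\<Sum>k<n. hscaleC (cis (- real k * t)) ((U ^^ k) f)))\<^sup>2)
     = (\<Sum>k<n. \<Sum>l<n. cis (- real k * t) * (cnj (cis (- real l * t)) * hinner ((U ^^ k) f) ((U ^^ l) f)))"
    unfolding hinner_self[symmetric] hinner_sum_left
    unfolding hinner_sum_right hinner_scaleC_left hinner_scaleC_right
    by (simp only: mult.left_commute)
  also have "\<dots> = (\<Sum>k<n. \<Sum>l<n. hinner ((U ^^ k) f) ((U ^^ l) f) * cis (of_int (int l - int k) * t))"
  proof (intro sum.cong refl)
    fix k l
    have "cis (- real k * t) * cnj (cis (- real l * t)) = cis (of_int (int l - int k) * t)"
      unfolding cis_cnj cis_mult by (simp add: algebra_simps)
    then show "cis (- real k * t) * (cnj (cis (- real l * t)) * hinner ((U ^^ k) f) ((U ^^ l) f))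
       = hinner ((U ^^ k) f) ((U ^^ l) f) * cis (of_int (int l - int k) * t)"
      by (metis mult.assoc mult.commute)
  qed
  finally show ?thesis by (simp add: fejer_def sum_divide_distrib)
qed

text \<open>Orthogonality of the exponentials selects the pairs with k = l + j. There are n - j of
  them, each contributing the same moment divided by n.\<close>

lemma fejer_moment:
  assumes U: "\<And>x y. hinner (U x) (U y) = hinner x (y::'a::chilbert)" and n: "0 < n" and j: "j \<le> n"
  shows "has_bochner_integral lborel (\<lambda>t. (indicator {0..2 * pi} t * fejer U f n t) *\<^sub>R cis (of_nat j * t))
     (of_real (real (n - j) / real n) * hinner ((U ^^ j) f) f)"
proof -
  define ip where "ip k l = hinner ((U ^^ k) f) ((U ^^ l) f)" for k l
  let ?m = "\<lambda>k l. int j + (int l - int k)"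
  have "has_bochner_integral lborel
     (\<lambda>t. \<Sum>k<n. \<Sum>l<n. (ip k l / (2 * of_real pi * of_nat n)) * (indicator {0..2 * pi} t *\<^sub>R cis (of_int (?m k l) * t)))
     (\<Sum>k<n. \<Sum>l<n. (ip k l / (2 * of_real pi * of_nat n)) * (if ?m k l = 0 then complex_of_real (2 * pi) else 0))"
    by (intro has_bochner_integral_sum has_bochner_integral_mult_right integral_cis_period)
  moreover have "(\<lambda>t. \<Sum>k<n. \<Sum>l<n. (ip k l / (2 * of_real pi * of_nat n)) * (indicator {0..2 * pi} t *\<^sub>R cis (of_int (?m k l) * t)))
     = (\<lambda>t. (indicator {0..2 * pi} t * fejer U f n t) *\<^sub>R cis (of_nat j * t))"
  proof
    fix t
    have "cis (of_int (?m k l) * t) = cis (of_nat j * t) * cis (of_int (int l - int k) * t)" for k l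
      by (simp add: cis_mult algebra_simps)
    then show "(\<Sum>k<n. \<Sum>l<n. (ip k l / (2 * of_real pi * of_nat n)) * (indicator {0..2 * pi} t *\<^sub>R cis (of_int (?m k l) * t)))
      = (indicator {0..2 * pi} t * fejer U f n t) *\<^sub>R cis (of_nat j * t)"
      by (simp only: scaleR_conv_of_real of_real_mult fejer_expand ip_def sum_distrib_left sum_distrib_right mult_ac)
  qed
  moreover have "(\<Sum>k<n. \<Sum>l<n. (ip k l / (2 * of_real pi * of_nat n)) * (if ?m k l = 0 then complex_of_real (2 * pi) else 0))
     = of_real (real (n - j) / real n) * hinner ((U ^^ j) f) f"
  proof -
    have "(ip k l / (2 * of_real pi * of_nat n)) * (if ?m k l = 0 then complex_of_real (2 * pi) else 0)
      = (if k = l + j then hinner ((U ^^ j) f) f / of_nat n else 0)" for k l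
    proof (cases "k = l + j")
      case True
      then have "ip k l = hinner ((U ^^ j) f) f"
        using isometry_funpow[OF U, of j l f 0 f] by (simp add: ip_def add.commute)
      then show ?thesis using True by simp
    next
      case False
      then have "?m k l \<noteq> 0" by linarith
      then show ?thesis using False by simp
    qed
    then have "(\<Sum>k<n. \<Sum>l<n. (ip k l / (2 * of_real pi * of_nat n)) * (if ?m k l = 0 then complex_of_real (2 * pi) else 0))
       = (\<Sum>l<n. \<Sum>k<n. if k = l + j then hinner ((U ^^ j) f) f / of_nat n else 0)"
      by (simp add: sum.swap[of _ "{..<n}" "{..<n}"])
    also have "\<dots> = (\<Sum>l<n. if l + j < n then hinner ((U ^^ j) f) f / of_nat n else 0)"
      by (intro sum.cong refl) (simp add: sum.delta)
    also have "\<dots> = (\<Sum>l\<in>{..<n - j}. hinner ((U ^^ j) f) f / of_nat n)"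
      by (intro sum.mono_neutral_cong_right) auto
    finally show ?thesis by simp
  qed
  ultimately show ?thesis by simp
qed

definition fejer_measure :: "('a::chilbert \<Rightarrow> 'a) \<Rightarrow> 'a \<Rightarrow> nat \<Rightarrow> real measure" where
  "fejer_measure U f n = density lborel (\<lambda>t. ennreal (indicator {0..2 * pi} t * fejer U f n t))"

lemma fejer_nonneg: "0 \<le> fejer U f n t"
  by (simp add: fejer_def)

lemma fejer_measurable [measurable]: "fejer U f n \<in> borel_measurable borel"
proof -
  have e: "fejer U f n = (\<lambda>t. Re (complex_of_real (fejer U f n t)))" by simp
  show ?thesis
    by (subst e, unfold fejer_expand, intro borel_measurable_continuous_onI continuous_intros)
qed

lemma fejer_measure_moment:
  assumes U: "\<And>x y. hinner (U x) (U y) = hinner x (y::'a::chilbert)" and n: "0 < n" and j: "j \<le> n"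
  shows "integral\<^sup>L (fejer_measure U f n) (\<lambda>t. cis (of_nat j * t))
     = of_real (real (n - j) / real n) * hinner ((U ^^ j) f) f"
proof -
  have "(\<lambda>t. cis (of_nat j * t)) \<in> borel_measurable lborel"
    by (simp, intro borel_measurable_continuous_onI continuous_intros)
  then have "integral\<^sup>L (fejer_measure U f n) (\<lambda>t. cis (of_nat j * t))
    = integral\<^sup>L lborel (\<lambda>t. (indicator {0..2 * pi} t * fejer U f n t) *\<^sub>R cis (of_nat j * t))"
    unfolding fejer_measure_def by (intro integral_density) (auto simp: fejer_nonneg)
  then show ?thesis using fejer_moment[OF U n j] by (simp add: has_bochner_integral_integral_eq)
qed

text \<open>Total mass 1 is the zeroth moment. The interval from -1 to 8 contains [0, 2 pi] and has
  the half-open shape in which tightness is stated.\<close>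

lemma fejer_measure_distribution:
  assumes U: "\<And>x y. hinner (U x) (U y) = hinner x (y::'a::chilbert)" and n: "0 < n" and f: "norm f = 1"
  shows "real_distribution (fejer_measure U f n)" "measure (fejer_measure U f n) {-1<..8} = 1"
proof -
  have "has_bochner_integral lborel (\<lambda>t. complex_of_real (indicator {0..2 * pi} t * fejer U f n t)) 1"
    using fejer_moment[OF U n, of 0 f] n f by (simp add: scaleR_conv_of_real hinner_self)
  from has_bochner_integral_Re[OF this]
  have hb: "has_bochner_integral lborel (\<lambda>t. indicator {0..2 * pi} t * fejer U f n t) 1" by simp
  then have "(\<integral>\<^sup>+ t. ennreal (indicator {0..2 * pi} t * fejer U f n t) \<partial>lborel)
     = ennreal (integral\<^sup>L lborel (\<lambda>t. indicator {0..2 * pi} t * fejer U f n t))"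
    by (intro nn_integral_eq_integral) (auto simp: has_bochner_integral_iff fejer_nonneg)
  then have nn: "(\<integral>\<^sup>+ t. ennreal (indicator {0..2 * pi} t * fejer U f n t) \<partial>lborel) = 1"
    using hb by (simp add: has_bochner_integral_iff)
  then have "emeasure (fejer_measure U f n) (space (fejer_measure U f n)) = 1"
    unfolding fejer_measure_def by (subst emeasure_density) auto
  then have p: "prob_space (fejer_measure U f n)" by (rule prob_spaceI)
  then show "real_distribution (fejer_measure U f n)"
    by (intro real_distribution.intro real_distribution_axioms.intro) (simp_all add: fejer_measure_def)
  have "emeasure (fejer_measure U f n) {-1<..8}
     = (\<integral>\<^sup>+ t. ennreal (indicator {0..2 * pi} t * fejer U f n t) * indicator {-1<..8} t \<partial>lborel)"
    unfolding fejer_measure_def by (subst emeasure_density) auto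
  also have "\<dots> = (\<integral>\<^sup>+ t. ennreal (indicator {0..2 * pi} t * fejer U f n t) \<partial>lborel)"
  proof (rule nn_integral_cong)
    fix t :: real
    show "ennreal (indicator {0..2 * pi} t * fejer U f n t) * indicator {-1<..8} t
      = ennreal (indicator {0..2 * pi} t * fejer U f n t)"
      using pi_less_4 by (cases "t \<in> {0..2 * pi}") (simp_all add: indicator_def)
  qed
  finally have "emeasure (fejer_measure U f n) {-1<..8} = 1" using nn by simp
  then show "measure (fejer_measure U f n) {-1<..8} = 1" by (simp add: measure_def)
qed

text \<open>Herglotz's theorem for the positive definite sequence of moments. The Fejer measures are
  tight, and a weak limit keeps every moment because the exponentials are bounded and continuous and
  (n - j) / n tends to 1. The measure lives on the line instead of the circle, which is harmless
  since only functions of \<open>cis t\<close> are integrated.\<close>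

lemma trigonometric_moment_measure:
  assumes U: "\<And>x y. hinner (U x) (U y) = hinner x (y::'a::chilbert)" and f: "norm f = 1"
  shows "\<exists>M. real_distribution M \<and> (\<forall>j::nat. integral\<^sup>L M (\<lambda>t. cis (of_nat j * t)) = hinner ((U ^^ j) f) f)"
proof -
  define \<mu> where "\<mu> n = fejer_measure U f (Suc n)" for n
  have rd: "real_distribution (\<mu> n)" "measure (\<mu> n) {-1<..8} = 1" for n
    unfolding \<mu>_def by (rule fejer_measure_distribution[OF U _ f]; simp)+
  have "tight \<mu>"
    unfolding tight_def
  proof (intro conjI allI impI)
    fix e :: real assume "0 < e"
    then show "\<exists>a b. a < b \<and> (\<forall>n. 1 - e < measure (\<mu> n) {a<..b})"
      by (intro exI[of _ "-1"] exI[of _ 8]) (simp add: rd)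
  qed (rule rd)
  then obtain r M where r: "strict_mono r" and M: "real_distribution M" and w: "weak_conv_m (\<mu> \<circ> id \<circ> r) M"
    using tight_imp_convergent_subsubsequence[of \<mu> id] strict_mono_id by auto
  have "integral\<^sup>L M (\<lambda>t. cis (of_nat j * t)) = hinner ((U ^^ j) f) f" for j
  proof -
    have 1: "(\<lambda>n. integral\<^sup>L ((\<mu> \<circ> id \<circ> r) n) (\<lambda>t. cis (of_nat j * t))) \<longlonglongrightarrow> integral\<^sup>L M (\<lambda>t. cis (of_nat j * t))"
    proof (rule weak_conv_imp_integral_bdd_continuous_conv[OF _ M w])
      show "real_distribution ((\<mu> \<circ> id \<circ> r) n)" for n using rd(1) by simp
      show "isCont (\<lambda>t. cis (of_nat j * t)) x" for x 
      proof -
        have "continuous_on UNIV (\<lambda>t. cis (of_nat j * t))" by (intro continuous_intros)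
        then show ?thesis by (simp add: continuous_on_eq_continuous_at)
      qed
      show "norm (cis (of_nat j * t)) \<le> 1" for t by simp
    qed
    have ev: "\<forall>\<^sub>F n in sequentially. integral\<^sup>L ((\<mu> \<circ> id \<circ> r) n) (\<lambda>t. cis (of_nat j * t))
       = of_real (1 - real j * inverse (real (Suc (r n)))) * hinner ((U ^^ j) f) f"
      using eventually_ge_at_top[of j]
    proof eventually_elim
      case (elim n)
      then have jn: "j \<le> Suc (r n)" using seq_suble[OF r, of n] by linarith
      then have "real (Suc (r n) - j) / real (Suc (r n)) = 1 - real j * inverse (real (Suc (r n)))"
        by (simp add: of_nat_diff divide_simps)
      then show ?case using fejer_measure_moment[OF U _ jn, of f] by (simp only: \<mu>_def comp_apply id_apply)
    qed
    have lim: "(\<lambda>n. of_real (1 - real j * inverse (real (Suc (r n)))) * hinner ((U ^^ j) f) f)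
       \<longlonglongrightarrow> of_real (1 - real j * 0) * hinner ((U ^^ j) f) f"
      using LIMSEQ_subseq_LIMSEQ[OF LIMSEQ_inverse_real_of_nat r]
      by (intro tendsto_intros) (simp add: comp_def)
    have "(\<lambda>n. integral\<^sup>L ((\<mu> \<circ> id \<circ> r) n) (\<lambda>t. cis (of_nat j * t))) \<longlonglongrightarrow> of_real (1 - real j * 0) * hinner ((U ^^ j) f) f"
      by (rule tendsto_cong[THEN iffD2, OF ev lim])
    then show ?thesis using LIMSEQ_unique[OF 1] by simp
  qed
  then show ?thesis using M by blast
qed

text \<open>Vectors h - U h have telescoping ergodic sums of norm at most 2 |h|, and they
  approximate every f; the error stays controlled because U preserves norms.\<close>

lemma mean_ergodic_zero:
  assumes U: "bounded_op U" "\<And>x y. hinner (U x) (U y) = hinner x (y::'a::chilbert)"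
    and dense: "closure (range (\<lambda>h. h - U h)) = UNIV"
  shows "(\<lambda>n. norm (\<Sum>k<n. (U ^^ k) f) / real n) \<longlonglongrightarrow> 0"
proof (rule LIMSEQ_I)
  have iso: "norm ((U ^^ k) x) = norm x" for k x
  proof -
    have "(norm ((U ^^ k) x))\<^sup>2 = (norm x)\<^sup>2"
      using isometry_funpow[OF U(2), of 0 k x 0 x] by (simp add: hinner_norm_sq)
    then show ?thesis by (simp add: power2_eq_iff_nonneg)
  qed
  fix e :: real assume e: "0 < e"
  have "f \<in> closure (range (\<lambda>h. h - U h))" using dense by simp
  then obtain h where h: "dist (h - U h) f < e / 2"
    using e closure_approachable[of f "range (\<lambda>h. h - U h)"] half_gt_zero by fastforce
  \<comment> \<open>For n > N the telescoped part, at most 2 |h|, is below n e / 2.\<close>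
  obtain N where N: "real N > 4 * norm h / e" using reals_Archimedean2 by blast
  have "norm (\<Sum>k<n. (U ^^ k) f) / real n < e" if n: "n \<ge> Suc N" for n
  proof -
    define g where "g = f - (h - U h)"
    have g: "norm g < e / 2" using h by (simp add: g_def dist_norm norm_minus_commute)
    have "(U ^^ k) f = (U ^^ k) g + ((U ^^ k) h - (U ^^ Suc k) h)" for k
      using bounded_op_add[OF bounded_op_funpow[OF U(1)], of k g "h - U h"]
        bounded_op_diff[OF bounded_op_funpow[OF U(1)], of k h "U h"]
      by (simp add: g_def funpow_swap1)
    then have "(\<Sum>k<n. (U ^^ k) f) = (\<Sum>k<n. (U ^^ k) g) + (\<Sum>k<n. (U ^^ k) h - (U ^^ Suc k) h)"
      by (simp only: sum.distrib)
    also have "(\<Sum>k<n. (U ^^ k) h - (U ^^ Suc k) h) = h - (U ^^ n) h"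
      by (induction n) simp_all
    finally have "norm (\<Sum>k<n. (U ^^ k) f) \<le> norm (\<Sum>k<n. (U ^^ k) g) + norm (h - (U ^^ n) h)"
      by (simp add: norm_triangle_ineq)
    also have "norm (\<Sum>k<n. (U ^^ k) g) \<le> real n * norm g"
      using sum_norm_le[of "{..<n}" "\<lambda>k. (U ^^ k) g" "\<lambda>k. norm g"] by (simp add: iso)
    also have "norm (h - (U ^^ n) h) \<le> 2 * norm h"
      using norm_triangle_ineq4[of h "(U ^^ n) h"] by (simp add: iso)
    finally have b: "norm (\<Sum>k<n. (U ^^ k) f) \<le> real n * norm g + 2 * norm h" by simp
    have "4 * norm h < e * real N" using N e by (simp add: field_simps)
    also have "\<dots> \<le> e * real n" using n e by (intro mult_left_mono) auto
    finally have "2 * norm h < real n * (e / 2)" by (simp add: field_simps)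
    moreover have "real n * norm g \<le> real n * (e / 2)" using g by (intro mult_left_mono) auto
    ultimately have "norm (\<Sum>k<n. (U ^^ k) f) < real n * (e / 2) + real n * (e / 2)" using b by linarith
    then have "norm (\<Sum>k<n. (U ^^ k) f) < e * real n" by (simp add: field_simps)
    then show ?thesis using n by (simp add: field_simps)
  qed
  then show "\<exists>no. \<forall>n\<ge>no. norm (norm (\<Sum>k<n. (U ^^ k) f) / real n - 0) < e"
    by (intro exI[of _ "Suc N"]) simp
qed

text \<open>The number - sin t / (1 - cos t) is - cot (t / 2), the inverse of the Cayley function on
  the circle without 1.\<close>

lemma cayley_cot:
  assumes "cos t \<noteq> 1" shows "cayley (- sin t / (1 - cos t)) = cis t"
proof -
  define c where "c = 1 - complex_of_real (cos t)"
  have c: "c \<noteq> 0" using assms unfolding c_def by (metis eq_iff_diff_eq_0 of_real_1 of_real_eq_iff)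
  have sc: "(complex_of_real (sin t))\<^sup>2 + (complex_of_real (cos t))\<^sup>2 = 1"
    by (metis of_real_1 of_real_add of_real_power sin_cos_squared_add)
  have x: "complex_of_real (- sin t / (1 - cos t)) = - of_real (sin t) / c" by (simp add: c_def)
  have nz: "- complex_of_real (sin t) + \<i> * c \<noteq> 0"
  proof
    assume "- complex_of_real (sin t) + \<i> * c = 0"
    then have "Im (- complex_of_real (sin t) + \<i> * c) = 0" by simp
    then show False using assms by (simp add: c_def)
  qed
  have "cayley (- sin t / (1 - cos t)) = ((- of_real (sin t) - \<i> * c) / c) / ((- of_real (sin t) + \<i> * c) / c)"
    unfolding cayley_def x using c by (simp add: add_divide_distrib diff_divide_distrib)
  also have "\<dots> = (- of_real (sin t) - \<i> * c) / (- of_real (sin t) + \<i> * c)" using c by simp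
  also have "\<dots> = cis t"
  proof -
    have "cis t * (- of_real (sin t) + \<i> * c) = - of_real (sin t) - \<i> * c"
      using sin_cos_squared_add[of t] by (simp add: complex_eq_iff c_def algebra_simps power2_eq_square)
    then show ?thesis using nz by (simp add: divide_eq_eq)
  qed
  finally show ?thesis .
qed

lemma (in real_distribution) borel_measurable_M: "F \<in> borel_measurable borel \<Longrightarrow> F \<in> borel_measurable M"
  by (subst measurable_cong_sets[OF events_eq_borel refl])

lemma (in real_distribution) integrable_cis: "integrable M (\<lambda>t. cis (c * t))"
  by (rule integrable_const_bound[of _ 1])
     (simp, intro borel_measurable_M borel_measurable_continuous_onI continuous_intros)

lemma cayley_moment_measure_unit:
  assumes U: "bounded_op U" "\<And>x y. hinner (U x) (U y) = hinner x (y::'a::chilbert)"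
    and dense: "closure (range (\<lambda>h. h - U h)) = UNIV" and f: "norm f = 1"
  shows "\<exists>\<mu>. real_distribution \<mu> \<and>
    (\<forall>j k. integral\<^sup>L \<mu> (\<lambda>x. cayley x ^ j * cnj (cayley x) ^ k) = hinner ((U ^^ j) f) ((U ^^ k) f))"
proof -
  obtain M where M: "real_distribution M" and mom: "\<And>j::nat. integral\<^sup>L M (\<lambda>t. cis (of_nat j * t)) = hinner ((U ^^ j) f) f"
    using trigonometric_moment_measure[OF U(2) f] by blast
  interpret real_distribution M by fact
  have jk: "integral\<^sup>L M (\<lambda>t. cis t ^ j * cnj (cis t) ^ k) = hinner ((U ^^ j) f) ((U ^^ k) f)" for j k
  proof (cases "k \<le> j")
    case True
    have "cis t ^ j * cnj (cis t) ^ k = cis (of_nat (j - k) * t)" for t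
      using True by (simp add: cis_cnj Complex.DeMoivre cis_mult of_nat_diff algebra_simps)
    then have "integral\<^sup>L M (\<lambda>t. cis t ^ j * cnj (cis t) ^ k) = hinner ((U ^^ (j - k)) f) f"
      by (simp only: mom)
    then show ?thesis using isometry_funpow[OF U(2), of "j - k" k f 0 f] True by simp
  next
    case False
    have "cis t ^ j * cnj (cis t) ^ k = cnj (cis (of_nat (k - j) * t))" for t
      using False by (simp add: cis_cnj Complex.DeMoivre cis_mult of_nat_diff algebra_simps)
    then have "integral\<^sup>L M (\<lambda>t. cis t ^ j * cnj (cis t) ^ k) = cnj (hinner ((U ^^ (k - j)) f) f)"
      using Bochner_Integration.integral_cnj[of M "\<lambda>t. cis (of_nat (k - j) * t)"] by (simp only: mom)
    also have "\<dots> = hinner f ((U ^^ (k - j)) f)" by (rule hinner_commute[symmetric])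
    also have "\<dots> = hinner ((U ^^ j) f) ((U ^^ k) f)"
      using isometry_funpow[OF U(2), of 0 j f "k - j" f] False by simp
    finally show ?thesis .
  qed
  define N where "N = {t::real. cos t = 1}"
  have N: "N \<in> sets borel" unfolding N_def by simp
  \<comment> \<open>On N every term of the exponential sum is 1, so its squared modulus is n^2
    there, while the integral of the squared modulus is the squared norm of the ergodic sum.\<close>
  have "measure M N \<le> (norm (\<Sum>k<n. (U ^^ k) f) / real n)\<^sup>2" if n: "0 < n" for n
  proof -
    define s where "s t = (\<Sum>k<n. cis t ^ k)" for t
    have e: "complex_of_real ((cmod (s t))\<^sup>2) = (\<Sum>k<n. \<Sum>l<n. cis t ^ k * cnj (cis t) ^ l)" for t
      unfolding complex_norm_square s_def by (simp add: sum_product)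
    have ci: "integrable M (\<lambda>t. cis t ^ k * cnj (cis t) ^ l)" for k l
    proof -
      have "cis t ^ k * cnj (cis t) ^ l = cis ((real k - real l) * t)" for t
        by (simp add: cis_cnj Complex.DeMoivre cis_mult algebra_simps)
      then show ?thesis using integrable_cis by simp
    qed
    have "has_bochner_integral M (\<lambda>t. cis t ^ k * cnj (cis t) ^ l) (hinner ((U ^^ k) f) ((U ^^ l) f))" for k l
      using ci jk by (simp only: has_bochner_integral_iff)
    then have hb: "has_bochner_integral M (\<lambda>t. complex_of_real ((cmod (s t))\<^sup>2))
       (\<Sum>k<n. \<Sum>l<n. hinner ((U ^^ k) f) ((U ^^ l) f))"
      unfolding e by (intro has_bochner_integral_sum)
    have i: "integrable M (\<lambda>t. complex_of_real ((cmod (s t))\<^sup>2))"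
      using hb by (simp only: has_bochner_integral_iff)
    have "complex_of_real (integral\<^sup>L M (\<lambda>t. (cmod (s t))\<^sup>2)) = integral\<^sup>L M (\<lambda>t. complex_of_real ((cmod (s t))\<^sup>2))"
      by (rule integral_complex_of_real[symmetric])
    also have "\<dots> = (\<Sum>k<n. \<Sum>l<n. hinner ((U ^^ k) f) ((U ^^ l) f))"
      using hb by (simp only: has_bochner_integral_iff)
    also have "\<dots> = of_real ((norm (\<Sum>k<n. (U ^^ k) f))\<^sup>2)"
      unfolding hinner_self[symmetric] hinner_sum_left unfolding hinner_sum_right ..
    finally have int: "integral\<^sup>L M (\<lambda>t. (cmod (s t))\<^sup>2) = (norm (\<Sum>k<n. (U ^^ k) f))\<^sup>2"
      unfolding of_real_eq_iff .
    have sN: "s t = of_nat n" if "t \<in> N" for t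
    proof -
      have "cos t = 1" using that by (simp add: N_def)
      then have "sin t = 0" using sin_cos_squared_add[of t] by simp
      then have "cis t = 1" using \<open>cos t = 1\<close> by (simp add: complex_eq_iff)
      then show ?thesis by (simp add: s_def)
    qed
    have "(real n)\<^sup>2 * measure M N = integral\<^sup>L M (\<lambda>t. (real n)\<^sup>2 * indicator N t)"
      using N by simp
    also have "\<dots> \<le> integral\<^sup>L M (\<lambda>t. (cmod (s t))\<^sup>2)"
    proof (rule integral_mono)
      have "integrable M (indicator N :: real \<Rightarrow> real)"
        using N by (intro integrable_const_bound[of _ 1] borel_measurable_M borel_measurable_indicator)
          (simp_all add: indicator_def)
      then show "integrable M (\<lambda>t. (real n)\<^sup>2 * indicator N t)" by simp
      show "integrable M (\<lambda>t. (cmod (s t))\<^sup>2)" using i complex_of_real_integrable_eq by blast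
      show "(real n)\<^sup>2 * indicator N t \<le> (cmod (s t))\<^sup>2" for t
        using sN[of t] by (simp add: indicator_def)
    qed
    finally show ?thesis using n by (simp add: int power_divide field_simps)
  qed
  moreover have "(\<lambda>n. (norm (\<Sum>k<n. (U ^^ k) f) / real n)\<^sup>2) \<longlonglongrightarrow> 0\<^sup>2"
    by (intro tendsto_power mean_ergodic_zero[OF U dense])
  ultimately have "measure M N \<le> 0\<^sup>2"
    by (intro LIMSEQ_le_const[of "\<lambda>n. (norm (\<Sum>k<n. (U ^^ k) f) / real n)\<^sup>2"]) (auto intro!: exI[of _ 1])
  then have "measure M N = 0" using measure_nonneg[of M N] by simp
  then have "AE t in M. t \<notin> N"
    using N by (intro AE_I[of _ _ N]) (auto simp: emeasure_eq_measure)
  then have ae: "AE t in M. cos t \<noteq> 1" by (simp add: N_def)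
  define g where "g t = - sin t / (1 - cos t)" for t :: real
  have g [measurable]: "g \<in> borel_measurable borel" unfolding g_def by measurable
  \<comment> \<open>The image under g moves the measure from the circle to the line; outside the
    null set N the Cayley function undoes g.\<close>
  have "real_distribution (distr M borel g)"
    using prob_space_distr[OF borel_measurable_M[OF g]]
    by (intro real_distribution.intro real_distribution_axioms.intro) simp_all
  moreover have "integral\<^sup>L (distr M borel g) (\<lambda>x. cayley x ^ j * cnj (cayley x) ^ k) = hinner ((U ^^ j) f) ((U ^^ k) f)" for j k
  proof -
    have m: "(\<lambda>x. cayley x ^ j * cnj (cayley x) ^ k) \<in> borel_measurable borel"
      using bounded_borel_cayley_power bounded_borel_measurable by blast
    have gM: "g \<in> measurable M borel" using g by simp
    have "integral\<^sup>L (distr M borel g) (\<lambda>x. cayley x ^ j * cnj (cayley x) ^ k)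
      = integral\<^sup>L M (\<lambda>t. cayley (g t) ^ j * cnj (cayley (g t)) ^ k)"
      by (rule integral_distr[OF gM m])
    also have "\<dots> = integral\<^sup>L M (\<lambda>t. cis t ^ j * cnj (cis t) ^ k)"
    proof (rule integral_cong_AE)
      show "(\<lambda>t. cayley (g t) ^ j * cnj (cayley (g t)) ^ k) \<in> borel_measurable M"
        using measurable_compose[OF gM m] .
      show "(\<lambda>t. cis t ^ j * cnj (cis t) ^ k) \<in> borel_measurable M"
        by (intro borel_measurable_M borel_measurable_continuous_onI continuous_intros)
      have cg: "cayley (g t) = cis t" if "cos t \<noteq> 1" for t using cayley_cot[OF that] unfolding g_def .
      show "AE t in M. cayley (g t) ^ j * cnj (cayley (g t)) ^ k = cis t ^ j * cnj (cis t) ^ k"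
        using ae by eventually_elim (simp add: cg)
    qed
    finally show ?thesis by (simp add: jk)
  qed
  ultimately show ?thesis by blast
qed

lemma cayley_moment_measure:
  assumes U: "bounded_op U" "\<And>x y. hinner (U x) (U y) = hinner x (y::'a::chilbert)"
    and dense: "closure (range (\<lambda>h. h - U h)) = UNIV"
  shows "\<exists>\<mu>. sets \<mu> = sets borel \<and> emeasure \<mu> UNIV = ennreal ((norm f)\<^sup>2) \<and>
    (\<forall>j k. integral\<^sup>L \<mu> (\<lambda>x. cayley x ^ j * cnj (cayley x) ^ k) = hinner ((U ^^ j) f) ((U ^^ k) f))"
proof (cases "f = 0")
  case True
  have "(U ^^ j) 0 = 0" for j by (rule bounded_op_zero[OF bounded_op_funpow[OF U(1)]])
  then show ?thesis using True by (intro exI[of _ "null_measure borel"]) simp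
next
  case False
  define u where "u = hscaleC (of_real (1 / norm f)) f"
  have u: "norm u = 1" "f = hscaleC (of_real (norm f)) u"
    using False by (simp_all add: u_def norm_divide hscaleC_hscaleC hscaleC_one)
  obtain \<mu> where \<mu>: "real_distribution \<mu>"
    and mom: "\<And>j k. integral\<^sup>L \<mu> (\<lambda>x. cayley x ^ j * cnj (cayley x) ^ k) = hinner ((U ^^ j) u) ((U ^^ k) u)"
    using cayley_moment_measure_unit[OF U dense u(1)] by blast
  interpret real_distribution \<mu> by fact
  define \<nu> where "\<nu> = density \<mu> (\<lambda>_. ennreal ((norm f)\<^sup>2))"
  have "emeasure \<nu> UNIV = ennreal ((norm f)\<^sup>2)"
    unfolding \<nu>_def using emeasure_space_1 by (subst emeasure_density) simp_all
  moreover have "sets \<nu> = sets borel" by (simp add: \<nu>_def)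
  moreover have "integral\<^sup>L \<nu> (\<lambda>x. cayley x ^ j * cnj (cayley x) ^ k) = hinner ((U ^^ j) f) ((U ^^ k) f)" for j k
  proof -
    have m: "(\<lambda>x. cayley x ^ j * cnj (cayley x) ^ k) \<in> borel_measurable \<mu>"
      using bounded_borel_cayley_power bounded_borel_measurable by simp
    have fp: "(U ^^ j) f = hscaleC (of_real (norm f)) ((U ^^ j) u)" for j
      using bounded_op_scale[OF bounded_op_funpow[OF U(1)]] u(2) by metis
    have "integral\<^sup>L \<nu> (\<lambda>x. cayley x ^ j * cnj (cayley x) ^ k)
       = (norm f)\<^sup>2 *\<^sub>R hinner ((U ^^ j) u) ((U ^^ k) u)"
      unfolding \<nu>_def by (subst integral_density[OF m]) (simp_all add: mom)
    also have "\<dots> = hinner ((U ^^ j) f) ((U ^^ k) f)"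
      by (subst (1 2) fp) (simp add: hinner_linear scaleR_conv_of_real power2_eq_square)
    finally show ?thesis .
  qed
  ultimately show ?thesis by blast
qed

section \<open>Bounded Borel functional calculus\<close>

definition represents :: "('a::chilbert \<Rightarrow> real measure) \<Rightarrow> (real \<Rightarrow> complex) \<Rightarrow> ('a \<Rightarrow> 'a) \<Rightarrow> bool" where
  "represents \<mu> F T \<longleftrightarrow> bounded_op T \<and> (\<forall>f. hinner (T f) f = integral\<^sup>L (\<mu> f) F)"

text \<open>The measure \<mu> f plays the role of the spectral measure at f. Measures of different
  vectors are linked only by the requirement that the generators be represented by operators,
  multiplicatively; this is enough to reach all bounded Borel functions.\<close>

locale borel_calculus =
  fixes \<mu> :: "'a::chilbert \<Rightarrow> real measure" and \<G> :: "(real \<Rightarrow> complex) set"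
  assumes sets_mu [simp, measurable_cong]: "sets (\<mu> f) = sets borel"
    and mass: "emeasure (\<mu> f) UNIV = ennreal ((norm f)\<^sup>2)"
    and gen: "generates_borel \<G>"
    and gen_represented: "G \<in> \<G> \<Longrightarrow> \<exists>T. represents \<mu> G T"
    and gen_mult: "\<lbrakk>G \<in> \<G>; H \<in> \<G>; represents \<mu> G S; represents \<mu> H T\<rbrakk>
       \<Longrightarrow> represents \<mu> (\<lambda>x. G x * H x) (\<lambda>f. S (T f))"
begin

lemma space_mu [simp]: "space (\<mu> f) = UNIV"
  using sets_eq_imp_space_eq[OF sets_mu, of f] by simp

lemma finite_measure_mu: "finite_measure (\<mu> f)"
  by (rule finite_measureI) (simp add: mass)

lemma measurable_mu: "F \<in> borel_measurable borel \<Longrightarrow> F \<in> borel_measurable (\<mu> f)"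
  by (subst measurable_cong_sets[OF sets_mu refl])

lemma integrable_bounded_borel:
  assumes "bounded_borel F" shows "integrable (\<mu> f) F"
proof -
  obtain K where "\<And>x. cmod (F x) \<le> K" using assms bounded_borel_bound by metis
  then show ?thesis
    by (intro finite_measure.integrable_const_bound[OF finite_measure_mu, where B = K] measurable_mu
        bounded_borel_measurable assms) simp
qed

lemma integral_bound:
  assumes "bounded_borel F" "\<And>x. cmod (F x) \<le> K"
  shows "cmod (integral\<^sup>L (\<mu> f) F) \<le> K * (norm f)\<^sup>2"
proof -
  have "measure (\<mu> f) UNIV = (norm f)\<^sup>2" by (simp add: measure_def mass)
  moreover have "cmod (integral\<^sup>L (\<mu> f) F) \<le> integral\<^sup>L (\<mu> f) (\<lambda>x. K)"
  proof (rule Bochner_Integration.integral_norm_bound_integral)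
    show "integrable (\<mu> f) (\<lambda>x. K)" using finite_measure_mu by (simp add: finite_measure.integrable_const)
  qed (simp_all add: assms integrable_bounded_borel)
  ultimately show ?thesis by (simp add: mult.commute)
qed

lemma integral_limit_AE:
  assumes "\<And>n. bounded_borel (Fs n)" "bounded_borel F" "\<And>n x. cmod (Fs n x) \<le> K"
    "AE x in \<mu> f. (\<lambda>n. Fs n x) \<longlonglongrightarrow> F x"
  shows "(\<lambda>n. integral\<^sup>L (\<mu> f) (Fs n)) \<longlonglongrightarrow> integral\<^sup>L (\<mu> f) F"
proof (rule integral_dominated_convergence[where w = "\<lambda>_. K"])
  show "integrable (\<mu> f) (\<lambda>x. K)" using finite_measure_mu by (simp add: finite_measure.integrable_const)
qed (simp_all add: assms measurable_mu bounded_borel_measurable)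

lemma represents_unique: "represents \<mu> F S \<Longrightarrow> represents \<mu> F T \<Longrightarrow> S = T"
  by (rule bounded_op_eq_quadratic) (simp_all add: represents_def)

lemma represents_zero: "represents \<mu> (\<lambda>_. 0) (\<lambda>f. 0)"
  by (auto simp: represents_def bounded_op_def intro: exI[of _ 0])

lemma represents_add:
  assumes "bounded_borel F" "bounded_borel G" "represents \<mu> F S" "represents \<mu> G T"
  shows "represents \<mu> (\<lambda>x. F x + G x) (\<lambda>f. S f + T f)"
  using assms by (simp add: represents_def bounded_op_plus hinner_linear integrable_bounded_borel)

lemma represents_scale:
  assumes "bounded_borel F" "represents \<mu> F S"
  shows "represents \<mu> (\<lambda>x. c * F x) (\<lambda>f. hscaleC c (S f))"
  using assms by (simp add: represents_def bounded_op_scaled hinner_linear)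

text \<open>Dominated convergence gives the limit of the quadratic forms, and polarization upgrades
  it to weak convergence of the operators.\<close>

lemma represents_limit:
  assumes Fs: "\<And>n. bounded_borel (Fs n)" and F: "bounded_borel F"
    and K: "\<And>n x. cmod (Fs n x) \<le> K" and lim: "\<And>x. (\<lambda>n. Fs n x) \<longlonglongrightarrow> F x"
    and T: "\<And>n. represents \<mu> (Fs n) (T n)"
  shows "\<exists>S. represents \<mu> F S \<and> (\<forall>f g. (\<lambda>n. hinner (T n f) g) \<longlonglongrightarrow> hinner (S f) g)"
proof -
  have q: "(\<lambda>n. hinner (T n f) f) \<longlonglongrightarrow> integral\<^sup>L (\<mu> f) F" for f
    using integral_limit_AE[OF Fs F K, where f = f] T lim by (simp add: represents_def)
  have b: "cmod (F x) \<le> K" for x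
    by (rule LIMSEQ_le_const2[OF tendsto_norm[OF lim]]) (simp add: K)
  have "bounded_op (T n)" for n using T by (simp add: represents_def)
  from quadratic_limit_represented[OF this q integral_bound[OF F b]] show ?thesis
    by (auto simp: represents_def)
qed

lemma represented:
  assumes "bounded_borel F" shows "\<exists>T. represents \<mu> F T"
proof (rule generates_borelD[OF gen _ _ assms])
  show "bounded_closed (\<lambda>F. \<exists>T. represents \<mu> F T)"
  proof (rule bounded_closedI)
    show "\<exists>T. represents \<mu> (\<lambda>_. 0) T" using represents_zero by blast
    show "\<exists>T. represents \<mu> (\<lambda>x. F x + G x) T"
      if "bounded_borel F" "bounded_borel G" "\<exists>T. represents \<mu> F T" "\<exists>T. represents \<mu> G T" for F G
      using represents_add that by blast
    show "\<exists>T. represents \<mu> (\<lambda>x. c * F x) T" if "bounded_borel F" "\<exists>T. represents \<mu> F T" for c F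
      using represents_scale that by blast
    show "\<exists>T. represents \<mu> F T" if Fs: "\<And>n. bounded_borel (Fs n)" "bounded_borel F" and ex: "\<And>n. \<exists>T. represents \<mu> (Fs n) T"
      and lim: "\<And>n x. cmod (Fs n x) \<le> K" "\<And>x. (\<lambda>n. Fs n x) \<longlonglongrightarrow> F x" for Fs F K
    proof -
      obtain T where "\<And>n. represents \<mu> (Fs n) (T n)" using ex by metis
      from represents_limit[OF Fs lim this] show ?thesis by blast
    qed
  qed
qed (rule gen_represented)

section \<open>Multiplicativity and convergence of the bounded calculus\<close>

definition calc :: "(real \<Rightarrow> complex) \<Rightarrow> 'a \<Rightarrow> 'a" where
  "calc F = (THE T. represents \<mu> F T)"

lemma calc_eqI: "represents \<mu> F T \<Longrightarrow> calc F = T"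
  unfolding calc_def using represents_unique by blast

lemma calc_represents: "bounded_borel F \<Longrightarrow> represents \<mu> F (calc F)"
  using represented calc_eqI by blast

lemma calc_bounded_op: "bounded_borel F \<Longrightarrow> bounded_op (calc F)"
  using calc_represents by (simp add: represents_def)

lemma calc_quadratic: "bounded_borel F \<Longrightarrow> hinner (calc F f) f = integral\<^sup>L (\<mu> f) F"
  using calc_represents by (simp add: represents_def)

lemma calc_zero: "calc (\<lambda>_. 0) = (\<lambda>f. 0)"
  by (rule calc_eqI[OF represents_zero])

lemma calc_add:
  "bounded_borel F \<Longrightarrow> bounded_borel G \<Longrightarrow> calc (\<lambda>x. F x + G x) = (\<lambda>f. calc F f + calc G f)"
  by (rule calc_eqI) (rule represents_add; (assumption | rule calc_represents, assumption))

lemma calc_scale: "bounded_borel F \<Longrightarrow> calc (\<lambda>x. c * F x) = (\<lambda>f. hscaleC c (calc F f))"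
  by (rule calc_eqI) (rule represents_scale; (assumption | rule calc_represents, assumption))

lemma calc_diff:
  assumes "bounded_borel F" "bounded_borel G"
  shows "calc (\<lambda>x. F x - G x) = (\<lambda>f. calc F f - calc G f)"
  using calc_add[OF assms(1) bounded_borel_mult[OF bounded_borel_const[of "-1"] assms(2)]]
    calc_scale[OF assms(2), of "-1"] by (simp add: hscaleC_minus_one)

lemma calc_one: "calc (\<lambda>_. 1) = (\<lambda>f. f)"
proof (rule calc_eqI)
  have "measure (\<mu> f) UNIV = (norm f)\<^sup>2" for f by (simp add: measure_def mass)
  then show "represents \<mu> (\<lambda>_. 1) (\<lambda>f. f)"
    by (simp add: represents_def bounded_op_id hinner_self scaleR_conv_of_real)
qed

lemma calc_const: "calc (\<lambda>_. c) = (\<lambda>f. hscaleC c f)"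
  using calc_scale[of "\<lambda>_. 1" c] by (simp add: calc_one)

lemma calc_adjoint:
  assumes "bounded_borel F"
  shows "hinner (calc F f) g = hinner f (calc (\<lambda>x. cnj (F x)) g)"
proof (rule bounded_op_adjoint_quadratic)
  show "bounded_op (calc F)" "bounded_op (calc (\<lambda>x. cnj (F x)))"
    using assms by (simp_all add: calc_bounded_op bounded_borel_cnj)
  show "hinner (calc F h) h = cnj (hinner (calc (\<lambda>x. cnj (F x)) h) h)" for h
    using assms by (simp add: calc_quadratic bounded_borel_cnj)
qed

lemma calc_weak_limit:
  assumes Fs: "\<And>n. bounded_borel (Fs n)" and K: "\<And>n x. cmod (Fs n x) \<le> K" and lim: "\<And>x. (\<lambda>n. Fs n x) \<longlonglongrightarrow> F x"
  shows "(\<lambda>n. hinner (calc (Fs n) f) g) \<longlonglongrightarrow> hinner (calc F f) g"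
proof -
  have F: "bounded_borel F" using bounded_borel_limit[OF Fs K lim] .
  obtain S where "represents \<mu> F S" "\<forall>f g. (\<lambda>n. hinner (calc (Fs n) f) g) \<longlonglongrightarrow> hinner (S f) g"
    using represents_limit[OF Fs F K lim calc_represents[OF Fs]] by blast
  then show ?thesis using calc_eqI by blast
qed

text \<open>Multiplicativity is extended one factor at a time; here the left factor becomes
  arbitrary while the right one stays a generator. Weak convergence suffices because the inner
  vector \<open>calc G f\<close> is fixed.\<close>

lemma calc_mult_gen:
  assumes G: "G \<in> \<G>" and F: "bounded_borel F"
  shows "calc (\<lambda>x. F x * G x) = (\<lambda>f. calc F (calc G f))"
proof (rule generates_borelD[OF gen _ _ F])
  have bG: "bounded_borel G" using generates_borel_bounded[OF gen G] .
  show "bounded_closed (\<lambda>F. calc (\<lambda>x. F x * G x) = (\<lambda>f. calc F (calc G f)))"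
  proof (rule bounded_closedI)
    show "calc (\<lambda>x. 0 * G x) = (\<lambda>f. calc (\<lambda>_. 0) (calc G f))" by (simp add: calc_zero)
  next
    fix F H assume *: "bounded_borel F" "bounded_borel H" "calc (\<lambda>x. F x * G x) = (\<lambda>f. calc F (calc G f))"
      "calc (\<lambda>x. H x * G x) = (\<lambda>f. calc H (calc G f))"
    show "calc (\<lambda>x. (F x + H x) * G x) = (\<lambda>f. calc (\<lambda>x. F x + H x) (calc G f))"
      unfolding distrib_right
      using calc_add[OF bounded_borel_mult[OF *(1) bG] bounded_borel_mult[OF *(2) bG]] * calc_add[OF *(1,2)] by simp
  next
    fix c F assume *: "bounded_borel F" "calc (\<lambda>x. F x * G x) = (\<lambda>f. calc F (calc G f))"
    show "calc (\<lambda>x. c * F x * G x) = (\<lambda>f. calc (\<lambda>x. c * F x) (calc G f))"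
      unfolding mult.assoc using calc_scale[OF bounded_borel_mult[OF *(1) bG]] calc_scale[OF *(1)] *(2) by simp
  next
    fix Fs F K assume Fs: "\<And>n. bounded_borel (Fs n)" and F: "bounded_borel F"
      and eq: "\<And>n. calc (\<lambda>x. Fs n x * G x) = (\<lambda>f. calc (Fs n) (calc G f))"
      and K: "\<And>n x. cmod (Fs n x) \<le> K" and lim: "\<And>x. (\<lambda>n. Fs n x) \<longlonglongrightarrow> F x"
    obtain L where L: "0 \<le> L" "\<And>x. cmod (G x) \<le> L" using bG bounded_borel_bound by metis
    have K0: "0 \<le> K" using K[of 0 0] norm_ge_zero order_trans by blast
    have "cmod (Fs n x * G x) \<le> K * L" for n x
      using K L K0 by (simp add: norm_mult mult_mono)
    moreover have "(\<lambda>n. Fs n x * G x) \<longlonglongrightarrow> F x * G x" for x by (intro tendsto_intros lim)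
    ultimately have 1: "(\<lambda>n. hinner (calc (\<lambda>x. Fs n x * G x) f) g) \<longlonglongrightarrow> hinner (calc (\<lambda>x. F x * G x) f) g" for f g
      by (intro calc_weak_limit[where K = "K * L"] bounded_borel_mult Fs bG)
    have 2: "(\<lambda>n. hinner (calc (Fs n) (calc G f)) g) \<longlonglongrightarrow> hinner (calc F (calc G f)) g" for f g
      by (intro calc_weak_limit[OF Fs K lim])
    show "calc (\<lambda>x. F x * G x) = (\<lambda>f. calc F (calc G f))"
    proof (rule ext, rule hinner_eqI)
      fix f g
      show "hinner (calc (\<lambda>x. F x * G x) f) g = hinner (calc F (calc G f)) g"
        using LIMSEQ_unique[OF 1[of f g]] 2[of f g] by (simp add: eq)
    qed
  qed
  show "calc (\<lambda>x. H x * G x) = (\<lambda>f. calc H (calc G f))" if "H \<in> \<G>" for H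
    using that G generates_borel_bounded[OF gen]
    by (intro calc_eqI gen_mult calc_represents) auto
qed

text \<open>Now the right factor becomes arbitrary. The varying operator sits inside
  \<open>calc F\<close>, which is therefore moved to the other side of the inner product before the
  weak limit is taken.\<close>

lemma calc_mult:
  assumes F: "bounded_borel F" and G: "bounded_borel G"
  shows "calc (\<lambda>x. F x * G x) = (\<lambda>f. calc F (calc G f))"
proof (rule generates_borelD[OF gen _ _ G])
  note lin = bounded_op_add[OF calc_bounded_op[OF F]] bounded_op_scale[OF calc_bounded_op[OF F]]
    bounded_op_zero[OF calc_bounded_op[OF F]]
  show "bounded_closed (\<lambda>G. calc (\<lambda>x. F x * G x) = (\<lambda>f. calc F (calc G f)))"
  proof (rule bounded_closedI)
    show "calc (\<lambda>x. F x * 0) = (\<lambda>f. calc F (calc (\<lambda>_. 0) f))" by (simp add: calc_zero lin)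
  next
    fix G H assume *: "bounded_borel G" "bounded_borel H" "calc (\<lambda>x. F x * G x) = (\<lambda>f. calc F (calc G f))"
      "calc (\<lambda>x. F x * H x) = (\<lambda>f. calc F (calc H f))"
    show "calc (\<lambda>x. F x * (G x + H x)) = (\<lambda>f. calc F (calc (\<lambda>x. G x + H x) f))"
      unfolding distrib_left
      using calc_add[OF bounded_borel_mult[OF F *(1)] bounded_borel_mult[OF F *(2)]] * calc_add[OF *(1,2)]
      by (simp add: lin)
  next
    fix c G assume *: "bounded_borel G" "calc (\<lambda>x. F x * G x) = (\<lambda>f. calc F (calc G f))"
    show "calc (\<lambda>x. F x * (c * G x)) = (\<lambda>f. calc F (calc (\<lambda>x. c * G x) f))"
      unfolding mult.left_commute[of _ c] using calc_scale[OF bounded_borel_mult[OF F *(1)]] calc_scale[OF *(1)] *(2)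
      by (simp add: lin)
  next
    fix Gs G K assume Gs: "\<And>n. bounded_borel (Gs n)" and bG: "bounded_borel G"
      and eq: "\<And>n. calc (\<lambda>x. F x * Gs n x) = (\<lambda>f. calc F (calc (Gs n) f))"
      and K: "\<And>n x. cmod (Gs n x) \<le> K" and lim: "\<And>x. (\<lambda>n. Gs n x) \<longlonglongrightarrow> G x"
    obtain L where L: "0 \<le> L" "\<And>x. cmod (F x) \<le> L" using F bounded_borel_bound by metis
    have "cmod (F x * Gs n x) \<le> L * K" for n x
      using K L by (simp add: norm_mult mult_mono)
    moreover have "(\<lambda>n. F x * Gs n x) \<longlonglongrightarrow> F x * G x" for x by (intro tendsto_intros lim)
    ultimately have 1: "(\<lambda>n. hinner (calc (\<lambda>x. F x * Gs n x) f) g) \<longlonglongrightarrow> hinner (calc (\<lambda>x. F x * G x) f) g" for f g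
      by (intro calc_weak_limit[where K = "L * K"] bounded_borel_mult Gs F)
    have 2: "(\<lambda>n. hinner (calc (Gs n) f) (calc (\<lambda>x. cnj (F x)) g)) \<longlonglongrightarrow> hinner (calc G f) (calc (\<lambda>x. cnj (F x)) g)" for f g
      by (intro calc_weak_limit[OF Gs K lim])
    show "calc (\<lambda>x. F x * G x) = (\<lambda>f. calc F (calc G f))"
    proof (rule ext, rule hinner_eqI)
      fix f g
      show "hinner (calc (\<lambda>x. F x * G x) f) g = hinner (calc F (calc G f)) g"
        using LIMSEQ_unique[OF 1[of f g]] 2[of f g] by (simp add: eq calc_adjoint[OF F])
    qed
  qed
qed (rule calc_mult_gen[OF _ F])

lemma calc_commute:
  "bounded_borel F \<Longrightarrow> bounded_borel G \<Longrightarrow> calc F (calc G f) = calc G (calc F f)"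
  using calc_mult[of F G] calc_mult[of G F] by (metis (no_types, lifting) ext mult.commute)

text \<open>This is the L2 isometry of the calculus: the adjoint of \<open>calc F\<close> turns the
  squared norm into the integral of cnj F times F.\<close>

lemma calc_norm:
  assumes F: "bounded_borel F"
  shows "(norm (calc F f))\<^sup>2 = integral\<^sup>L (\<mu> f) (\<lambda>x. (cmod (F x))\<^sup>2)"
proof -
  have cF: "bounded_borel (\<lambda>x. cnj (F x))" using F by (rule bounded_borel_cnj)
  have "complex_of_real ((norm (calc F f))\<^sup>2) = hinner (calc (\<lambda>x. cnj (F x)) (calc F f)) f"
    using calc_adjoint[OF cF, of "calc F f" f] by (simp add: hinner_self)
  also have "\<dots> = hinner (calc (\<lambda>x. cnj (F x) * F x) f) f"
    by (simp add: calc_mult[OF cF F])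
  also have "\<dots> = integral\<^sup>L (\<mu> f) (\<lambda>x. cnj (F x) * F x)"
    by (rule calc_quadratic[OF bounded_borel_mult[OF cF F]])
  also have "\<dots> = integral\<^sup>L (\<mu> f) (\<lambda>x. complex_of_real ((cmod (F x))\<^sup>2))"
    by (simp only: complex_norm_square mult.commute)
  also have "\<dots> = of_real (integral\<^sup>L (\<mu> f) (\<lambda>x. (cmod (F x))\<^sup>2))"
    by (rule integral_complex_of_real)
  finally show ?thesis unfolding of_real_eq_iff .
qed

lemma calc_cong_AE:
  assumes "bounded_borel F" "bounded_borel G" "AE x in \<mu> f. F x = G x"
  shows "calc F f = calc G f"
proof -
  have b: "bounded_borel (\<lambda>x. F x - G x)" using assms by (intro bounded_borel_diff)
  have "(norm (calc F f - calc G f))\<^sup>2 = integral\<^sup>L (\<mu> f) (\<lambda>x. (cmod (F x - G x))\<^sup>2)"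
    using calc_norm[OF b, of f] by (simp add: calc_diff[OF assms(1,2)])
  also have "\<dots> = integral\<^sup>L (\<mu> f) (\<lambda>x. 0)"
  proof (rule integral_cong_AE)
    show "AE x in \<mu> f. (cmod (F x - G x))\<^sup>2 = 0" using assms(3) by eventually_elim simp
    have "(\<lambda>x. F x - G x) \<in> borel_measurable (\<mu> f)" using b by (intro measurable_mu bounded_borel_measurable)
    then show "(\<lambda>x. (cmod (F x - G x))\<^sup>2) \<in> borel_measurable (\<mu> f)" by measurable
  qed simp
  finally show ?thesis by simp
qed

text \<open>By the isometry the norm of the difference is an L2 norm, so bounded convergence almost
  everywhere for \<mu> f yields strong convergence. Admitting null sets is what later allows the
  point 0 to be ignored.\<close>

lemma calc_strong_limit:
  assumes Fs: "\<And>n. bounded_borel (Fs n)" and F: "bounded_borel F" and K: "\<And>n x. cmod (Fs n x) \<le> K"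
    and lim: "AE x in \<mu> f. (\<lambda>n. Fs n x) \<longlonglongrightarrow> F x"
  shows "(\<lambda>n. calc (Fs n) f) \<longlonglongrightarrow> calc F f"
proof -
  obtain L where L: "0 \<le> L" "\<And>x. cmod (F x) \<le> L" using F bounded_borel_bound by metis
  have b: "bounded_borel (\<lambda>x. Fs n x - F x)" for n using Fs F by (intro bounded_borel_diff)
  have m: "(\<lambda>x. (cmod (Fs n x - F x))\<^sup>2) \<in> borel_measurable (\<mu> f)" for n
  proof -
    have "(\<lambda>x. Fs n x - F x) \<in> borel_measurable (\<mu> f)" using b by (intro measurable_mu bounded_borel_measurable)
    then show ?thesis by measurable
  qed
  have "(\<lambda>n. integral\<^sup>L (\<mu> f) (\<lambda>x. (cmod (Fs n x - F x))\<^sup>2)) \<longlonglongrightarrow> integral\<^sup>L (\<mu> f) (\<lambda>x. 0)"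
  proof (rule integral_dominated_convergence[where w = "\<lambda>_. (K + L)\<^sup>2"])
    show "integrable (\<mu> f) (\<lambda>x. (K + L)\<^sup>2)" using finite_measure_mu by (simp add: finite_measure.integrable_const)
    show "AE x in \<mu> f. (\<lambda>n. (cmod (Fs n x - F x))\<^sup>2) \<longlonglongrightarrow> 0"
      using lim
    proof eventually_elim
      case (elim x)
      then have "(\<lambda>n. (cmod (Fs n x - F x))\<^sup>2) \<longlonglongrightarrow> (cmod (F x - F x))\<^sup>2" by (intro tendsto_intros)
      then show ?case by simp
    qed
    show "AE x in \<mu> f. norm ((cmod (Fs n x - F x))\<^sup>2) \<le> (K + L)\<^sup>2" for n
    proof (rule AE_I2)
      fix x
      have "cmod (Fs n x - F x) \<le> K + L"
        using norm_triangle_ineq4[of "Fs n x" "F x"] K[of n x] L(2)[of x] by linarith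
      then show "norm ((cmod (Fs n x - F x))\<^sup>2) \<le> (K + L)\<^sup>2" by (simp add: power_mono)
    qed
  qed (simp_all add: m)
  then have "(\<lambda>n. (norm (calc (Fs n) f - calc F f))\<^sup>2) \<longlonglongrightarrow> 0"
    using calc_norm[OF b] by (simp add: calc_diff[OF Fs F])
  then have "(\<lambda>n. sqrt ((norm (calc (Fs n) f - calc F f))\<^sup>2)) \<longlonglongrightarrow> sqrt 0" by (intro tendsto_real_sqrt)
  then have "(\<lambda>n. norm (calc (Fs n) f - calc F f)) \<longlonglongrightarrow> 0" by simp
  then show ?thesis by (metis LIM_zero_cancel tendsto_norm_zero_iff)
qed

text \<open>The measure of S at \<open>calc F f\<close> is the quadratic form of the indicator at
  that vector; commuting and multiplying turn it into the integral of |F|^2 over S. This identity is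
  the bridge from bounded functions to domains of unbounded operators.\<close>

lemma mu_calc:
  assumes F: "bounded_borel F"
  shows "\<mu> (calc F f) = density (\<mu> f) (\<lambda>x. ennreal ((cmod (F x))\<^sup>2))"
proof (rule measure_eqI)
  fix S assume "S \<in> sets (\<mu> (calc F f))"
  then have S: "S \<in> sets borel" by simp
  have cF: "bounded_borel (\<lambda>x. cnj (F x))" using F by (rule bounded_borel_cnj)
  have iS: "bounded_borel (indicator S)" using S by (rule bounded_borel_indicator)
  have mF: "(\<lambda>x. (cmod (F x))\<^sup>2) \<in> borel_measurable borel"
    using bounded_borel_measurable[OF F] by measurable
  have bF2: "bounded_borel (\<lambda>x. indicator S x * (cnj (F x) * F x))"
    by (intro bounded_borel_mult iS cF F)
  have "complex_of_real (measure (\<mu> (calc F f)) S) = integral\<^sup>L (\<mu> (calc F f)) (indicator S)"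
  proof -
    have "integral\<^sup>L (\<mu> (calc F f)) (\<lambda>x. complex_of_real (indicator S x)) = of_real (measure (\<mu> (calc F f)) S)"
      using S by (subst integral_complex_of_real) simp
    moreover have "(\<lambda>x. complex_of_real (indicator S x)) = indicator S"
      by (rule ext) (simp add: indicator_def)
    ultimately show ?thesis by simp
  qed
  also have "\<dots> = hinner (calc (indicator S) (calc F f)) (calc F f)"
    by (rule calc_quadratic[OF iS, symmetric])
  also have "\<dots> = hinner (calc (\<lambda>x. cnj (F x)) (calc (indicator S) (calc F f))) f"
    using calc_adjoint[OF cF, of "calc (indicator S) (calc F f)" f] by simp
  also have "\<dots> = hinner (calc (\<lambda>x. indicator S x * (cnj (F x) * F x)) f) f"
    using calc_commute[OF cF iS] by (simp add: calc_mult iS cF F bounded_borel_mult)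
  also have "\<dots> = integral\<^sup>L (\<mu> f) (\<lambda>x. indicator S x * (cnj (F x) * F x))"
    by (rule calc_quadratic[OF bF2])
  also have "\<dots> = integral\<^sup>L (\<mu> f) (\<lambda>x. complex_of_real ((cmod (F x))\<^sup>2 * indicator S x))"
    by (rule Bochner_Integration.integral_cong)
       (simp_all add: complex_norm_square[symmetric] mult.commute indicator_def)
  also have "\<dots> = of_real (integral\<^sup>L (\<mu> f) (\<lambda>x. (cmod (F x))\<^sup>2 * indicator S x))"
    by (rule integral_complex_of_real)
  finally have eq: "measure (\<mu> (calc F f)) S = integral\<^sup>L (\<mu> f) (\<lambda>x. (cmod (F x))\<^sup>2 * indicator S x)"
    unfolding of_real_eq_iff .
  have "integrable (\<mu> f) (\<lambda>x. complex_of_real ((cmod (F x))\<^sup>2 * indicator S x))"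
  proof -
    have "(\<lambda>x. complex_of_real ((cmod (F x))\<^sup>2 * indicator S x)) = (\<lambda>x. indicator S x * (cnj (F x) * F x))"
      by (rule ext) (simp add: complex_norm_square[symmetric] mult.commute indicator_def)
    then show ?thesis using integrable_bounded_borel[OF bF2] by simp
  qed
  then have int: "integrable (\<mu> f) (\<lambda>x. (cmod (F x))\<^sup>2 * indicator S x)"
    using complex_of_real_integrable_eq by blast
  have "emeasure (\<mu> (calc F f)) S = ennreal (measure (\<mu> (calc F f)) S)"
    by (rule finite_measure.emeasure_eq_measure[OF finite_measure_mu])
  also have "\<dots> = (\<integral>\<^sup>+ x. ennreal ((cmod (F x))\<^sup>2 * indicator S x) \<partial>\<mu> f)"
    unfolding eq by (rule nn_integral_eq_integral[OF int, symmetric]) simp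
  also have "\<dots> = (\<integral>\<^sup>+ x. ennreal ((cmod (F x))\<^sup>2) * indicator S x \<partial>\<mu> f)"
    by (rule nn_integral_cong) (simp add: indicator_def)
  also have "\<dots> = emeasure (density (\<mu> f) (\<lambda>x. ennreal ((cmod (F x))\<^sup>2))) S"
    using S measurable_mu[OF mF, of f] by (intro emeasure_density[symmetric]) auto
  finally show "emeasure (\<mu> (calc F f)) S = emeasure (density (\<mu> f) (\<lambda>x. ennreal ((cmod (F x))\<^sup>2))) S" .
qed simp

end

section \<open>Self-adjoint operators\<close>

lemma selfadjoint_add:
  "selfadjoint T \<Longrightarrow> f \<in> opdom T \<Longrightarrow> g \<in> opdom T \<Longrightarrow> f + g \<in> opdom T \<and> opapp T (f + g) = opapp T f + opapp T g"
  unfolding selfadjoint_def linear_op_def by blast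

lemma selfadjoint_scale:
  "selfadjoint T \<Longrightarrow> f \<in> opdom T \<Longrightarrow> hscaleC c f \<in> opdom T \<and> opapp T (hscaleC c f) = hscaleC c (opapp T f)"
  unfolding selfadjoint_def linear_op_def by blast

lemma selfadjoint_zero: "selfadjoint T \<Longrightarrow> 0 \<in> opdom T \<and> opapp T 0 = 0"
proof -
  assume T: "selfadjoint T"
  then have "0 \<in> opdom T" unfolding selfadjoint_def linear_op_def by blast
  then show ?thesis using selfadjoint_scale[OF T, of 0 0] by simp
qed

lemma selfadjoint_diff:
  "selfadjoint T \<Longrightarrow> f \<in> opdom T \<Longrightarrow> g \<in> opdom T \<Longrightarrow> f - g \<in> opdom T \<and> opapp T (f - g) = opapp T f - opapp T g"
  using selfadjoint_add[of T f "hscaleC (-1) g"] selfadjoint_scale[of T g "-1"] by (simp add: hscaleC_minus_one)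

lemma selfadjoint_symmetric:
  "selfadjoint T \<Longrightarrow> f \<in> opdom T \<Longrightarrow> g \<in> opdom T \<Longrightarrow> hinner (opapp T f) g = hinner f (opapp T g)"
  unfolding selfadjoint_def by blast

lemma selfadjoint_dense: "selfadjoint T \<Longrightarrow> closure (opdom T) = UNIV"
  unfolding selfadjoint_def by blast

text \<open>Self-adjointness gives membership in the domain, and density then identifies the image
  with h. Later memberships in domains are often obtained through this inclusion of the adjoint's
  graph in that of T.\<close>

lemma selfadjoint_adjoint_domain:
  assumes T: "selfadjoint T" and h: "\<And>f. f \<in> opdom T \<Longrightarrow> hinner (opapp T f) g = hinner f h"
  shows "g \<in> opdom T \<and> opapp T g = h"
proof -
  have g: "g \<in> opdom T" using T h unfolding selfadjoint_def by blast
  have "opapp T g = h"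
  proof (rule hinner_dense_eqI[OF selfadjoint_dense[OF T]])
    fix f assume f: "f \<in> opdom T"
    have "hinner f (opapp T g) = hinner f h" using selfadjoint_symmetric[OF T f g] h[OF f] by simp
    then show "hinner (opapp T g) f = hinner h f"
      by (subst (1 2) hinner_commute) simp
  qed
  then show ?thesis using g by blast
qed

lemma selfadjoint_closed:
  assumes T: "selfadjoint T" and s: "\<And>n. s n \<in> opdom T" "s \<longlonglongrightarrow> f" "(\<lambda>n. opapp T (s n)) \<longlonglongrightarrow> h"
  shows "f \<in> opdom T \<and> opapp T f = h"
proof (rule selfadjoint_adjoint_domain[OF T])
  fix u assume u: "u \<in> opdom T"
  have "(\<lambda>n. hinner (opapp T u) (s n)) \<longlonglongrightarrow> hinner (opapp T u) f" by (intro tendsto_hinner tendsto_const s)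
  moreover have "(\<lambda>n. hinner u (opapp T (s n))) \<longlonglongrightarrow> hinner u h" by (intro tendsto_hinner tendsto_const s)
  moreover have "hinner (opapp T u) (s n) = hinner u (opapp T (s n))" for n
    using selfadjoint_symmetric[OF T u s(1)] .
  ultimately show "hinner (opapp T u) f = hinner u h" using LIMSEQ_unique by simp
qed

lemma selfadjoint_real:
  assumes "selfadjoint T" "f \<in> opdom T" shows "Im (hinner (opapp T f) f) = 0"
proof -
  have "hinner (opapp T f) f = cnj (hinner (opapp T f) f)"
    using selfadjoint_symmetric[OF assms(1) assms(2) assms(2)] hinner_commute[of f "opapp T f"] by simp
  then show ?thesis by (simp add: complex_eq_iff)
qed

text \<open>The two conditions on c say that c is i or -i, so one lemma serves both shifts. The
  mixed terms cancel by symmetry of T.\<close>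

lemma selfadjoint_shift_inner:
  assumes "selfadjoint T" "f \<in> opdom T" "g \<in> opdom T" "cnj c = - c" "c * c = -1"
  shows "hinner (opapp T f + hscaleC c f) (opapp T g + hscaleC c g) = hinner (opapp T f) (opapp T g) + hinner f g"
proof -
  have k: "c * (c * z) = - z" for z using assms(5) by (simp add: mult.assoc[symmetric])
  show ?thesis using selfadjoint_symmetric[OF assms(1-3)]
    by (simp add: hinner_linear assms(4) k algebra_simps)
qed

lemma selfadjoint_shift_norm:
  assumes "selfadjoint T" "f \<in> opdom T" "cnj c = - c" "c * c = -1"
  shows "norm f \<le> norm (opapp T f + hscaleC c f)"
proof -
  have "(norm (opapp T f + hscaleC c f))\<^sup>2 = (norm (opapp T f))\<^sup>2 + (norm f)\<^sup>2"
    using selfadjoint_shift_inner[OF assms(1,2,2,3,4)] by (simp add: hinner_norm_sq)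
  then have "(norm f)\<^sup>2 \<le> (norm (opapp T f + hscaleC c f))\<^sup>2" by simp
  then show ?thesis by (rule power2_le_imp_le) simp
qed

text \<open>The shift does not decrease norms, so its range is closed. A vector orthogonal to the
  range lies in the domain and satisfies T g = c g with c not real, hence is zero.\<close>

lemma selfadjoint_shift_surj:
  assumes T: "selfadjoint T" and c: "cnj c = - c" "c * c = -1"
  shows "\<exists>f\<in>opdom T. opapp T f + hscaleC c f = h"
proof -
  define M where "M = (\<lambda>f. opapp T f + hscaleC c f) ` opdom T"
  have sub: "csubspace M"
    unfolding csubspace_def
  proof (intro conjI ballI allI)
    show "0 \<in> M" unfolding M_def using selfadjoint_zero[OF T] by (intro image_eqI[of _ _ 0]) simp_all
    show "x + y \<in> M" if xy: "x \<in> M" "y \<in> M" for x y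
    proof -
      obtain f g where "f \<in> opdom T" "g \<in> opdom T" "x = opapp T f + hscaleC c f" "y = opapp T g + hscaleC c g"
        using xy M_def by blast
      then show ?thesis unfolding M_def using selfadjoint_add[OF T, of f g]
        by (intro image_eqI[of _ _ "f + g"]) (simp_all add: hscaleC_add_right)
    qed
    show "hscaleC a x \<in> M" if x: "x \<in> M" for a x
    proof -
      obtain f where "f \<in> opdom T" "x = opapp T f + hscaleC c f" using x M_def by blast
      then show ?thesis unfolding M_def using selfadjoint_scale[OF T, of f a]
        by (intro image_eqI[of _ _ "hscaleC a f"]) (simp_all add: hscaleC_add_right hscaleC_hscaleC mult.commute)
    qed
  qed
  have "closed M"
    unfolding closed_sequential_limits
  proof (intro allI impI, elim conjE)
    fix y l assume "\<forall>n. y n \<in> M" and yl: "y \<longlonglongrightarrow> l"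
    then have "\<forall>n. \<exists>f. f \<in> opdom T \<and> y n = opapp T f + hscaleC c f" unfolding M_def by blast
    then obtain f where f: "\<And>n. f n \<in> opdom T" "\<And>n. y n = opapp T (f n) + hscaleC c (f n)" by metis
    have le: "norm (f m - f n) \<le> norm (y m - y n)" for m n
    proof -
      have "y m - y n = opapp T (f m - f n) + hscaleC c (f m - f n)"
        using selfadjoint_diff[OF T f(1)[of m] f(1)[of n]] by (simp add: f(2) hscaleC_diff_right)
      then show ?thesis
        using selfadjoint_shift_norm[OF T _ c, of "f m - f n"] selfadjoint_diff[OF T f(1)[of m] f(1)[of n]] by simp
    qed
    have "Cauchy f"
    proof (rule metric_CauchyI)
      fix e :: real assume "0 < e"
      then obtain N where N: "\<forall>m\<ge>N. \<forall>n\<ge>N. dist (y m) (y n) < e"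
        using LIMSEQ_imp_Cauchy[OF yl] metric_CauchyD by blast
      then have "dist (f m) (f n) < e" if "m \<ge> N" "n \<ge> N" for m n
        using le[of m n] that by (force simp: dist_norm)
      then show "\<exists>N. \<forall>m\<ge>N. \<forall>n\<ge>N. dist (f m) (f n) < e" by blast
    qed
    then obtain g where g: "f \<longlonglongrightarrow> g" using Cauchy_convergent convergent_def by blast
    have "(\<lambda>n. y n - hscaleC c (f n)) \<longlonglongrightarrow> l - hscaleC c g"
      by (intro tendsto_diff yl tendsto_hscaleC g)
    then have "(\<lambda>n. opapp T (f n)) \<longlonglongrightarrow> l - hscaleC c g" by (simp add: f(2))
    from selfadjoint_closed[OF T f(1) g this] show "l \<in> M" unfolding M_def
      by (intro image_eqI[of _ _ g]) simp_all
  qed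
  with sub obtain m where m: "m \<in> M" "\<forall>u\<in>M. hinner (h - m) u = 0" using orthogonal_projection_exists by blast
  define g where "g = h - m"
  have "hinner (opapp T f) g = hinner f (hscaleC c g)" if f: "f \<in> opdom T" for f
  proof -
    have "hinner g (opapp T f + hscaleC c f) = 0" using m f unfolding g_def M_def by blast
    then have "hinner (opapp T f + hscaleC c f) g = 0" by (subst hinner_commute) simp
    then show ?thesis by (simp add: hinner_linear c add_eq_0_iff)
  qed
  from selfadjoint_adjoint_domain[OF T this] have g: "g \<in> opdom T" "opapp T g = hscaleC c g" by auto
  have "c * hinner g g = cnj c * hinner g g"
    using selfadjoint_symmetric[OF T g(1) g(1)] by (simp add: g hinner_linear)
  moreover have "c \<noteq> 0" using c by auto
  ultimately have "hinner g g = 0" using c by (simp add: eq_neg_iff_add_eq_0)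
  then have "h = m" by (simp add: g_def)
  then show ?thesis using m M_def by blast
qed

text \<open>The inverse of T + i as a total function; the calculus of T will be pinned down by this
  single operator.\<close>

definition resolvent_i :: "('a::chilbert) op \<Rightarrow> 'a \<Rightarrow> 'a" where
  "resolvent_i T h = (THE f. f \<in> opdom T \<and> opapp T f + hscaleC \<i> f = h)"

lemma selfadjoint_shift_inj:
  assumes T: "selfadjoint T" and c: "cnj c = - c" "c * c = -1" and f: "f \<in> opdom T" "g \<in> opdom T"
    and eq: "opapp T f + hscaleC c f = opapp T g + hscaleC c g"
  shows "f = g"
proof -
  have "norm (f - g) \<le> norm (opapp T (f - g) + hscaleC c (f - g))"
    using selfadjoint_shift_norm[OF T _ c] selfadjoint_diff[OF T f] by blast
  also have "opapp T (f - g) + hscaleC c (f - g) = 0"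
    using selfadjoint_diff[OF T f] eq by (simp add: hscaleC_diff_right add_diff_add[symmetric])
  finally show ?thesis by simp
qed

lemma resolvent_i_eqI:
  assumes "selfadjoint T" "f \<in> opdom T" "opapp T f + hscaleC \<i> f = h" shows "resolvent_i T h = f"
  unfolding resolvent_i_def using assms selfadjoint_shift_inj[OF assms(1), of \<i>] by (intro the_equality) auto

lemma resolvent_i:
  assumes "selfadjoint T"
  shows "resolvent_i T h \<in> opdom T" "opapp T (resolvent_i T h) + hscaleC \<i> (resolvent_i T h) = h"
proof -
  obtain f where "f \<in> opdom T" "opapp T f + hscaleC \<i> f = h"
    using selfadjoint_shift_surj[OF assms, of \<i> h] by auto
  then show "resolvent_i T h \<in> opdom T" "opapp T (resolvent_i T h) + hscaleC \<i> (resolvent_i T h) = h"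
    using resolvent_i_eqI[OF assms] by auto
qed

lemma bounded_op_resolvent_i:
  assumes T: "selfadjoint T" shows "bounded_op (resolvent_i T)"
  unfolding bounded_op_def
proof (intro conjI allI exI[of _ 1])
  note r = resolvent_i[OF T]
  show "resolvent_i T (x + y) = resolvent_i T x + resolvent_i T y" for x y
  proof (rule resolvent_i_eqI[OF T])
    have "opapp T (resolvent_i T x + resolvent_i T y) + hscaleC \<i> (resolvent_i T x + resolvent_i T y)
      = (opapp T (resolvent_i T x) + hscaleC \<i> (resolvent_i T x)) + (opapp T (resolvent_i T y) + hscaleC \<i> (resolvent_i T y))"
      using selfadjoint_add[OF T r(1)[of x] r(1)[of y]] by (simp add: hscaleC_add_right)
    then show "opapp T (resolvent_i T x + resolvent_i T y) + hscaleC \<i> (resolvent_i T x + resolvent_i T y) = x + y"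
      by (simp add: r(2))
  qed (use selfadjoint_add[OF T r(1) r(1)] in blast)
  show "resolvent_i T (hscaleC c x) = hscaleC c (resolvent_i T x)" for c x
  proof (rule resolvent_i_eqI[OF T])
    have "opapp T (hscaleC c (resolvent_i T x)) + hscaleC \<i> (hscaleC c (resolvent_i T x))
      = hscaleC c (opapp T (resolvent_i T x) + hscaleC \<i> (resolvent_i T x))"
      using selfadjoint_scale[OF T r(1)[of x], of c] by (simp add: hscaleC_add_right hscaleC_hscaleC mult.commute)
    then show "opapp T (hscaleC c (resolvent_i T x)) + hscaleC \<i> (hscaleC c (resolvent_i T x)) = hscaleC c x"
      by (simp add: r(2))
  qed (use selfadjoint_scale[OF T r(1)] in blast)
  show "norm (resolvent_i T x) \<le> 1 * norm x" for x
    using selfadjoint_shift_norm[OF T r(1)[of x], of \<i>] by (simp add: r(2))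
qed

section \<open>Unbounded functional calculus\<close>

lemma bounded_borel_rational:
  assumes "Im z \<noteq> 0" shows "bounded_borel (\<lambda>x. 1 / (of_real x - z))"
proof (rule bounded_borelI)
  have nz: "complex_of_real x - z \<noteq> 0" for x using assms by (auto simp: complex_eq_iff)
  then show "(\<lambda>x. 1 / (of_real x - z)) \<in> borel_measurable borel"
    by (intro borel_measurable_continuous_onI continuous_intros) auto
  show "cmod (1 / (of_real x - z)) \<le> 1 / \<bar>Im z\<bar>" for x
  proof -
    have "\<bar>Im z\<bar> \<le> cmod (of_real x - z)" using abs_Im_le_cmod[of "of_real x - z"] by simp
    then show ?thesis using assms by (simp add: norm_divide frac_le)
  qed
qed

lemma bounded_borel_inv_i: "bounded_borel (\<lambda>x. 1 / (of_real x + \<i>))"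
  using bounded_borel_rational[of "-\<i>"] by simp

lemma bounded_borel_mult_x_inv_i: "bounded_borel (\<lambda>x. of_real x / (of_real x + \<i>))"
proof -
  have "of_real x / (of_real x + \<i>) = 1 - \<i> * (1 / (of_real x + \<i>))" for x
    by (simp add: divide_simps)
  then show ?thesis
    using bounded_borel_diff[OF bounded_borel_const bounded_borel_mult[OF bounded_borel_const bounded_borel_inv_i]] by simp
qed

lemma cmod_inv_i_sq: "(cmod (1 / (of_real x + \<i>)))\<^sup>2 = 1 / (x\<^sup>2 + 1)"
  by (simp add: norm_divide power_divide cmod_power2)

lemma cayley_inv_i: "cayley x = 1 - 2 * \<i> * (1 / (of_real x + \<i>))"
  by (simp add: cayley_def divide_simps)

context borel_calculus
begin

text \<open>By \<open>mu_calc\<close> the measure at this vector has density 1 / (x^2 + 1) with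
  respect to \<mu> g, which compensates x^2.\<close>

lemma integrable_square_calc_inv_i:
  "integrable (\<mu> (calc (\<lambda>x. 1 / (of_real x + \<i>)) g)) (\<lambda>x. x\<^sup>2)"
proof -
  have m: "(\<lambda>x. x\<^sup>2) \<in> borel_measurable (\<mu> g)" "(\<lambda>x. 1 / (x\<^sup>2 + 1)) \<in> borel_measurable (\<mu> g)"
    by (rule measurable_mu; measurable)+
  have "integrable (\<mu> g) (\<lambda>x. (1 / (x\<^sup>2 + 1)) *\<^sub>R x\<^sup>2)"
  proof (rule finite_measure.integrable_const_bound[OF finite_measure_mu, where B = 1])
    show "AE x in \<mu> g. norm ((1 / (x\<^sup>2 + 1)) *\<^sub>R x\<^sup>2) \<le> 1"
    proof (rule AE_I2)
      fix x :: real
      have "0 < x\<^sup>2 + 1" by (simp add: add_nonneg_pos)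
      then show "norm ((1 / (x\<^sup>2 + 1)) *\<^sub>R x\<^sup>2) \<le> 1" by (simp add: divide_le_eq)
    qed
    show "(\<lambda>x. (1 / (x\<^sup>2 + 1)) *\<^sub>R x\<^sup>2) \<in> borel_measurable (\<mu> g)" using m by measurable
  qed
  then show ?thesis
    unfolding mu_calc[OF bounded_borel_inv_i] cmod_inv_i_sq
    by (subst integrable_density[OF m(1) m(2)]) auto
qed

lemma integral_x_calc_inv_i:
  "complex_of_real (integral\<^sup>L (\<mu> (calc (\<lambda>x. 1 / (of_real x + \<i>)) g)) (\<lambda>x. x))
     = hinner (calc (\<lambda>x. of_real x / (of_real x + \<i>)) g) (calc (\<lambda>x. 1 / (of_real x + \<i>)) g)"
proof -
  have m: "(\<lambda>x. x) \<in> borel_measurable (\<mu> g)" "(\<lambda>x. 1 / (x\<^sup>2 + 1)) \<in> borel_measurable (\<mu> g)"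
    by (rule measurable_mu; measurable)+
  have c: "bounded_borel (\<lambda>x. cnj (1 / (of_real x + \<i>)))" by (rule bounded_borel_cnj[OF bounded_borel_inv_i])
  have eq: "cnj (1 / (of_real x + \<i>)) * (of_real x / (of_real x + \<i>)) = of_real ((1 / (x\<^sup>2 + 1)) * x)" for x
  proof -
    have "cnj (1 / (of_real x + \<i>)) * (1 / (of_real x + \<i>)) = of_real (1 / (x\<^sup>2 + 1))"
      unfolding cmod_inv_i_sq[symmetric] complex_norm_square by (simp add: mult.commute)
    then show ?thesis by (metis (no_types, lifting) mult.assoc mult.commute of_real_mult times_divide_eq_right mult_1)
  qed
  have "hinner (calc (\<lambda>x. of_real x / (of_real x + \<i>)) g) (calc (\<lambda>x. 1 / (of_real x + \<i>)) g)
    = hinner (calc (\<lambda>x. cnj (1 / (of_real x + \<i>))) (calc (\<lambda>x. of_real x / (of_real x + \<i>)) g)) g"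
    using calc_adjoint[OF c] by simp
  also have "\<dots> = integral\<^sup>L (\<mu> g) (\<lambda>x. cnj (1 / (of_real x + \<i>)) * (of_real x / (of_real x + \<i>)))"
    unfolding calc_mult[OF c bounded_borel_mult_x_inv_i, symmetric, THEN fun_cong]
    by (rule calc_quadratic[OF bounded_borel_mult[OF c bounded_borel_mult_x_inv_i]])
  also have "\<dots> = complex_of_real (integral\<^sup>L (\<mu> g) (\<lambda>x. (1 / (x\<^sup>2 + 1)) * x))"
    unfolding eq by (rule integral_complex_of_real)
  also have "integral\<^sup>L (\<mu> g) (\<lambda>x. (1 / (x\<^sup>2 + 1)) * x) = integral\<^sup>L (\<mu> (calc (\<lambda>x. 1 / (of_real x + \<i>)) g)) (\<lambda>x. x)"
    unfolding mu_calc[OF bounded_borel_inv_i] cmod_inv_i_sq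
    by (subst integral_density[OF m(1) m(2)]) auto
  finally show ?thesis by simp
qed

text \<open>The vector g should be x + i applied to f. It is obtained as the limit of the
  truncations to [-n, n], a Cauchy sequence because the differences are bounded by tails of the
  integral of x^2 + 1.\<close>

lemma integrable_square_imp_range:
  assumes int: "integrable (\<mu> f) (\<lambda>x. x\<^sup>2)"
  shows "\<exists>g. f = calc (\<lambda>x. 1 / (of_real x + \<i>)) g"
proof -
  define G where "G n x = (indicator {- real n..real n} x :: complex)" for n x
  define F where "F n x = G n x * (of_real x + \<i>)" for n x
  have G: "bounded_borel (G n)" for n unfolding G_def[abs_def] by (intro bounded_borel_indicator) simp
  have F: "bounded_borel (F n)" for n
  proof (rule bounded_borelI[of _ "real n + 1"])
    have "(\<lambda>x. complex_of_real x + \<i>) \<in> borel_measurable borel"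
      by (intro borel_measurable_continuous_onI continuous_intros)
    then show "F n \<in> borel_measurable borel" unfolding F_def[abs_def]
      using bounded_borel_measurable[OF G] by (intro borel_measurable_times)
    show "cmod (F n x) \<le> real n + 1" for x
    proof (cases "x \<in> {- real n..real n}")
      case True
      have "cmod (of_real x + \<i>) \<le> \<bar>x\<bar> + 1" using norm_triangle_ineq[of "of_real x" \<i>] by simp
      then show ?thesis using True by (auto simp: F_def G_def)
    qed (simp add: F_def G_def)
  qed
  have m2: "(\<lambda>x. x\<^sup>2 + 1) \<in> borel_measurable (\<mu> f)" by (rule measurable_mu) measurable
  have int1: "integrable (\<mu> f) (\<lambda>x. x\<^sup>2 + 1)"
    using int finite_measure_mu by (simp add: finite_measure.integrable_const)
  define t where "t N = integral\<^sup>L (\<mu> f) (\<lambda>x. (x\<^sup>2 + 1) * indicator (- {- real N..real N}) x)" for N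
  have tlim: "t \<longlonglongrightarrow> 0"
  proof -
    have "(\<lambda>N. integral\<^sup>L (\<mu> f) (\<lambda>x. (x\<^sup>2 + 1) * indicator (- {- real N..real N}) x)) \<longlonglongrightarrow> integral\<^sup>L (\<mu> f) (\<lambda>x. 0)"
    proof (rule integral_dominated_convergence[where w = "\<lambda>x. x\<^sup>2 + 1"])
      show "AE x in \<mu> f. (\<lambda>N. (x\<^sup>2 + 1) * indicator (- {- real N..real N}) x) \<longlonglongrightarrow> 0"
      proof (rule AE_I2)
        fix x :: real
        obtain N where N: "\<bar>x\<bar> \<le> real N" using real_arch_simple by blast
        have "\<forall>\<^sub>F n in sequentially. (x\<^sup>2 + 1) * indicator (- {- real n..real n}) x = 0"
          by (rule eventually_sequentiallyI[of N]) (use N in \<open>auto simp: indicator_def\<close>)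
        then show "(\<lambda>N. (x\<^sup>2 + 1) * indicator (- {- real N..real N}) x) \<longlonglongrightarrow> 0" by (rule tendsto_eventually)
      qed
      show "AE x in \<mu> f. norm ((x\<^sup>2 + 1) * indicator (- {- real N..real N}) x) \<le> x\<^sup>2 + 1" for N
        by (rule AE_I2) (simp add: indicator_def)
      show "(\<lambda>x. (x\<^sup>2 + 1) * indicator (- {- real N..real N}) x) \<in> borel_measurable (\<mu> f)" for N
        by (intro borel_measurable_times m2 measurable_mu borel_measurable_indicator) simp
    qed (simp_all add: int1)
    then show ?thesis by (simp add: t_def[abs_def])
  qed
  have diff: "(norm (calc (F m) f - calc (F n) f))\<^sup>2 \<le> t N" if mn: "N \<le> m" "N \<le> n" for m n N
  proof -
    have b: "bounded_borel (\<lambda>x. F m x - F n x)" by (intro bounded_borel_diff F)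
    have "(norm (calc (F m) f - calc (F n) f))\<^sup>2 = integral\<^sup>L (\<mu> f) (\<lambda>x. (cmod (F m x - F n x))\<^sup>2)"
      using calc_norm[OF b, of f] by (simp add: calc_diff[OF F F])
    also have "\<dots> \<le> t N"
      unfolding t_def
    proof (rule integral_mono)
      have p: "(cmod z)\<^sup>2 = Re (cnj z * z)" for z unfolding cmod_power2 by (simp add: power2_eq_square)
      show "integrable (\<mu> f) (\<lambda>x. (cmod (F m x - F n x))\<^sup>2)"
        unfolding p by (intro integrable_Re integrable_bounded_borel bounded_borel_mult bounded_borel_cnj b)
      have "(\<lambda>x. (x\<^sup>2 + 1) * indicator (- {- real N..real N}) x) \<in> borel_measurable (\<mu> f)"
        by (intro borel_measurable_times m2 measurable_mu borel_measurable_indicator) simp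
      then show "integrable (\<mu> f) (\<lambda>x. (x\<^sup>2 + 1) * indicator (- {- real N..real N}) x)"
        by (rule Bochner_Integration.integrable_bound[OF int1]) (simp add: indicator_def)
      show "(cmod (F m x - F n x))\<^sup>2 \<le> (x\<^sup>2 + 1) * indicator (- {- real N..real N}) x" for x
      proof (cases "x \<in> {- real N..real N}")
        case True
        then have "F m x = F n x" using mn by (auto simp: F_def G_def indicator_def)
        then show ?thesis using True by simp
      next
        case False
        have e: "F m x - F n x = (G m x - G n x) * (of_real x + \<i>)" by (simp add: F_def algebra_simps)
        have "cmod (G m x - G n x) \<le> 1" by (simp add: G_def indicator_def)
        then have "(cmod (G m x - G n x))\<^sup>2 \<le> 1" by (simp add: abs_square_le_1)
        moreover have "(cmod (of_real x + \<i>))\<^sup>2 = x\<^sup>2 + 1" by (simp add: cmod_power2)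
        ultimately show ?thesis using False
          by (simp add: e norm_mult power_mult_distrib mult_left_le_one_le)
      qed
    qed
    finally show ?thesis .
  qed
  have "Cauchy (\<lambda>n. calc (F n) f)"
  proof (rule metric_CauchyI)
    fix e :: real assume e: "0 < e"
    then have "\<forall>\<^sub>F N in sequentially. t N < e\<^sup>2" using order_tendstoD(2)[OF tlim] by simp
    then obtain N where N: "t N < e\<^sup>2" using eventually_happens by force
    have "dist (calc (F m) f) (calc (F n) f) < e" if "m \<ge> N" "n \<ge> N" for m n
    proof -
      have "(norm (calc (F m) f - calc (F n) f))\<^sup>2 < e\<^sup>2" using diff[OF that] N by linarith
      then show ?thesis using e by (simp add: dist_norm power2_less_imp_less)
    qed
    then show "\<exists>N. \<forall>m\<ge>N. \<forall>n\<ge>N. dist (calc (F m) f) (calc (F n) f) < e" by blast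
  qed
  then obtain g where g: "(\<lambda>n. calc (F n) f) \<longlonglongrightarrow> g" using Cauchy_convergent convergent_def by blast
  have 1: "(\<lambda>n. calc (\<lambda>x. 1 / (of_real x + \<i>)) (calc (F n) f)) \<longlonglongrightarrow> calc (\<lambda>x. 1 / (of_real x + \<i>)) g"
    by (rule bounded_op_tendsto[OF calc_bounded_op[OF bounded_borel_inv_i] g])
  \<comment> \<open>Applying 1 / (x + i) to the truncated vector gives the cut-off of f itself,
    which tends to f.\<close>
  have 2: "calc (\<lambda>x. 1 / (of_real x + \<i>)) (calc (F n) f) = calc (G n) f" for n
  proof -
    have "(\<lambda>x. 1 / (of_real x + \<i>) * F n x) = G n" by (rule ext) (simp add: F_def)
    then show ?thesis using calc_mult[OF bounded_borel_inv_i F[of n]] by metis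
  qed
  have "(\<lambda>n. calc (G n) f) \<longlonglongrightarrow> calc (\<lambda>_. 1) f"
  proof (rule calc_strong_limit[where K = 1])
    show "AE x in \<mu> f. (\<lambda>n. G n x) \<longlonglongrightarrow> 1"
    proof (rule AE_I2)
      fix x :: real
      obtain N where N: "\<bar>x\<bar> \<le> real N" using real_arch_simple by blast
      have "\<forall>\<^sub>F n in sequentially. G n x = 1"
        by (rule eventually_sequentiallyI[of N]) (use N in \<open>auto simp: G_def indicator_def\<close>)
      then show "(\<lambda>n. G n x) \<longlonglongrightarrow> 1" by (rule tendsto_eventually)
    qed
    show "cmod (G n x) \<le> 1" for n x by (simp add: G_def indicator_def)
  qed (simp_all add: G)
  then have "f = calc (\<lambda>x. 1 / (of_real x + \<i>)) g"
    using LIMSEQ_unique[OF 1] by (simp add: 2 calc_one)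
  then show ?thesis by blast
qed

end

text \<open>The operator enters only through the value of the calculus at 1 / (x + i). This suffices
  because T is recovered from its resolvent.\<close>

locale sa_calculus = borel_calculus \<mu> \<G>
  for \<mu> :: "'a::chilbert \<Rightarrow> real measure" and \<G> +
  fixes T :: "'a op"
  assumes sa: "selfadjoint T"
    and calc_inv_i: "calc (\<lambda>x. 1 / (of_real x + \<i>)) = resolvent_i T"
begin

text \<open>F equals 1 / (x + i) times x F + i F, so \<open>calc F h\<close> lies in the range of
  the resolvent, and applying T + i to it reveals the action of T.\<close>

lemma calc_domain:
  assumes F: "bounded_borel F" and xF: "bounded_borel (\<lambda>x. of_real x * F x)"
  shows "calc F h \<in> opdom T \<and> opapp T (calc F h) = calc (\<lambda>x. of_real x * F x) h"
proof -
  have b: "bounded_borel (\<lambda>x. of_real x * F x + \<i> * F x)"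
    by (intro bounded_borel_add xF bounded_borel_mult bounded_borel_const F)
  have e0: "(\<lambda>x. 1 / (of_real x + \<i>) * (of_real x * F x + \<i> * F x)) = F"
    by (rule ext) (simp flip: distrib_right)
  have e: "calc F h = resolvent_i T (calc (\<lambda>x. of_real x * F x + \<i> * F x) h)"
    using fun_cong[OF calc_mult[OF bounded_borel_inv_i b], of h] unfolding e0 calc_inv_i .
  have "calc (\<lambda>x. of_real x * F x + \<i> * F x) h = calc (\<lambda>x. of_real x * F x) h + hscaleC \<i> (calc F h)"
    using calc_add[OF xF bounded_borel_mult[OF bounded_borel_const F, of \<i>]] calc_scale[OF F, of \<i>] by simp
  then have "opapp T (calc F h) + hscaleC \<i> (calc F h) = calc (\<lambda>x. of_real x * F x) h + hscaleC \<i> (calc F h)"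
    using resolvent_i(2)[OF sa, of "calc (\<lambda>x. of_real x * F x + \<i> * F x) h"] e by metis
  then show ?thesis using resolvent_i(1)[OF sa, of "calc (\<lambda>x. of_real x * F x + \<i> * F x) h"] e
    by (simp only: add_right_cancel)
qed

lemma domain_iff: "f \<in> opdom T \<longleftrightarrow> integrable (\<mu> f) (\<lambda>x. x\<^sup>2)"
proof
  assume "f \<in> opdom T"
  then have "f = calc (\<lambda>x. 1 / (of_real x + \<i>)) (opapp T f + hscaleC \<i> f)"
    using resolvent_i_eqI[OF sa] calc_inv_i by simp
  then show "integrable (\<mu> f) (\<lambda>x. x\<^sup>2)" using integrable_square_calc_inv_i by metis
next
  assume "integrable (\<mu> f) (\<lambda>x. x\<^sup>2)"
  then show "f \<in> opdom T" using integrable_square_imp_range calc_inv_i resolvent_i(1)[OF sa] by metis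
qed

lemma form_integral:
  assumes "f \<in> opdom T" shows "hinner (opapp T f) f = complex_of_real (integral\<^sup>L (\<mu> f) (\<lambda>x. x))"
proof -
  define g where "g = opapp T f + hscaleC \<i> f"
  have f: "f = calc (\<lambda>x. 1 / (of_real x + \<i>)) g"
    using resolvent_i_eqI[OF sa assms] calc_inv_i by (simp add: g_def)
  have "opapp T f = calc (\<lambda>x. of_real x / (of_real x + \<i>)) g"
    using calc_domain[OF bounded_borel_inv_i, of g] bounded_borel_mult_x_inv_i f by simp
  then show ?thesis using integral_x_calc_inv_i[of g] f by simp
qed

text \<open>The rational function solves the resolvent equation by \<open>calc_domain\<close>. The
  description inside \<open>resolvent\<close> also needs uniqueness: a symmetric operator has no
  nonreal eigenvalue.\<close>

lemma calc_resolvent: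
  assumes z: "Im z \<noteq> 0"
  shows "opdom (resolvent z T) = UNIV" "opapp (resolvent z T) = calc (\<lambda>x. 1 / (of_real x - z))"
proof -
  have b: "bounded_borel (\<lambda>x. 1 / (of_real x - z))" by (rule bounded_borel_rational[OF z])
  have e: "(\<lambda>x. of_real x * (1 / (of_real x - z))) = (\<lambda>x. 1 + z * (1 / (of_real x - z)))"
  proof
    fix x :: real
    have "complex_of_real x - z \<noteq> 0" using z by (auto simp: complex_eq_iff)
    then show "of_real x * (1 / (of_real x - z)) = 1 + z * (1 / (of_real x - z))" by (simp add: field_simps)
  qed
  have bx: "bounded_borel (\<lambda>x. of_real x * (1 / (of_real x - z)))"
    unfolding e by (intro bounded_borel_add bounded_borel_const bounded_borel_mult b)
  have c: "calc (\<lambda>x. of_real x * (1 / (of_real x - z))) h = h + hscaleC z (calc (\<lambda>x. 1 / (of_real x - z)) h)" for h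
    unfolding e
    using calc_add[OF bounded_borel_const bounded_borel_mult[OF bounded_borel_const b, of z], of 1] calc_scale[OF b, of z]
    by (simp add: calc_one)
  have R: "calc (\<lambda>x. 1 / (of_real x - z)) h \<in> opdom T
     \<and> opapp T (calc (\<lambda>x. 1 / (of_real x - z)) h) - hscaleC z (calc (\<lambda>x. 1 / (of_real x - z)) h) = h" for h
    using calc_domain[OF b bx, of h] c by simp
  have inj: "f = g" if fg: "f \<in> opdom T" "g \<in> opdom T" "opapp T f - hscaleC z f = opapp T g - hscaleC z g" for f g
  proof -
    define d where "d = f - g"
    have d: "d \<in> opdom T" "opapp T d = hscaleC z d"
    proof -
      have "opapp T f - opapp T g = hscaleC z f - hscaleC z g"
        using arg_cong[OF fg(3), of "\<lambda>u. u + hscaleC z f - opapp T g"] by simp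
      then show "d \<in> opdom T" "opapp T d = hscaleC z d"
        using selfadjoint_diff[OF sa fg(1,2)] by (auto simp: d_def hscaleC_diff_right)
    qed
    have "Im (z * of_real ((norm d)\<^sup>2)) = 0"
      using selfadjoint_real[OF sa d(1)] by (simp add: d(2) hinner_linear hinner_self)
    then show ?thesis using z by (simp add: d_def)
  qed
  show "opdom (resolvent z T) = UNIV" unfolding resolvent_def opdom_def
    using R unfolding opdom_def by (auto simp: image_iff) metis
  show "opapp (resolvent z T) = calc (\<lambda>x. 1 / (of_real x - z))"
  proof
    fix h
    have "(THE f. f \<in> opdom T \<and> opapp T f - hscaleC z f = h) = calc (\<lambda>x. 1 / (of_real x - z)) h"
      using R[of h] inj by (intro the_equality) auto
    then show "opapp (resolvent z T) h = calc (\<lambda>x. 1 / (of_real x - z)) h"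
      by (simp add: resolvent_def opapp_def)
  qed
qed

text \<open>The spectral projection of {0} maps into the kernel of T, because x times the indicator
  of {0} vanishes.\<close>

lemma AE_nonzero:
  assumes ker: "op_ker T = {0}" shows "AE x in \<mu> f. x \<noteq> 0"
proof -
  have b: "bounded_borel (indicator {0} :: real \<Rightarrow> complex)" by (rule bounded_borel_indicator) simp
  have z: "(\<lambda>x. complex_of_real x * indicator {0} x) = (\<lambda>_. 0)" by (rule ext) (simp add: indicator_def)
  have "calc (indicator {0}) f \<in> op_ker T"
    using calc_domain[OF b, of f] by (simp add: z calc_zero op_ker_def)
  then have "(norm (calc (indicator {0}) f))\<^sup>2 = 0" using ker by simp
  then have "integral\<^sup>L (\<mu> f) (\<lambda>x. (cmod (indicator {0} x))\<^sup>2) = 0" using calc_norm[OF b] by simp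
  moreover have "(\<lambda>x::real. (cmod (indicator {0} x))\<^sup>2) = (indicator {0} :: real \<Rightarrow> real)" by (rule ext) (simp add: indicator_def)
  ultimately have "measure (\<mu> f) {0} = 0" by simp
  then have "emeasure (\<mu> f) {0} = 0" by (simp add: finite_measure.emeasure_eq_measure[OF finite_measure_mu])
  then show ?thesis by (intro AE_I[of _ _ "{0}"]) auto
qed

text \<open>The right-hand side depends on T alone and not on the measures; hence the same is true
  of all Cayley moments.\<close>

lemma calc_cayley: "calc cayley h = h - hscaleC (2 * \<i>) (resolvent_i T h)"
proof -
  have e: "cayley = (\<lambda>x. 1 - 2 * \<i> * (1 / (of_real x + \<i>)))" by (rule ext) (rule cayley_inv_i)
  show ?thesis
    unfolding e
    using calc_diff[OF bounded_borel_const bounded_borel_mult[OF bounded_borel_const bounded_borel_inv_i], of 1 "2 * \<i>"]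
      calc_scale[OF bounded_borel_inv_i, of "2 * \<i>"] by (simp add: calc_one calc_inv_i)
qed

lemma cayley_moments:
  "integral\<^sup>L (\<mu> f) (\<lambda>x. cayley x ^ j * cnj (cayley x) ^ k) = hinner ((calc cayley ^^ j) f) ((calc cayley ^^ k) f)"
proof -
  have p: "bounded_borel (\<lambda>x. cayley x ^ j)" for j by (intro bounded_borel_power bounded_borel_cayley)
  have pw: "calc (\<lambda>x. cayley x ^ j) = calc cayley ^^ j" for j
  proof (induction j)
    case 0 then show ?case by (simp add: calc_one id_def)
  next
    case (Suc j)
    then show ?case using calc_mult[OF bounded_borel_cayley p[of j]] by (simp add: comp_def)
  qed
  have cp: "bounded_borel (\<lambda>x. cnj (cayley x ^ k))" by (intro bounded_borel_cnj p)
  have "integral\<^sup>L (\<mu> f) (\<lambda>x. cayley x ^ j * cnj (cayley x) ^ k)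
     = integral\<^sup>L (\<mu> f) (\<lambda>x. cnj (cayley x ^ k) * cayley x ^ j)" by (simp add: mult.commute)
  also have "\<dots> = hinner (calc (\<lambda>x. cnj (cayley x ^ k) * cayley x ^ j) f) f"
    by (rule calc_quadratic[symmetric]) (intro bounded_borel_mult cp p)
  also have "\<dots> = hinner (calc (\<lambda>x. cnj (cayley x ^ k)) (calc (\<lambda>x. cayley x ^ j) f)) f"
    by (simp only: calc_mult[OF cp p])
  also have "\<dots> = hinner (calc (\<lambda>x. cayley x ^ j) f) (calc (\<lambda>x. cayley x ^ k) f)"
    using calc_adjoint[OF cp] by simp
  finally show ?thesis by (simp only: pw)
qed

end

text \<open>Both calculi give the same Cayley transform of T, hence the same moments, and the Cayley
  monomials generate. Consequently any two spectral measures of T integrate bounded Borel functions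
  equally.\<close>

lemma sa_calculus_integral_unique:
  assumes "sa_calculus \<mu> \<G> T" "sa_calculus \<nu> \<H> T" "bounded_borel F"
  shows "integral\<^sup>L (\<mu> f) F = integral\<^sup>L (\<nu> f) F"
proof -
  interpret m: sa_calculus \<mu> \<G> T by fact
  interpret n: sa_calculus \<nu> \<H> T by fact
  have c: "m.calc cayley = n.calc cayley" by (rule ext) (simp add: m.calc_cayley n.calc_cayley)
  show ?thesis
  proof (rule generates_borelD[OF generates_borel_cayley _ _ assms(3)])
    show "bounded_closed (\<lambda>F. integral\<^sup>L (\<mu> f) F = integral\<^sup>L (\<nu> f) F)"
    proof (rule bounded_closedI)
      show "integral\<^sup>L (\<mu> f) (\<lambda>x. F x + G x) = integral\<^sup>L (\<nu> f) (\<lambda>x. F x + G x)"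
        if "bounded_borel F" "bounded_borel G" "integral\<^sup>L (\<mu> f) F = integral\<^sup>L (\<nu> f) F"
          "integral\<^sup>L (\<mu> f) G = integral\<^sup>L (\<nu> f) G" for F G
        using that by (simp add: m.integrable_bounded_borel n.integrable_bounded_borel)
      show "integral\<^sup>L (\<mu> f) F = integral\<^sup>L (\<nu> f) F"
        if *: "\<And>n. bounded_borel (Fs n)" "bounded_borel F" and e: "\<And>n. integral\<^sup>L (\<mu> f) (Fs n) = integral\<^sup>L (\<nu> f) (Fs n)"
          and K: "\<And>n x. cmod (Fs n x) \<le> K" and l: "\<And>x. (\<lambda>n. Fs n x) \<longlonglongrightarrow> F x" for Fs F K
        using m.integral_limit_AE[OF * K AE_I2[OF l], of f] n.integral_limit_AE[OF * K AE_I2[OF l], of f]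
          LIMSEQ_unique by (simp add: e)
    qed simp_all
    show "integral\<^sup>L (\<mu> f) G = integral\<^sup>L (\<nu> f) G"
      if G: "G \<in> range (\<lambda>(j::nat, k::nat). (\<lambda>x. cayley x ^ j * cnj (cayley x) ^ k))" for G
    proof -
      obtain p :: "nat \<times> nat" where "G = (case p of (j, k) \<Rightarrow> \<lambda>x. cayley x ^ j * cnj (cayley x) ^ k)"
        using G by (rule rangeE)
      moreover obtain j k where "p = (j, k)" by (rule prod.exhaust)
      ultimately have "G = (\<lambda>x. cayley x ^ j * cnj (cayley x) ^ k)" by simp
      then show ?thesis using m.cayley_moments[of f j k] n.cayley_moments[of f j k] c by simp
    qed
  qed
qed

section \<open>Projection-valued measures and the spectral theorem\<close>

definition borel_indicators :: "(real \<Rightarrow> complex) set" where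
  "borel_indicators = {indicator S | S. S \<in> sets borel}"

lemma orth_proj_inner: "orth_proj P \<Longrightarrow> hinner (P x) x = complex_of_real ((norm (P x))\<^sup>2)"
proof -
  assume P: "orth_proj P"
  then have "hinner (P (P x)) x = hinner (P x) (P x)" unfolding orth_proj_def by blast
  then show ?thesis using P by (simp add: orth_proj_def hinner_self)
qed

lemma orth_proj_norm_le: "orth_proj P \<Longrightarrow> norm (P x) \<le> norm x"
proof -
  assume P: "orth_proj P"
  have "(norm (P x))\<^sup>2 = cmod (hinner (P x) x)" using orth_proj_inner[OF P, of x] by (simp add: norm_power)
  also have "\<dots> \<le> norm (P x) * norm x" by (rule hinner_cauchy_schwarz)
  finally show ?thesis by (cases "P x = 0") (simp_all add: power2_eq_square)
qed

context
  fixes E :: "real set \<Rightarrow> 'a::chilbert \<Rightarrow> 'a"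
  assumes E: "pvm E"
begin

lemma pvm_orth_proj: "S \<in> sets borel \<Longrightarrow> orth_proj (E S)"
  using E by (simp add: pvm_def)

lemma pvm_bounded_op: "S \<in> sets borel \<Longrightarrow> bounded_op (E S)"
  using pvm_orth_proj by (simp add: orth_proj_def)

lemma pvm_sums: "range S \<subseteq> sets borel \<Longrightarrow> disjoint_family S \<Longrightarrow> (\<lambda>n. E (S n) f) sums E (\<Union>n. S n) f"
  using E by (simp add: pvm_def)

text \<open>The empty set is a disjoint union of copies of itself, and a constant series converges
  only if its term is zero.\<close>

lemma pvm_empty: "E {} f = 0"
proof -
  have "(\<lambda>n::nat. E {} f) sums E {} f"
    using pvm_sums[of "\<lambda>_. {}" f] by (simp add: disjoint_family_on_def)
  then have "summable (\<lambda>n::nat. E {} f)" by (rule sums_summable)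
  then have "(\<lambda>n::nat. E {} f) \<longlonglongrightarrow> 0" by (rule summable_LIMSEQ_zero)
  then show ?thesis using LIMSEQ_const_iff by blast
qed

lemma pvm_union:
  assumes "A \<in> sets borel" "B \<in> sets borel" "A \<inter> B = {}" shows "E (A \<union> B) f = E A f + E B f"
proof -
  have "(\<lambda>n. E (binaryset A B n) f) sums E (\<Union>n. binaryset A B n) f"
    using assms by (intro pvm_sums) (auto simp: binaryset_def disjoint_family_on_def)
  then have "(\<lambda>n. E (binaryset A B n) f) sums E (A \<union> B) f" by (simp only: UN_binaryset_eq)
  moreover have "(\<lambda>n. E (binaryset A B n) f) sums (\<Sum>n<2. E (binaryset A B n) f)"
    by (rule sums_finite) (auto simp: binaryset_def pvm_empty)
  ultimately have "E (A \<union> B) f = (\<Sum>n<2. E (binaryset A B n) f)" by (rule sums_unique2)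
  also have "\<dots> = E A f + E B f" by (simp add: numeral_2_eq_2 binaryset_def)
  finally show ?thesis .
qed

text \<open>For x in the range of \<open>E B\<close>, additivity gives |E (A \<union> B) x|^2 = |E A
  x|^2 + |x|^2, while a projection does not increase norms.\<close>

lemma pvm_orthogonal:
  assumes "A \<in> sets borel" "B \<in> sets borel" "A \<inter> B = {}" shows "E A (E B f) = 0"
proof -
  define x where "x = E B f"
  have x: "E B x = x" using pvm_orth_proj[OF assms(2)] by (simp add: x_def orth_proj_def)
  have "hinner (E (A \<union> B) x) x = of_real ((norm (E A x))\<^sup>2) + of_real ((norm x)\<^sup>2)"
    using orth_proj_inner[OF pvm_orth_proj[OF assms(1)], of x]
    by (simp add: pvm_union[OF assms] hinner_linear x hinner_self)
  moreover have "hinner (E (A \<union> B) x) x = of_real ((norm (E (A \<union> B) x))\<^sup>2)"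
    using assms by (intro orth_proj_inner pvm_orth_proj) auto
  ultimately have "complex_of_real ((norm (E (A \<union> B) x))\<^sup>2) = of_real ((norm (E A x))\<^sup>2 + (norm x)\<^sup>2)" by simp
  then have "(norm (E (A \<union> B) x))\<^sup>2 = (norm (E A x))\<^sup>2 + (norm x)\<^sup>2" unfolding of_real_eq_iff .
  moreover have "(norm (E (A \<union> B) x))\<^sup>2 \<le> (norm x)\<^sup>2"
    using assms by (intro power_mono orth_proj_norm_le pvm_orth_proj) auto
  ultimately have "(norm (E A x))\<^sup>2 \<le> 0" by simp
  then show ?thesis by (simp add: x_def)
qed

lemma pvm_inter:
  assumes "A \<in> sets borel" "B \<in> sets borel" shows "E A (E B f) = E (A \<inter> B) f"
proof -
  have s: "A \<inter> B \<in> sets borel" "A - B \<in> sets borel" "B - A \<in> sets borel" using assms by auto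
  have "A = (A \<inter> B) \<union> (A - B)" "B = (A \<inter> B) \<union> (B - A)" by auto
  then have a: "E A g = E (A \<inter> B) g + E (A - B) g" and b: "E B g = E (A \<inter> B) g + E (B - A) g" for g
    using pvm_union[of "A \<inter> B" "A - B" g] pvm_union[of "A \<inter> B" "B - A" g] s by (auto simp: Int_Diff)
  have "E A (E B f) = E A (E (A \<inter> B) f) + E A (E (B - A) f)"
    by (simp add: b bounded_op_add[OF pvm_bounded_op[OF assms(1)]])
  also have "E A (E (B - A) f) = 0" using assms by (intro pvm_orthogonal) auto
  also have "E A (E (A \<inter> B) f) = E (A \<inter> B) (E (A \<inter> B) f) + E (A - B) (E (A \<inter> B) f)" by (rule a)
  also have "E (A - B) (E (A \<inter> B) f) = 0" using assms by (intro pvm_orthogonal) auto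
  also have "E (A \<inter> B) (E (A \<inter> B) f) = E (A \<inter> B) f" using pvm_orth_proj[OF s(1)] by (simp add: orth_proj_def)
  finally show ?thesis by simp
qed

lemma sets_spec_meas: "sets (spec_meas E f) = sets borel"
  unfolding spec_meas_def using sets.sigma_sets_eq[of "borel :: real measure"] by (simp add: sets_measure_of)

lemma emeasure_spec_meas:
  assumes "S \<in> sets borel" shows "emeasure (spec_meas E f) S = ennreal ((norm (E S f))\<^sup>2)"
proof -
  have e: "Re (hinner (E A f) f) = (norm (E A f))\<^sup>2" if "A \<in> sets borel" for A
    using orth_proj_inner[OF pvm_orth_proj[OF that], of f] by simp
  have "emeasure (spec_meas E f) S = ennreal (Re (hinner (E S f) f))"
    unfolding spec_meas_def
  proof (rule emeasure_measure_of_sigma)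
    show "sigma_algebra UNIV (sets (borel :: real measure))"
      using sets.sigma_algebra_axioms[of "borel :: real measure"] by simp
    show "positive (sets borel) (\<lambda>S. ennreal (Re (hinner (E S f) f)))"
      by (simp add: positive_def pvm_empty)
    show "countably_additive (sets borel) (\<lambda>S. ennreal (Re (hinner (E S f) f)))"
      unfolding countably_additive_def
    proof (intro allI impI)
      fix A :: "nat \<Rightarrow> real set" assume A: "range A \<subseteq> sets borel" "disjoint_family A"
      have "bounded_linear (\<lambda>x. Re (hinner x f))"
        by (rule bounded_linear_compose[OF bounded_linear_Re bounded_bilinear.bounded_linear_left[OF bounded_bilinear_hinner]])
      from bounded_linear.sums[OF this pvm_sums[OF A]]
      have "(\<lambda>n. Re (hinner (E (A n) f) f)) sums Re (hinner (E (\<Union>n. A n) f) f)" .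
      moreover have "0 \<le> Re (hinner (E (A n) f) f)" for n using A(1) e[of "A n"] by auto
      ultimately show "(\<Sum>n. ennreal (Re (hinner (E (A n) f) f))) = ennreal (Re (hinner (E (\<Union>n. A n) f) f))"
        by (intro suminf_ennreal_eq)
    qed
  qed (rule assms)
  then show ?thesis by (simp add: e assms)
qed

lemma represents_pvm:
  assumes S: "S \<in> sets borel" shows "represents (spec_meas E) (indicator S) (E S)"
  unfolding represents_def
proof (intro conjI allI pvm_bounded_op[OF S])
  fix f
  have "(\<lambda>x. complex_of_real (indicator S x)) = indicator S" by (rule ext) (simp add: indicator_def)
  moreover have "integral\<^sup>L (spec_meas E f) (\<lambda>x. complex_of_real (indicator S x)) = of_real (measure (spec_meas E f) S)"
    using S sets_eq_imp_space_eq[OF sets_spec_meas[of f]] by (subst integral_complex_of_real) simp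
  moreover have "measure (spec_meas E f) S = (norm (E S f))\<^sup>2"
    by (simp add: measure_def emeasure_spec_meas[OF S])
  ultimately show "hinner (E S f) f = integral\<^sup>L (spec_meas E f) (indicator S)"
    using orth_proj_inner[OF pvm_orth_proj[OF S], of f] by simp
qed

lemma borel_calculus_pvm: "borel_calculus (spec_meas E) borel_indicators"
proof
  show "sets (spec_meas E f) = sets borel" for f by (rule sets_spec_meas)
  have "E UNIV = id" using E by (simp add: pvm_def)
  then show "emeasure (spec_meas E f) UNIV = ennreal ((norm f)\<^sup>2)" for f
    by (simp add: emeasure_spec_meas)
  show "generates_borel borel_indicators" unfolding borel_indicators_def by (rule generates_borel_indicators)
  show "\<exists>T. represents (spec_meas E) G T" if "G \<in> borel_indicators" for G
    using that represents_pvm unfolding borel_indicators_def by blast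
  show "represents (spec_meas E) (\<lambda>x. G x * H x) (\<lambda>f. S (T f))"
    if GH: "G \<in> borel_indicators" "H \<in> borel_indicators" and r: "represents (spec_meas E) G S" "represents (spec_meas E) H T"
    for G H S T
  proof -
    obtain A B where AB: "A \<in> sets borel" "G = indicator A" "B \<in> sets borel" "H = indicator B"
      using GH unfolding borel_indicators_def by blast
    have u: "S' = T'" if "represents (spec_meas E) F S'" "represents (spec_meas E) F T'" for F S' T'
      using that by (intro bounded_op_eq_quadratic) (simp_all add: represents_def)
    have "S = E A" using u[OF r(1)] represents_pvm[OF AB(1)] AB(2) by blast
    moreover have "T = E B" using u[OF r(2)] represents_pvm[OF AB(3)] AB(4) by blast
    moreover have "(\<lambda>x. G x * H x) = indicator (A \<inter> B)" unfolding AB by (rule ext) (simp add: indicator_def)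
    moreover have "A \<inter> B \<in> sets borel" using AB by auto
    ultimately show ?thesis using represents_pvm[of "A \<inter> B"] by (simp add: pvm_inter[OF AB(1,3)])
  qed
qed

end

lemma sesquilinear_eq_quadratic:
  assumes "sesquilinear s" "sesquilinear s'" "\<And>f. s f f = s' f f" shows "s f g = s' f g"
proof -
  have "4 * s f g = 4 * s' f g" unfolding polarization[OF assms(1)] polarization[OF assms(2)] assms(3) ..
  then show ?thesis by simp
qed

text \<open>\<open>spectral_measure_of\<close> fixes only the domain and the quadratic form of T.
  Let R and Q be the calculus at 1 / (x + i) and x / (x + i). The domain is the range of R, so the
  form can be polarized in the parameter g; density of the domain then gives T R g = Q g, and since
  Q + i R is the identity, R is the inverse of T + i.\<close>

lemma spectral_measure_sa_calculus:
  assumes T: "selfadjoint T" and E: "spectral_measure_of T E"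
  shows "sa_calculus (spec_meas E) borel_indicators T"
proof -
  have "pvm E" using E by (simp add: spectral_measure_of_def)
  then interpret borel_calculus "spec_meas E" borel_indicators by (rule borel_calculus_pvm)
  let ?R = "calc (\<lambda>x. 1 / (of_real x + \<i>))" and ?Q = "calc (\<lambda>x. of_real x / (of_real x + \<i>))"
  have dom: "opdom T = {f. integrable (spec_meas E f) (\<lambda>x. x\<^sup>2)}" using E by (simp add: spectral_measure_of_def)
  have form: "hinner (opapp T f) f = complex_of_real (integral\<^sup>L (spec_meas E f) (\<lambda>x. x))" if "f \<in> opdom T" for f
    using E that by (simp add: spectral_measure_of_def)
  have bR: "bounded_op ?R" "bounded_op ?Q"
    by (simp_all add: calc_bounded_op bounded_borel_inv_i bounded_borel_mult_x_inv_i)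
  have R: "?R g \<in> opdom T" for g unfolding dom using integrable_square_calc_inv_i by blast
  have Rsurj: "\<exists>g. f = ?R g" if "f \<in> opdom T" for f
    using integrable_square_imp_range that unfolding dom by blast
  have "hinner (opapp T (?R g)) (?R g') = hinner (?Q g) (?R g')" for g g'
  proof (rule sesquilinear_eq_quadratic[where s = "\<lambda>g g'. hinner (opapp T (?R g)) (?R g')"
        and s' = "\<lambda>g g'. hinner (?Q g) (?R g')"])
    show "sesquilinear (\<lambda>g g'. hinner (opapp T (?R g)) (?R g'))"
      unfolding sesquilinear_def
      using selfadjoint_add[OF T R R] selfadjoint_scale[OF T R]
      by (simp add: bounded_op_add[OF bR(1)] bounded_op_scale[OF bR(1)] hinner_linear)
    show "sesquilinear (\<lambda>g g'. hinner (?Q g) (?R g'))"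
      unfolding sesquilinear_def
      by (simp add: bounded_op_add[OF bR(1)] bounded_op_scale[OF bR(1)] bounded_op_add[OF bR(2)]
          bounded_op_scale[OF bR(2)] hinner_linear)
    show "hinner (opapp T (?R g)) (?R g) = hinner (?Q g) (?R g)" for g
      using form[OF R] integral_x_calc_inv_i by simp
  qed
  then have TR: "opapp T (?R g) = ?Q g" for g
    using Rsurj by (intro hinner_dense_eqI[OF selfadjoint_dense[OF T]]) blast
  have e: "(\<lambda>x. of_real x / (of_real x + \<i>) + \<i> * (1 / (of_real x + \<i>))) = (\<lambda>_. 1)"
    by (rule ext) (simp flip: add_divide_distrib)
  have "?Q g + hscaleC \<i> (?R g) = g" for g
    using fun_cong[OF calc_add[OF bounded_borel_mult_x_inv_i bounded_borel_mult[OF bounded_borel_const[of \<i>] bounded_borel_inv_i]], of g]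
      calc_scale[OF bounded_borel_inv_i, of \<i>] unfolding e by (simp add: calc_one)
  then have "resolvent_i T g = ?R g" for g using R TR by (intro resolvent_i_eqI[OF T]) simp_all
  then show ?thesis using T by unfold_locales (auto intro!: ext)
qed

lemma funpow_commute:
  assumes "\<And>x. U (V x) = V (U x)"
  shows "(U ^^ j) ((V ^^ k) x) = (V ^^ k) ((U ^^ j) x)"
proof -
  have 1: "U ((V ^^ k) x) = (V ^^ k) (U x)" for x by (induction k) (simp_all add: assms)
  show ?thesis by (induction j) (simp_all add: 1)
qed

theorem spectral_theorem:
  assumes T: "selfadjoint (T :: ('a::chilbert) op)" shows "\<exists>E. spectral_measure_of T E"
proof -
  define R where "R = resolvent_i T"
  note r = resolvent_i[OF T, folded R_def]
  have bR: "bounded_op R" unfolding R_def by (rule bounded_op_resolvent_i[OF T])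
  \<comment> \<open>The Cayley transform, T - i times the inverse of T + i, written through the
    resolvent.\<close>
  define U where "U h = h - hscaleC (2 * \<i>) (R h)" for h
  have bU: "bounded_op U"
    using bounded_op_plus[OF bounded_op_id bounded_op_scaled[OF bR, of "- (2 * \<i>)"]]
    by (simp add: U_def[abs_def] hscaleC_minus_left)
  have ii: "hscaleC (2 * \<i>) x = hscaleC \<i> x + hscaleC \<i> x" for x :: 'a
    by (simp flip: hscaleC_add_left)
  have UT: "U h = opapp T (R h) + hscaleC (- \<i>) (R h)" for h
  proof -
    have "U h = (opapp T (R h) + hscaleC \<i> (R h)) - hscaleC (2 * \<i>) (R h)" by (simp add: U_def r(2))
    then show ?thesis by (simp add: ii hscaleC_minus_left)
  qed
  have iso: "hinner (U x) (U y) = hinner x y" for x y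
  proof -
    have "hinner (U x) (U y) = hinner (opapp T (R x)) (opapp T (R y)) + hinner (R x) (R y)"
      unfolding UT by (rule selfadjoint_shift_inner[OF T r(1) r(1)]) simp_all
    also have "\<dots> = hinner (opapp T (R x) + hscaleC \<i> (R x)) (opapp T (R y) + hscaleC \<i> (R y))"
      by (rule selfadjoint_shift_inner[OF T r(1) r(1), symmetric]) simp_all
    finally show ?thesis by (simp add: r(2))
  qed
  have surj: "\<exists>h. U h = y" for y
  proof -
    obtain f where f: "f \<in> opdom T" "opapp T f + hscaleC (- \<i>) f = y"
      using selfadjoint_shift_surj[OF T, of "- \<i>" y] by auto
    then have "R (opapp T f + hscaleC \<i> f) = f" unfolding R_def by (intro resolvent_i_eqI[OF T]) simp_all
    then show ?thesis using f UT by metis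
  qed
  \<comment> \<open>The inverse of the unitary \<open>U\<close> is also its adjoint and will
    represent the conjugate Cayley function.\<close>
  define V where "V y = (SOME h. U h = y)" for y
  have UV: "U (V y) = y" for y unfolding V_def using surj[of y] by (rule someI_ex)
  have Uinj: "x = y" if "U x = U y" for x y
  proof -
    have "hinner (U (x - y)) (U (x - y)) = 0" using that by (simp add: bounded_op_diff[OF bU])
    then show ?thesis by (simp only: iso hinner_eq_0_iff right_minus_eq)
  qed
  have VU: "V (U x) = x" for x using UV Uinj by blast
  have adjV: "hinner (V x) y = hinner x (U y)" for x y using iso[of "V x" y] by (simp add: UV)
  have bV: "bounded_op V"
    unfolding bounded_op_def
  proof (intro conjI allI exI[of _ 1])
    show "V (x + y) = V x + V y" for x y by (rule Uinj) (simp add: UV bounded_op_add[OF bU])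
    show "V (hscaleC c x) = hscaleC c (V x)" for c x by (rule Uinj) (simp add: UV bounded_op_scale[OF bU])
    show "norm (V x) \<le> 1 * norm x" for x
    proof -
      have "(norm (V x))\<^sup>2 = (norm x)\<^sup>2" using iso[of "V x" "V x"] by (simp add: UV hinner_norm_sq)
      then show ?thesis by (simp add: power2_eq_iff_nonneg)
    qed
  qed
  \<comment> \<open>Since h - U h = 2 i R h, the range in question is the dense domain of T; this is
    the input for the ergodic theorem.\<close>
  have "range (\<lambda>h. h - U h) = opdom T"
  proof
    show "range (\<lambda>h. h - U h) \<subseteq> opdom T"
      using selfadjoint_scale[OF T r(1)] by (auto simp: U_def)
    show "opdom T \<subseteq> range (\<lambda>h. h - U h)"
    proof
      fix f assume f: "f \<in> opdom T"
      define h where "h = hscaleC (1 / (2 * \<i>)) (opapp T f + hscaleC \<i> f)"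
      have "R h = hscaleC (1 / (2 * \<i>)) f"
      proof -
        have "R (opapp T f + hscaleC \<i> f) = f" unfolding R_def using resolvent_i_eqI[OF T f] by simp
        then show ?thesis by (simp only: h_def bounded_op_scale[OF bR])
      qed
      then have "f = h - U h" by (simp add: U_def hscaleC_hscaleC hscaleC_one)
      then show "f \<in> range (\<lambda>h. h - U h)" by blast
    qed
  qed
  then have dense: "closure (range (\<lambda>h. h - U h)) = UNIV" using selfadjoint_dense[OF T] by simp
  obtain \<mu> where \<mu>: "\<And>f. sets (\<mu> f) = sets borel" "\<And>f. emeasure (\<mu> f) UNIV = ennreal ((norm f)\<^sup>2)"
    "\<And>f j k. integral\<^sup>L (\<mu> f) (\<lambda>x. cayley x ^ j * cnj (cayley x) ^ k) = hinner ((U ^^ j) f) ((U ^^ k) f)"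
    using cayley_moment_measure[OF bU iso dense] by metis
  define \<G> where "\<G> = range (\<lambda>(j::nat, k::nat). (\<lambda>x. cayley x ^ j * cnj (cayley x) ^ k))"
  define W where "W j k f = (V ^^ k) ((U ^^ j) f)" for j k f
  have rep: "represents \<mu> (\<lambda>x. cayley x ^ j * cnj (cayley x) ^ k) (W j k)" for j k
  proof -
    have "hinner ((V ^^ k) x) y = hinner x ((U ^^ k) y)" for x y
      by (induction k arbitrary: y) (simp_all add: adjV funpow_swap1[of U])
    then show ?thesis
      using bounded_op_comp[OF bounded_op_funpow[OF bV] bounded_op_funpow[OF bU], of k j]
      by (simp add: represents_def W_def[abs_def] \<mu>(3))
  qed
  have elem: "\<exists>j k. G = (\<lambda>x. cayley x ^ j * cnj (cayley x) ^ k)" if G: "G \<in> \<G>" for G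
  proof -
    obtain p :: "nat \<times> nat" where "G = (case p of (j, k) \<Rightarrow> \<lambda>x. cayley x ^ j * cnj (cayley x) ^ k)"
      using G unfolding \<G>_def by (rule rangeE)
    moreover obtain j k where "p = (j, k)" by (rule prod.exhaust)
    ultimately show ?thesis by auto
  qed
  interpret c: borel_calculus \<mu> \<G>
  proof
    show "generates_borel \<G>" unfolding \<G>_def by (rule generates_borel_cayley)
    show "\<exists>T. represents \<mu> G T" if "G \<in> \<G>" for G using elem[OF that] rep by blast
    show "represents \<mu> (\<lambda>x. G x * H x) (\<lambda>f. S (S' f))"
      if GH: "G \<in> \<G>" "H \<in> \<G>" and rr: "represents \<mu> G S" "represents \<mu> H S'" for G H S S'
    proof -
      obtain j k where G: "G = (\<lambda>x. cayley x ^ j * cnj (cayley x) ^ k)" using elem[OF GH(1)] by blast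
      obtain j' k' where H: "H = (\<lambda>x. cayley x ^ j' * cnj (cayley x) ^ k')" using elem[OF GH(2)] by blast
      have u: "S1 = S2" if "represents \<mu> F S1" "represents \<mu> F S2" for F S1 S2
        using that by (intro bounded_op_eq_quadratic) (simp_all add: represents_def)
      have S: "S = W j k" using u[OF rr(1)] rep unfolding G by blast
      have S': "S' = W j' k'" using u[OF rr(2)] rep unfolding H by blast
      have "(\<lambda>f. S (S' f)) = W (j + j') (k + k')"
      proof
        fix f
        have "(U ^^ j) ((V ^^ k') x) = (V ^^ k') ((U ^^ j) x)" for x
          by (rule funpow_commute) (simp add: UV VU)
        then show "S (S' f) = W (j + j') (k + k') f" by (simp add: S S' W_def funpow_add)
      qed
      moreover have "(\<lambda>x. G x * H x) = (\<lambda>x. cayley x ^ (j + j') * cnj (cayley x) ^ (k + k'))"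
        unfolding G H by (rule ext) (simp add: power_add)
      ultimately show ?thesis using rep by simp
    qed
  qed (rule \<mu>)+
  have "represents \<mu> cayley U"
    using rep[of 1 0] by (simp add: W_def[abs_def])
  then have cU: "c.calc cayley = U" by (rule c.calc_eqI)
  have e: "(\<lambda>x. 1 / (of_real x + \<i>)) = (\<lambda>x. (1 / (2 * \<i>)) * (1 - cayley x))"
    by (rule ext) (simp add: cayley_inv_i)
  \<comment> \<open>The resolvent is an affine function of the Cayley transform, which attaches the
    constructed calculus to T.\<close>
  have "c.calc (\<lambda>x. (1 / (2 * \<i>)) * (1 - cayley x)) = R"
  proof
    fix h
    have "c.calc (\<lambda>x. (1 / (2 * \<i>)) * (1 - cayley x)) h = hscaleC (1 / (2 * \<i>)) (c.calc (\<lambda>x. 1 - cayley x) h)"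
      by (simp only: c.calc_scale[OF bounded_borel_diff[OF bounded_borel_const bounded_borel_cayley]])
    also have "c.calc (\<lambda>x. 1 - cayley x) h = h - U h"
      by (simp only: c.calc_diff[OF bounded_borel_const bounded_borel_cayley] c.calc_one cU)
    also have "hscaleC (1 / (2 * \<i>)) (h - U h) = R h" by (simp add: U_def hscaleC_hscaleC hscaleC_one)
    finally show "c.calc (\<lambda>x. (1 / (2 * \<i>)) * (1 - cayley x)) h = R h" .
  qed
  then interpret c: sa_calculus \<mu> \<G> T
    using T by unfold_locales (simp_all add: e R_def)
  define E where "E S = c.calc (indicator S)" for S
  have bi: "bounded_borel (indicator S :: real \<Rightarrow> complex)" if "S \<in> sets borel" for S
    using that by (rule bounded_borel_indicator)
  have cn: "(\<lambda>x. cnj (indicator S x)) = (indicator S :: real \<Rightarrow> complex)"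
    "(\<lambda>x. indicator S x * indicator S x) = (indicator S :: real \<Rightarrow> complex)" for S :: "real set"
    by (rule ext, simp add: indicator_def)+
  have nE: "hinner (E S f) f = of_real (measure (\<mu> f) S)" if "S \<in> sets borel" for S f
  proof -
    have "(\<lambda>x. complex_of_real (indicator S x)) = indicator S" by (rule ext) (simp add: indicator_def)
    moreover have "integral\<^sup>L (\<mu> f) (\<lambda>x. complex_of_real (indicator S x)) = of_real (measure (\<mu> f) S)"
      using that by (subst integral_complex_of_real) simp
    ultimately show ?thesis unfolding E_def by (simp add: c.calc_quadratic[OF bi[OF that]])
  qed
  have "pvm E"
    unfolding pvm_def
  proof (intro conjI ballI allI impI)
    fix S :: "real set" assume S: "S \<in> sets borel"
    show "orth_proj (E S)"
      unfolding orth_proj_def E_def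
      using c.calc_bounded_op[OF bi[OF S]] fun_cong[OF c.calc_mult[OF bi[OF S] bi[OF S]]] c.calc_adjoint[OF bi[OF S]]
      by (simp add: cn)
  next
    have "(indicator UNIV :: real \<Rightarrow> complex) = (\<lambda>_. 1)" by (rule ext) simp
    then show "E UNIV = id" by (simp add: E_def c.calc_one id_def)
  next
    fix S :: "nat \<Rightarrow> real set" and f
    assume S: "range S \<subseteq> sets borel" "disjoint_family S"
    have m: "S i \<in> sets borel" for i using S by auto
    have "(\<Sum>i<n. E (S i) f) = c.calc (indicator (\<Union>i<n. S i)) f" for n
    proof (induction n)
      case 0
      have "(indicator {} :: real \<Rightarrow> complex) = (\<lambda>_. 0)" by (rule ext) simp
      then show ?case by (simp add: c.calc_zero)
    next
      case (Suc n)
      have "S i \<inter> S n = {}" if "i < n" for i using S(2) that by (simp add: disjoint_family_on_def)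
      then have d: "(\<Union>i<n. S i) \<inter> S n = {}" by blast
      have eq: "indicator (\<Union>i<Suc n. S i) = (\<lambda>x. indicator (\<Union>i<n. S i) x + indicator (S n) x :: complex)"
        by (rule ext) (use d in \<open>auto simp: indicator_def less_Suc_eq\<close>)
      have "(\<Union>i<n. S i) \<in> sets borel" using m by auto
      then show ?case unfolding eq
        by (simp only: c.calc_add[OF bi bi[OF m]] sum.lessThan_Suc Suc[unfolded E_def] E_def)
    qed
    moreover have "(\<lambda>n. c.calc (indicator (\<Union>i<n. S i)) f) \<longlonglongrightarrow> c.calc (indicator (\<Union>i. S i)) f"
    proof (rule c.calc_strong_limit[where K = 1])
      show "bounded_borel (indicator (\<Union>i<n. S i))" for n using m by (intro bi) auto
      show "bounded_borel (indicator (\<Union>i. S i))" using m by (intro bi) auto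
      show "cmod (indicator (\<Union>i<n. S i) x) \<le> 1" for n x by (simp add: indicator_def)
      show "AE x in \<mu> f. (\<lambda>n. indicator (\<Union>i<n. S i) x) \<longlonglongrightarrow> (indicator (\<Union>i. S i) x :: complex)"
      proof (rule AE_I2)
        fix x
        show "(\<lambda>n. indicator (\<Union>i<n. S i) x) \<longlonglongrightarrow> (indicator (\<Union>i. S i) x :: complex)"
        proof (cases "x \<in> (\<Union>i. S i)")
          case True
          then obtain i where i: "x \<in> S i" by blast
          have "\<forall>\<^sub>F n in sequentially. (indicator (\<Union>i<n. S i) x :: complex) = indicator (\<Union>i. S i) x"
            by (rule eventually_sequentiallyI[of "Suc i"]) (use i in \<open>force simp: indicator_def\<close>)
          then show ?thesis by (rule tendsto_eventually)
        qed (simp add: indicator_def)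
      qed
    qed
    ultimately show "(\<lambda>n. E (S n) f) sums E (\<Union>n. S n) f" by (simp add: sums_def E_def)
  qed
  then have em: "emeasure (spec_meas E f) S = emeasure (\<mu> f) S" if S: "S \<in> sets borel" for f S
  proof -
    have "complex_of_real ((norm (E S f))\<^sup>2) = of_real (measure (\<mu> f) S)"
      using nE[OF S] orth_proj_inner[OF pvm_orth_proj[OF \<open>pvm E\<close> S]] by metis
    then have "(norm (E S f))\<^sup>2 = measure (\<mu> f) S" unfolding of_real_eq_iff .
    then show ?thesis
      by (simp add: emeasure_spec_meas[OF \<open>pvm E\<close> S] finite_measure.emeasure_eq_measure[OF c.finite_measure_mu])
  qed
  \<comment> \<open>The measures of E are the given ones, so the statements about domain and form
    carry over to E.\<close>
  have "spec_meas E f = \<mu> f" for f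
    by (rule measure_eqI) (simp_all add: sets_spec_meas[OF \<open>pvm E\<close>] em)
  then have "spectral_measure_of T E"
    using \<open>pvm E\<close> c.domain_iff c.form_integral by (auto simp: spectral_measure_of_def)
  then show ?thesis by blast
qed

corollary sa_calculus_exists:
  "selfadjoint T \<Longrightarrow> \<exists>E. sa_calculus (spec_meas E) borel_indicators T \<and> spectral_measure_of T E"
  using spectral_theorem spectral_measure_sa_calculus by blast

lemma (in sa_calculus) abs_pow_it_calc:
  assumes b: "bounded_borel (\<lambda>x. cis (t * ln \<bar>x\<bar>))"
  shows "abs_pow_it T t = calc (\<lambda>x. cis (t * ln \<bar>x\<bar>))"
  unfolding abs_pow_it_def
proof (rule the_equality)
  have i: "integral\<^sup>L (spec_meas E f) (\<lambda>x. cis (t * ln \<bar>x\<bar>)) = hinner (calc (\<lambda>x. cis (t * ln \<bar>x\<bar>)) f) f"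
    if "spectral_measure_of T E" for E f
    using sa_calculus_integral_unique[OF spectral_measure_sa_calculus[OF sa that] sa_calculus_axioms b, of f]
      calc_quadratic[OF b, of f] by simp
  obtain E where "spectral_measure_of T E" using spectral_theorem[OF sa] by blast
  then show "bounded_op (calc (\<lambda>x. cis (t * ln \<bar>x\<bar>))) \<and> (\<exists>E. spectral_measure_of T E \<and>
      (\<forall>f. hinner (calc (\<lambda>x. cis (t * ln \<bar>x\<bar>)) f) f = integral\<^sup>L (spec_meas E f) (\<lambda>x. cis (t * ln \<bar>x\<bar>))))"
    using i calc_bounded_op[OF b] by metis
  fix V assume V: "bounded_op V \<and> (\<exists>E. spectral_measure_of T E \<and>
      (\<forall>f. hinner (V f) f = integral\<^sup>L (spec_meas E f) (\<lambda>x. cis (t * ln \<bar>x\<bar>))))"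
  then obtain E where "spectral_measure_of T E"
    "\<forall>f. hinner (V f) f = integral\<^sup>L (spec_meas E f) (\<lambda>x. cis (t * ln \<bar>x\<bar>))" by blast
  then show "V = calc (\<lambda>x. cis (t * ln \<bar>x\<bar>))"
    using V i by (intro bounded_op_eq_quadratic calc_bounded_op[OF b]) auto
qed

section \<open>The polar decomposition\<close>

text \<open>The Newton-Schulz iteration for the sign function, with fixed points -1, 0 and 1. Every
  iterate is an odd polynomial. It will be evaluated at 2 x / (1 + x^2), which lies in [-1, 1] and
  has the sign of x.\<close>

fun newton :: "nat \<Rightarrow> real \<Rightarrow> real" where
  "newton 0 y = y"
| "newton (Suc n) y = newton n y * (3 - (newton n y)\<^sup>2) / 2"

lemma newton_minus: "newton n (- y) = - newton n y"
  by (induction n) simp_all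

lemma newton_bounds:
  assumes "0 \<le> y" "y \<le> 1" shows "y \<le> newton n y \<and> newton n y \<le> 1"
proof (induction n)
  case 0 then show ?case using assms by simp
next
  case (Suc n)
  define a where "a = newton n y"
  have a: "0 \<le> a" "y \<le> a" "a \<le> 1" using Suc assms by (auto simp: a_def)
  have a2: "a\<^sup>2 \<le> 1" using a by (simp add: power_le_one)
  have "a * 2 \<le> a * (3 - a\<^sup>2)" using a a2 by (intro mult_left_mono) auto
  moreover have "a * (3 - a\<^sup>2) \<le> 2"
  proof -
    have "2 - a * (3 - a\<^sup>2) = (1 - a)\<^sup>2 * (2 + a)" by (simp add: power2_eq_square algebra_simps)
    moreover have "0 \<le> (1 - a)\<^sup>2 * (2 + a)" using a by simp
    ultimately show ?thesis by linarith
  qed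
  ultimately show ?case using a by (simp add: a_def[symmetric])
qed

lemma newton_abs_le: assumes "\<bar>y\<bar> \<le> 1" shows "\<bar>newton n y\<bar> \<le> 1"
proof (cases "0 \<le> y")
  case True then show ?thesis using newton_bounds[of y n] assms by simp
next
  case False then show ?thesis using newton_bounds[of "- y" n] assms by (simp add: newton_minus)
qed

lemma newton_limit_pos:
  assumes "0 < y" "y \<le> 1" shows "(\<lambda>n. newton n y) \<longlonglongrightarrow> 1"
proof -
  have rate: "1 - newton n y \<le> (1 - y / 2) ^ n" for n
  proof (induction n)
    case 0 then show ?case using assms by simp
  next
    case (Suc n)
    define a where "a = newton n y"
    have a: "y \<le> a" "a \<le> 1" using newton_bounds[of y n] assms by (auto simp: a_def)
    \<comment> \<open>The error polynomial 1 - a (3 - a^2) / 2 has a double root at a = 1. One root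
      is kept as the previous error; the remaining factor is at most 1 - y / 2 because a \<ge>
      y.\<close>
    have "1 - newton (Suc n) y = (1 - a) * (1 - (a + a\<^sup>2) / 2)"
      by (simp add: a_def[symmetric] power2_eq_square field_simps)
    also have "\<dots> \<le> (1 - a) * (1 - y / 2)"
    proof (rule mult_left_mono)
      have "y \<le> a + a\<^sup>2" by (rule add_increasing2[OF zero_le_power2 a(1)])
      then show "1 - (a + a\<^sup>2) / 2 \<le> 1 - y / 2" by simp
    qed (use a in simp)
    also have "\<dots> \<le> (1 - y / 2) ^ n * (1 - y / 2)"
      using Suc assms by (intro mult_right_mono) (auto simp: a_def)
    finally show ?case by (simp add: mult.commute)
  qed
  have lim: "(\<lambda>n. (1 - y / 2) ^ n) \<longlonglongrightarrow> 0" using assms by (intro LIMSEQ_realpow_zero) auto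
  have "0 \<le> 1 - newton n y" for n using newton_bounds[of y n] assms by simp
  then have "(\<lambda>n. 1 - newton n y) \<longlonglongrightarrow> 0"
    by (intro tendsto_sandwich[OF always_eventually always_eventually tendsto_const lim] allI rate)
  then have "(\<lambda>n. 1 - (1 - newton n y)) \<longlonglongrightarrow> 1 - 0" by (intro tendsto_intros)
  then show ?thesis by simp
qed

lemma newton_limit:
  assumes "\<bar>y\<bar> \<le> 1" shows "(\<lambda>n. newton n y) \<longlonglongrightarrow> sgn y"
proof -
  consider "y = 0" | "0 < y" | "y < 0" by linarith
  then show ?thesis
  proof cases
    case 1
    have "newton n 0 = 0" for n by (induction n) simp_all
    then show ?thesis using 1 by simp
  next
    case 2 then show ?thesis using newton_limit_pos[of y] assms by simp
  next
    case 3
    then have "(\<lambda>n. - newton n (- y)) \<longlonglongrightarrow> - 1" using newton_limit_pos[of "- y"] assms by (intro tendsto_minus) auto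
    then show ?thesis using 3 by (simp add: newton_minus)
  qed
qed

lemma abs_le_one_plus_square: "\<bar>2 * x / (1 + x\<^sup>2)\<bar> \<le> (1::real)"
proof -
  have p: "0 < 1 + x\<^sup>2" by (simp add: add_pos_nonneg)
  have "0 \<le> (1 - \<bar>x\<bar>)\<^sup>2" by simp
  then have "2 * \<bar>x\<bar> \<le> 1 + x\<^sup>2" by (simp add: power2_eq_square algebra_simps)
  then show ?thesis using p by (simp add: abs_mult pos_divide_le_eq)
qed

lemma bounded_borel_sgn: "bounded_borel (\<lambda>x. complex_of_real (sgn x))"
  by (rule bounded_borelI[of _ 1]) (simp_all add: sgn_if)

lemma bounded_borel_of_real:
  "f \<in> borel_measurable borel \<Longrightarrow> (\<And>x. \<bar>f x\<bar> \<le> K) \<Longrightarrow> bounded_borel (\<lambda>x. complex_of_real (f x))"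
  by (rule bounded_borelI[of _ K]) simp_all

lemma bounded_borel_inv_square: "bounded_borel (\<lambda>x. complex_of_real (1 / (1 + x\<^sup>2)))"
  by (rule bounded_borel_of_real[of _ 1]) (simp_all add: divide_le_eq add_pos_nonneg)

lemma bounded_borel_x_inv_square: "bounded_borel (\<lambda>x. complex_of_real (x / (1 + x\<^sup>2)))"
proof (rule bounded_borel_of_real[of _ 1])
  show "\<bar>x / (1 + x\<^sup>2)\<bar> \<le> 1" for x :: real using abs_le_one_plus_square[of x] by (simp add: abs_mult)
qed simp

lemma bounded_borel_newton: "bounded_borel (\<lambda>x. complex_of_real (newton n (2 * x / (1 + x\<^sup>2))))"
proof (rule bounded_borel_of_real[of _ 1])
  have "newton n \<in> borel_measurable borel" by (induction n) simp_all
  then show "(\<lambda>x. newton n (2 * x / (1 + x\<^sup>2))) \<in> borel_measurable borel"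
    by (rule measurable_compose[rotated]) simp
qed (rule newton_abs_le[OF abs_le_one_plus_square])

section \<open>The sign function of a self-adjoint operator\<close>

context sa_calculus
begin

text \<open>Writing f as the resolvent applied to h makes f and T f bounded functions of T at h, so
  everything commutes. The last form is the integral of |x| / (x^2 + 1) against \<mu> h.\<close>

lemma calc_sgn_commute:
  assumes f: "f \<in> opdom T"
  shows "calc (\<lambda>x. complex_of_real (sgn x)) f \<in> opdom T"
    "opapp T (calc (\<lambda>x. complex_of_real (sgn x)) f) = calc (\<lambda>x. complex_of_real (sgn x)) (opapp T f)"
    "0 \<le> Re (hinner (calc (\<lambda>x. complex_of_real (sgn x)) (opapp T f)) f)"
proof -
  let ?s = "\<lambda>x. complex_of_real (sgn x)"
  define h where "h = opapp T f + hscaleC \<i> f"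
  have fh: "f = calc (\<lambda>x. 1 / (of_real x + \<i>)) h"
    using resolvent_i_eqI[OF sa f] calc_inv_i by (simp add: h_def)
  have Tf: "opapp T f = calc (\<lambda>x. of_real x / (of_real x + \<i>)) h"
    using calc_domain[OF bounded_borel_inv_i, of h] bounded_borel_mult_x_inv_i fh by simp
  have b1: "bounded_borel (\<lambda>x. ?s x * (1 / (of_real x + \<i>)))"
    by (rule bounded_borel_mult[OF bounded_borel_sgn bounded_borel_inv_i])
  have b2: "bounded_borel (\<lambda>x. ?s x * (of_real x / (of_real x + \<i>)))"
    by (rule bounded_borel_mult[OF bounded_borel_sgn bounded_borel_mult_x_inv_i])
  have e: "(\<lambda>x. of_real x * (?s x * (1 / (of_real x + \<i>)))) = (\<lambda>x. ?s x * (of_real x / (of_real x + \<i>)))"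
    by (rule ext) simp
  have sf: "calc ?s f = calc (\<lambda>x. ?s x * (1 / (of_real x + \<i>))) h"
    unfolding fh by (simp only: calc_mult[OF bounded_borel_sgn bounded_borel_inv_i])
  have sTf: "calc ?s (opapp T f) = calc (\<lambda>x. ?s x * (of_real x / (of_real x + \<i>))) h"
    unfolding Tf by (simp only: calc_mult[OF bounded_borel_sgn bounded_borel_mult_x_inv_i])
  have d: "calc (\<lambda>x. ?s x * (1 / (of_real x + \<i>))) h \<in> opdom T
     \<and> opapp T (calc (\<lambda>x. ?s x * (1 / (of_real x + \<i>))) h) = calc (\<lambda>x. ?s x * (of_real x / (of_real x + \<i>))) h"
    using calc_domain[OF b1, of h] b2 unfolding e by blast
  then show "calc ?s f \<in> opdom T" "opapp T (calc ?s f) = calc ?s (opapp T f)" by (simp_all add: sf sTf)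
  have c: "bounded_borel (\<lambda>x. cnj (1 / (of_real x + \<i>)))" by (rule bounded_borel_cnj[OF bounded_borel_inv_i])
  have eq: "cnj (1 / (of_real x + \<i>)) * (?s x * (of_real x / (of_real x + \<i>))) = of_real ((1 / (x\<^sup>2 + 1)) * \<bar>x\<bar>)" for x
  proof -
    have "cnj (1 / (of_real x + \<i>)) * (1 / (of_real x + \<i>)) = of_real (1 / (x\<^sup>2 + 1))"
      unfolding cmod_inv_i_sq[symmetric] complex_norm_square by (simp add: mult.commute)
    moreover have "?s x * of_real x = of_real \<bar>x\<bar>" by (simp add: sgn_if)
    moreover have "u * (a * (b / v)) = (u * (1 / v)) * (a * b)" for u v a b :: complex by simp
    ultimately show ?thesis by (simp only: of_real_mult)
  qed
  have "hinner (calc ?s (opapp T f)) f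
     = hinner (calc (\<lambda>x. cnj (1 / (of_real x + \<i>))) (calc (\<lambda>x. ?s x * (of_real x / (of_real x + \<i>))) h)) h"
    unfolding sTf using calc_adjoint[OF c] fh by simp
  also have "\<dots> = hinner (calc (\<lambda>x. cnj (1 / (of_real x + \<i>)) * (?s x * (of_real x / (of_real x + \<i>)))) h) h"
    by (simp only: calc_mult[OF c b2])
  also have "\<dots> = integral\<^sup>L (\<mu> h) (\<lambda>x. cnj (1 / (of_real x + \<i>)) * (?s x * (of_real x / (of_real x + \<i>))))"
    by (rule calc_quadratic[OF bounded_borel_mult[OF c b2]])
  also have "\<dots> = complex_of_real (integral\<^sup>L (\<mu> h) (\<lambda>x. (1 / (x\<^sup>2 + 1)) * \<bar>x\<bar>))"
    unfolding eq by (rule integral_complex_of_real)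
  finally have "Re (hinner (calc ?s (opapp T f)) f) = integral\<^sup>L (\<mu> h) (\<lambda>x. (1 / (x\<^sup>2 + 1)) * \<bar>x\<bar>)" by simp
  moreover have "0 \<le> integral\<^sup>L (\<mu> h) (\<lambda>x. (1 / (x\<^sup>2 + 1)) * \<bar>x\<bar>)"
    by (rule Bochner_Integration.integral_nonneg) simp
  ultimately show "0 \<le> Re (hinner (calc ?s (opapp T f)) f)" by simp
qed

lemma calc_sgn_involution:
  assumes ker: "op_ker T = {0}"
  shows "calc (\<lambda>x. complex_of_real (sgn x)) (calc (\<lambda>x. complex_of_real (sgn x)) f) = f"
proof -
  let ?s = "\<lambda>x. complex_of_real (sgn x)"
  have "AE x in \<mu> f. ?s x * ?s x = 1"
    using AE_nonzero[OF ker, of f] by eventually_elim (simp add: sgn_if)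
  then have "calc (\<lambda>x. ?s x * ?s x) f = calc (\<lambda>_. 1) f"
    by (intro calc_cong_AE bounded_borel_mult bounded_borel_sgn bounded_borel_const)
  then show ?thesis by (simp only: calc_mult[OF bounded_borel_sgn bounded_borel_sgn] calc_one)
qed

lemma calc_sgn_symmetric:
  "hinner (calc (\<lambda>x. complex_of_real (sgn x)) f) g = hinner f (calc (\<lambda>x. complex_of_real (sgn x)) g)"
  using calc_adjoint[OF bounded_borel_sgn, of f g] by simp

text \<open>With trivial kernel the sign of T is a self-adjoint involution, and its product with T,
  on the domain of T, is the absolute value. Self-adjointness of the product reduces to that of T
  because the involution maps the domain onto itself.\<close>

lemma polar_exists:
  assumes ker: "op_ker T = {0}"
  defines "U \<equiv> calc (\<lambda>x. complex_of_real (sgn x))"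
  shows "unitary_op U" "\<exists>P. positive_sa P \<and> op_eq T (op_comp (op_of U) P)"
proof -
  have UU: "U (U f) = f" for f unfolding U_def by (rule calc_sgn_involution[OF ker])
  have sym: "hinner (U f) g = hinner f (U g)" for f g unfolding U_def by (rule calc_sgn_symmetric)
  have bU: "bounded_op U" unfolding U_def by (rule calc_bounded_op[OF bounded_borel_sgn])
  have com: "U f \<in> opdom T" "opapp T (U f) = U (opapp T f)" "0 \<le> Re (hinner (U (opapp T f)) f)"
    if "f \<in> opdom T" for f using calc_sgn_commute[OF that] unfolding U_def by blast+
  show "unitary_op U" unfolding unitary_op_def using bU UU sym by (metis surjI)
  define P where "P = (opdom T, \<lambda>f. U (opapp T f))"
  have P: "opdom P = opdom T" "opapp P = (\<lambda>f. U (opapp T f))" by (simp_all add: P_def opdom_def opapp_def)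
  have symP: "hinner (U (opapp T f)) g = hinner f (U (opapp T g))" if "f \<in> opdom T" "g \<in> opdom T" for f g
    using selfadjoint_symmetric[OF sa that(1) com(1)[OF that(2)]] by (simp add: sym com(2)[OF that(2)])
  have "selfadjoint P"
    unfolding selfadjoint_def
  proof (intro conjI allI ballI)
    show "linear_op P"
      unfolding linear_op_def P
      using selfadjoint_zero[OF sa] selfadjoint_add[OF sa] selfadjoint_scale[OF sa]
      by (simp add: bounded_op_add[OF bU] bounded_op_scale[OF bU])
    show "closure (opdom P) = UNIV" unfolding P by (rule selfadjoint_dense[OF sa])
    show "hinner (opapp P f) g = hinner f (opapp P g)" if "f \<in> opdom P" "g \<in> opdom P" for f g
      using symP that unfolding P by blast
    show "g \<in> opdom P \<longleftrightarrow> (\<exists>h. \<forall>f\<in>opdom P. hinner (opapp P f) g = hinner f h)" for g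
    proof
      assume "g \<in> opdom P" then show "\<exists>h. \<forall>f\<in>opdom P. hinner (opapp P f) g = hinner f h"
        using symP unfolding P by blast
    next
      assume "\<exists>h. \<forall>f\<in>opdom P. hinner (opapp P f) g = hinner f h"
      then obtain h where h: "\<And>f. f \<in> opdom T \<Longrightarrow> hinner (U (opapp T f)) g = hinner f h" unfolding P by blast
      have "hinner (opapp T f) (U g) = hinner f h" if "f \<in> opdom T" for f
        using h[OF that] by (simp add: sym)
      from selfadjoint_adjoint_domain[OF sa this] have "U g \<in> opdom T" by blast
      from com(1)[OF this] show "g \<in> opdom P" by (simp add: UU P)
    qed
  qed
  then have "positive_sa P" unfolding positive_sa_def using com(3) by (simp add: P)
  moreover have "op_eq T (op_comp (op_of U) P)"
    by (auto simp: op_eq_def op_le_def op_comp_def op_of_def P_def opdom_def opapp_def UU)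
  ultimately show "\<exists>P. positive_sa P \<and> op_eq T (op_comp (op_of U) P)" by blast
qed

lemma calc_inv_square:
  "calc (\<lambda>x. complex_of_real (1 / (1 + x\<^sup>2))) h \<in> opdom T"
  "opapp T (calc (\<lambda>x. complex_of_real (1 / (1 + x\<^sup>2))) h) = calc (\<lambda>x. complex_of_real (x / (1 + x\<^sup>2))) h"
  "opapp T (calc (\<lambda>x. complex_of_real (1 / (1 + x\<^sup>2))) h) \<in> opdom T"
  "opapp T (opapp T (calc (\<lambda>x. complex_of_real (1 / (1 + x\<^sup>2))) h)) + calc (\<lambda>x. complex_of_real (1 / (1 + x\<^sup>2))) h = h"
proof -
  let ?k = "\<lambda>x. complex_of_real (1 / (1 + x\<^sup>2))" and ?l = "\<lambda>x. complex_of_real (x / (1 + x\<^sup>2))"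
  have e1: "(\<lambda>x. of_real x * ?k x) = ?l" by (rule ext) simp
  have e2: "(\<lambda>x. of_real x * ?l x) = (\<lambda>x. 1 - ?k x)"
  proof
    fix x :: real
    have "0 < 1 + x\<^sup>2" by (simp add: add_pos_nonneg)
    then have "x * (x / (1 + x\<^sup>2)) = 1 - 1 / (1 + x\<^sup>2)" by (simp add: field_simps power2_eq_square)
    then show "of_real x * ?l x = 1 - ?k x" by (metis of_real_1 of_real_diff of_real_mult)
  qed
  have b2: "bounded_borel (\<lambda>x. 1 - ?k x)" by (intro bounded_borel_diff bounded_borel_const bounded_borel_inv_square)
  show 1: "calc ?k h \<in> opdom T" "opapp T (calc ?k h) = calc ?l h"
    using calc_domain[OF bounded_borel_inv_square, of h] bounded_borel_x_inv_square unfolding e1 by blast+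
  have 2: "calc ?l h \<in> opdom T" "opapp T (calc ?l h) = calc (\<lambda>x. 1 - ?k x) h"
    using calc_domain[OF bounded_borel_x_inv_square, of h] b2 unfolding e2 by blast+
  have "calc (\<lambda>x. 1 - ?k x) h = h - calc ?k h"
    by (simp only: calc_diff[OF bounded_borel_const bounded_borel_inv_square] calc_one)
  then show "opapp T (calc ?k h) \<in> opdom T" "opapp T (opapp T (calc ?k h)) + calc ?k h = h"
    using 1 2 by simp_all
qed

text \<open>If T (T d) = - d, then |T d|^2 = - |d|^2. The inverse of 1 + T^2 is thereby
  characterized by an equation, which can be checked through another operator with the same
  square.\<close>

lemma calc_inv_square_unique:
  assumes g: "g \<in> opdom T" "opapp T g \<in> opdom T" "opapp T (opapp T g) + g = h"
  shows "calc (\<lambda>x. complex_of_real (1 / (1 + x\<^sup>2))) h = g"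
proof -
  let ?g = "calc (\<lambda>x. complex_of_real (1 / (1 + x\<^sup>2))) h"
  define d where "d = ?g - g"
  have d1: "d \<in> opdom T" "opapp T d = opapp T ?g - opapp T g"
    unfolding d_def using selfadjoint_diff[OF sa calc_inv_square(1) g(1)] by blast+
  have d2: "opapp T d \<in> opdom T" "opapp T (opapp T d) = opapp T (opapp T ?g) - opapp T (opapp T g)"
    unfolding d1(2) using selfadjoint_diff[OF sa calc_inv_square(3) g(2)] by blast+
  have "opapp T (opapp T ?g) + ?g = opapp T (opapp T g) + g" using calc_inv_square(4) g(3) by simp
  then have "opapp T (opapp T d) = - d"
    unfolding d2(2) by (simp add: d_def algebra_simps)
  then have "hinner (opapp T d) (opapp T d) = - hinner d d"
    using selfadjoint_symmetric[OF sa d2(1) d1(1)] by (simp add: hinner_linear)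
  then have "(norm (opapp T d))\<^sup>2 = - (norm d)\<^sup>2" by (simp add: hinner_norm_sq)
  moreover have "0 \<le> (norm (opapp T d))\<^sup>2" by simp
  ultimately have "(norm d)\<^sup>2 \<le> 0" by linarith
  then show ?thesis by (simp add: d_def)
qed

text \<open>On the spectral part where x < 0 the form of T is minus the integral of |x| / (x^2 + 1),
  so positivity leaves no mass there; the trivial kernel removes 0.\<close>

lemma calc_sgn_positive:
  assumes pos: "\<And>f. f \<in> opdom T \<Longrightarrow> 0 \<le> Re (hinner (opapp T f) f)" and ker: "op_ker T = {0}"
  shows "calc (\<lambda>x. complex_of_real (sgn x)) f = f"
proof -
  have bi: "bounded_borel (indicator {..<0} :: real \<Rightarrow> complex)" by (rule bounded_borel_indicator) simp
  let ?F = "\<lambda>x. indicator {..<0} x * (1 / (complex_of_real x + \<i>))"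
  let ?G = "\<lambda>x. indicator {..<0} x * (complex_of_real x / (of_real x + \<i>))"
  have b: "bounded_borel ?F" "bounded_borel ?G"
    by (intro bounded_borel_mult bi bounded_borel_inv_i bounded_borel_mult_x_inv_i)+
  have e: "(\<lambda>x. of_real x * ?F x) = ?G" by (rule ext) simp
  have u: "calc ?F f \<in> opdom T" "opapp T (calc ?F f) = calc ?G f"
    using calc_domain[OF b(1), of f] b(2) unfolding e by blast+
  have c: "bounded_borel (\<lambda>x. cnj (?F x))" by (rule bounded_borel_cnj[OF b(1)])
  have eq: "cnj (?F x) * ?G x = of_real (- ((1 / (x\<^sup>2 + 1)) * (indicator {..<0} x * \<bar>x\<bar>)))" for x
  proof (cases "x < 0")
    case True
    have "cnj (1 / (of_real x + \<i>)) * (1 / (of_real x + \<i>)) = of_real (1 / (x\<^sup>2 + 1))"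
      unfolding cmod_inv_i_sq[symmetric] complex_norm_square by (simp add: mult.commute)
    moreover have "cnj (?F x) * ?G x = (cnj (1 / (of_real x + \<i>)) * (1 / (of_real x + \<i>))) * of_real x"
      using True by simp
    ultimately have "cnj (?F x) * ?G x = of_real ((1 / (x\<^sup>2 + 1)) * x)" by (simp only: of_real_mult)
    then show ?thesis using True by (simp add: indicator_def)
  qed (simp add: indicator_def)
  have "hinner (opapp T (calc ?F f)) (calc ?F f) = hinner (calc (\<lambda>x. cnj (?F x)) (calc ?G f)) f"
    unfolding u using calc_adjoint[OF c] by simp
  also have "\<dots> = hinner (calc (\<lambda>x. cnj (?F x) * ?G x) f) f" by (simp only: calc_mult[OF c b(2)])
  also have "\<dots> = integral\<^sup>L (\<mu> f) (\<lambda>x. cnj (?F x) * ?G x)" by (rule calc_quadratic[OF bounded_borel_mult[OF c b(2)]])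
  also have "\<dots> = complex_of_real (integral\<^sup>L (\<mu> f) (\<lambda>x. - ((1 / (x\<^sup>2 + 1)) * (indicator {..<0} x * \<bar>x\<bar>))))"
    unfolding eq by (rule integral_complex_of_real)
  finally have i0: "0 \<le> - integral\<^sup>L (\<mu> f) (\<lambda>x. (1 / (x\<^sup>2 + 1)) * (indicator {..<0} x * \<bar>x\<bar>))"
    using pos[OF u(1)] by simp
  have int: "integrable (\<mu> f) (\<lambda>x. (1 / (x\<^sup>2 + 1)) * (indicator {..<0} x * \<bar>x\<bar>))"
  proof -
    have "integrable (\<mu> f) (\<lambda>x. - (cnj (?F x) * ?G x))"
      using integrable_bounded_borel[OF bounded_borel_mult[OF c b(2)]] by simp
    then have "integrable (\<mu> f) (\<lambda>x. complex_of_real ((1 / (x\<^sup>2 + 1)) * (indicator {..<0} x * \<bar>x\<bar>)))"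
      unfolding eq by simp
    then show ?thesis using complex_of_real_integrable_eq by blast
  qed
  have nn: "AE x in \<mu> f. 0 \<le> (1 / (x\<^sup>2 + 1)) * (indicator {..<0} x * \<bar>x\<bar>)" by (rule AE_I2) simp
  have "integral\<^sup>L (\<mu> f) (\<lambda>x. (1 / (x\<^sup>2 + 1)) * (indicator {..<0} x * \<bar>x\<bar>)) = 0"
    using i0 integral_nonneg_AE[OF nn] by linarith
  then have "AE x in \<mu> f. (1 / (x\<^sup>2 + 1)) * (indicator {..<0} x * \<bar>x\<bar>) = 0"
    using integral_nonneg_eq_0_iff_AE[OF int nn] by blast
  then have "AE x in \<mu> f. complex_of_real (sgn x) = 1"
    using AE_nonzero[OF ker, of f]
  proof eventually_elim
    case (elim x)
    have "x\<^sup>2 + 1 \<noteq> 0" using zero_le_power2[of x] by linarith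
    then have "\<not> x < 0" using elim by (auto simp: indicator_def)
    then show ?case using elim by simp
  qed
  then have "calc (\<lambda>x. complex_of_real (sgn x)) f = calc (\<lambda>_. 1) f"
    by (intro calc_cong_AE bounded_borel_sgn bounded_borel_const)
  then show ?thesis by (simp add: calc_one)
qed

lemma calc_newton_limit:
  "(\<lambda>n. calc (\<lambda>x. complex_of_real (newton n (2 * x / (1 + x\<^sup>2)))) f) \<longlonglongrightarrow> calc (\<lambda>x. complex_of_real (sgn x)) f"
proof (rule calc_strong_limit[where K = 1])
  show "cmod (complex_of_real (newton n (2 * x / (1 + x\<^sup>2)))) \<le> 1" for n x
    using newton_abs_le[OF abs_le_one_plus_square[of x], of n] by simp
  show "AE x in \<mu> f. (\<lambda>n. complex_of_real (newton n (2 * x / (1 + x\<^sup>2)))) \<longlonglongrightarrow> complex_of_real (sgn x)"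
  proof (rule AE_I2)
    fix x :: real
    have "0 < 1 + x\<^sup>2" by (simp add: add_pos_nonneg)
    then have "sgn (2 * x / (1 + x\<^sup>2)) = sgn x" by (simp add: sgn_divide sgn_mult)
    then show "(\<lambda>n. complex_of_real (newton n (2 * x / (1 + x\<^sup>2)))) \<longlonglongrightarrow> complex_of_real (sgn x)"
      using newton_limit[OF abs_le_one_plus_square[of x]] by (intro tendsto_of_real) simp
  qed
qed (rule bounded_borel_newton bounded_borel_sgn)+

end

text \<open>
  If \<open>T = U P\<close>, then \<open>T\<^sup>2 = P\<^sup>2\<close> because \<open>T\<close> is its own adjoint. Hence the even functions generated by
  \<open>1 / (1 + x\<^sup>2)\<close> agree on \<open>T\<close> and \<open>P\<close>, whereas the odd ones differ by the factor \<open>U\<close>, and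
  the iteration approximating the sign function is odd.
\<close>

lemma polar_unique:
  assumes T: "sa_calculus \<mu> \<G> T" and ker: "op_ker T = {0}"
    and U: "unitary_op U" and P: "positive_sa P" and eq: "op_eq T (op_comp (op_of U) P)"
  shows "U = borel_calculus.calc \<mu> (\<lambda>x. complex_of_real (sgn x))"
proof -
  interpret t: sa_calculus \<mu> \<G> T by fact
  have saP: "selfadjoint P" and posP: "\<And>f. f \<in> opdom P \<Longrightarrow> 0 \<le> Re (hinner (opapp P f) f)"
    using P by (auto simp: positive_sa_def)
  obtain E where "sa_calculus (spec_meas E) borel_indicators P" using sa_calculus_exists[OF saP] by blast
  then interpret p: sa_calculus "spec_meas E" borel_indicators P .
  have bU: "bounded_op U" and iso: "\<And>x y. hinner (U x) (U y) = hinner x y" using U by (auto simp: unitary_op_def)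
  have dom: "opdom T = opdom P" and TP: "\<And>f. f \<in> opdom T \<Longrightarrow> opapp T f = U (opapp P f)"
    using eq by (auto simp: op_eq_def op_le_def op_comp_def op_of_def opdom_def opapp_def)
  have kerP: "op_ker P = {0}"
  proof -
    have "op_ker P \<subseteq> op_ker T"
      using TP bounded_op_zero[OF bU] unfolding op_ker_def dom by auto
    moreover have "0 \<in> op_ker P" using selfadjoint_zero[OF saP] by (simp add: op_ker_def)
    ultimately show ?thesis using ker by blast
  qed
  let ?k = "\<lambda>x. complex_of_real (1 / (1 + x\<^sup>2))" and ?l = "\<lambda>x. complex_of_real (x / (1 + x\<^sup>2))"
  have kk: "t.calc ?k h = p.calc ?k h" for h
  proof (rule t.calc_inv_square_unique)
    define g where "g = p.calc ?k h"
    have g: "g \<in> opdom P" "opapp P g \<in> opdom P" "opapp P (opapp P g) + g = h"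
      unfolding g_def by (rule p.calc_inv_square)+
    \<comment> \<open>U preserves inner products, so <T u, T g> = <P u, P g> = <u, P P g>;
      self-adjointness of T then puts T g into the domain with T T g = P P g.\<close>
    have "hinner (opapp T u) (opapp T g) = hinner u (opapp P (opapp P g))" if u: "u \<in> opdom T" for u
      using u g selfadjoint_symmetric[OF saP _ g(2), of u] unfolding dom by (simp add: TP dom iso)
    from selfadjoint_adjoint_domain[OF t.sa this]
    have "g \<in> opdom T" "opapp T g \<in> opdom T" "opapp T (opapp T g) + g = h" using g by (simp_all add: dom)
    then show "p.calc ?k h \<in> opdom T" "opapp T (p.calc ?k h) \<in> opdom T"
      "opapp T (opapp T (p.calc ?k h)) + p.calc ?k h = h"
      unfolding g_def .
  qed
  have ll: "t.calc ?l h = U (p.calc ?l h)" for h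
  proof -
    have "t.calc ?l h = opapp T (t.calc ?k h)" by (rule t.calc_inv_square(2)[symmetric])
    also have "\<dots> = U (opapp P (t.calc ?k h))" by (rule TP[OF t.calc_inv_square(1)])
    also have "\<dots> = U (p.calc ?l h)" by (simp only: kk p.calc_inv_square(2))
    finally show ?thesis .
  qed
  let ?F = "\<lambda>n x. complex_of_real (newton n (2 * x / (1 + x\<^sup>2)))"
  have b: "bounded_borel (?F n)" "bounded_borel (\<lambda>x. ?F n x * ?F n x)" for n
    by (intro bounded_borel_newton bounded_borel_mult)+
  \<comment> \<open>The induction couples the odd iterates, which differ by U, with their squares,
    which agree; the next iterate is the present one times a function of its square.\<close>
  have "(\<forall>h. t.calc (?F n) h = U (p.calc (?F n) h)) \<and>
     (\<forall>h. t.calc (\<lambda>x. ?F n x * ?F n x) h = p.calc (\<lambda>x. ?F n x * ?F n x) h)" for n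
  proof (induction n)
    case 0
    have e1: "?F 0 = (\<lambda>x. 2 * ?l x)" by (rule ext) simp
    \<comment> \<open>With k = 1 / (1 + x^2) one has x^2 k^2 = k - k^2, so the square of the
      starting point depends on k alone.\<close>
    have e2: "(\<lambda>x. ?F 0 x * ?F 0 x) = (\<lambda>x. 4 * (?k x - ?k x * ?k x))"
    proof
      fix x :: real
      have "0 < 1 + x\<^sup>2" by (simp add: add_pos_nonneg)
      then have "(2 * x / (1 + x\<^sup>2)) * (2 * x / (1 + x\<^sup>2)) = 4 * (1 / (1 + x\<^sup>2) - 1 / (1 + x\<^sup>2) * (1 / (1 + x\<^sup>2)))"
        by (simp add: divide_simps) (simp add: power2_eq_square algebra_simps)
      then have "complex_of_real ((2 * x / (1 + x\<^sup>2)) * (2 * x / (1 + x\<^sup>2)))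
        = complex_of_real (4 * (1 / (1 + x\<^sup>2) - 1 / (1 + x\<^sup>2) * (1 / (1 + x\<^sup>2))))" by (simp only:)
      then show "?F 0 x * ?F 0 x = 4 * (?k x - ?k x * ?k x)" by (simp only: newton.simps of_real_mult of_real_diff of_real_numeral)
    qed
    note bk = bounded_borel_inv_square bounded_borel_mult[OF bounded_borel_inv_square bounded_borel_inv_square]
    show ?case
      unfolding e1 e2
      by (simp only: t.calc_scale[OF bounded_borel_x_inv_square] p.calc_scale[OF bounded_borel_x_inv_square] ll
          t.calc_scale[OF bounded_borel_diff[OF bk]] p.calc_scale[OF bounded_borel_diff[OF bk]]
          t.calc_diff[OF bk] p.calc_diff[OF bk] t.calc_mult[OF bk(1) bk(1)] p.calc_mult[OF bk(1) bk(1)] kk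
          bounded_op_scale[OF bU]) simp
  next
    case (Suc n)
    let ?q = "\<lambda>x. ?F n x * ?F n x"
    define r where "r x = (1 / 2) * (3 - ?q x)" for x
    have br: "bounded_borel r"
      unfolding r_def[abs_def] by (intro bounded_borel_mult bounded_borel_const bounded_borel_diff b)
    have rr: "t.calc r h = p.calc r h" for h
      unfolding r_def[abs_def] using Suc
      by (simp only: t.calc_scale[OF bounded_borel_diff[OF bounded_borel_const b(2)]]
          p.calc_scale[OF bounded_borel_diff[OF bounded_borel_const b(2)]]
          t.calc_diff[OF bounded_borel_const b(2)] p.calc_diff[OF bounded_borel_const b(2)] t.calc_const p.calc_const)
    have e1: "?F (Suc n) = (\<lambda>x. ?F n x * r x)"
      by (rule ext) (simp add: r_def power2_eq_square)
    have e2: "(\<lambda>x. ?F (Suc n) x * ?F (Suc n) x) = (\<lambda>x. ?q x * (r x * r x))"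
      unfolding e1[THEN fun_cong] by (rule ext) (simp add: mult_ac)
    have "t.calc (\<lambda>x. ?F n x * r x) h = U (p.calc (\<lambda>x. ?F n x * r x) h)" for h
      using Suc by (simp only: t.calc_mult[OF b(1) br] p.calc_mult[OF b(1) br] rr)
    moreover have "t.calc (\<lambda>x. ?q x * (r x * r x)) h = p.calc (\<lambda>x. ?q x * (r x * r x)) h" for h
      using Suc by (simp only: t.calc_mult[OF b(2) bounded_borel_mult[OF br br]]
          p.calc_mult[OF b(2) bounded_borel_mult[OF br br]] t.calc_mult[OF br br] p.calc_mult[OF br br] rr)
    ultimately show ?case unfolding e2 e1 by blast
  qed
  then have F: "t.calc (?F n) f = U (p.calc (?F n) f)" for n f by blast
  have "U f = t.calc (\<lambda>x. complex_of_real (sgn x)) f" for f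
  proof -
    \<comment> \<open>P is positive with trivial kernel, so its sign function is the identity and
      this limit is U f.\<close>
    have "(\<lambda>n. U (p.calc (?F n) f)) \<longlonglongrightarrow> U (p.calc (\<lambda>x. complex_of_real (sgn x)) f)"
      by (rule bounded_op_tendsto[OF bU p.calc_newton_limit])
    then have "(\<lambda>n. t.calc (?F n) f) \<longlonglongrightarrow> U f"
      by (simp only: F p.calc_sgn_positive[OF posP kerP])
    then show ?thesis using LIMSEQ_unique t.calc_newton_limit by blast
  qed
  then show ?thesis by (intro ext)
qed

lemma (in sa_calculus) polar_U_eqI:
  assumes ker: "op_ker T = {0}" and U: "unitary_op U" "positive_sa P" "op_eq T (op_comp (op_of U) P)"
  shows "polar_U T = U"
  unfolding polar_U_def
proof (rule the_equality)
  show "unitary_op U \<and> (\<exists>P. positive_sa P \<and> op_eq T (op_comp (op_of U) P))"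
    by (intro conjI exI[of _ P] U)
  fix V assume "unitary_op V \<and> (\<exists>P. positive_sa P \<and> op_eq T (op_comp (op_of V) P))"
  then obtain Q where V: "unitary_op V" "positive_sa Q" "op_eq T (op_comp (op_of V) Q)" by (elim conjE exE)
  show "V = U"
    unfolding polar_unique[OF sa_calculus_axioms ker V] polar_unique[OF sa_calculus_axioms ker U] ..
qed

lemma (in sa_calculus) polar_U_calc:
  assumes ker: "op_ker T = {0}" shows "polar_U T = calc (\<lambda>x. complex_of_real (sgn x))"
proof -
  obtain P where "positive_sa P" "op_eq T (op_comp (op_of (calc (\<lambda>x. complex_of_real (sgn x)))) P)"
    using polar_exists(2)[OF ker] by (elim exE conjE)
  from polar_U_eqI[OF ker polar_exists(1)[OF ker] this] show ?thesis .
qed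

section \<open>Intertwining\<close>

definition (in borel_calculus) intertwines :: "'a op \<Rightarrow> (real \<Rightarrow> complex) \<Rightarrow> (real \<Rightarrow> complex) \<Rightarrow> bool" where
  "intertwines B F G \<longleftrightarrow> bounded_borel F \<and> bounded_borel G
     \<and> (\<forall>f\<in>opdom B. calc F f \<in> opdom B \<and> opapp B (calc F f) = calc G (opapp B f))"

context sa_calculus
begin

context
  fixes B :: "'a op"
  assumes B: "selfadjoint B"
begin

lemma intertwines_add:
  assumes "intertwines B F G" "intertwines B F' G'"
  shows "intertwines B (\<lambda>x. F x + F' x) (\<lambda>x. G x + G' x)"
  using assms selfadjoint_add[OF B] unfolding intertwines_def
  by (auto simp: bounded_borel_add calc_add)

lemma intertwines_scale:
  assumes "intertwines B F G" shows "intertwines B (\<lambda>x. c * F x) (\<lambda>x. c * G x)"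
  using assms selfadjoint_scale[OF B] unfolding intertwines_def
  by (auto simp: bounded_borel_mult calc_scale)

lemma intertwines_const: "intertwines B (\<lambda>_. c) (\<lambda>_. c)"
  using selfadjoint_scale[OF B] unfolding intertwines_def by (simp add: calc_const)

lemma intertwines_mult:
  assumes "intertwines B F G" "intertwines B F' G'"
  shows "intertwines B (\<lambda>x. F x * F' x) (\<lambda>x. G x * G' x)"
  using assms unfolding intertwines_def by (auto simp: bounded_borel_mult calc_mult)

lemma intertwines_power: "intertwines B F G \<Longrightarrow> intertwines B (\<lambda>x. F x ^ n) (\<lambda>x. G x ^ n)"
proof (induction n)
  case 0 then show ?case using intertwines_const[of 1] by simp
next
  case (Suc n) then show ?case using intertwines_mult[OF Suc.prems Suc.IH[OF Suc.prems]] by simp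
qed

lemma intertwines_sum:
  "finite I \<Longrightarrow> (\<And>i. i \<in> I \<Longrightarrow> intertwines B (F i) (G i)) \<Longrightarrow> intertwines B (\<lambda>x. \<Sum>i\<in>I. F i x) (\<lambda>x. \<Sum>i\<in>I. G i x)"
proof (induction I rule: finite_induct)
  case empty then show ?case using intertwines_const[of 0] by simp
next
  case (insert i I)
  have "intertwines B (\<lambda>x. F i x + (\<Sum>i\<in>I. F i x)) (\<lambda>x. G i x + (\<Sum>i\<in>I. G i x))"
    by (rule intertwines_add[OF insert.prems insert.IH]) (simp_all add: insert.prems)
  then show ?case using insert.hyps by simp
qed

lemma intertwines_limit:
  assumes ker: "op_ker T = {0}" and FG: "\<And>n. intertwines B (Fs n) (Gs n)"
    and b: "bounded_borel F" "bounded_borel G"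
    and K: "\<And>n x. cmod (Fs n x) \<le> K" "\<And>n x. cmod (Gs n x) \<le> K"
    and lim: "\<And>x. x \<noteq> 0 \<Longrightarrow> (\<lambda>n. Fs n x) \<longlonglongrightarrow> F x" "\<And>x. x \<noteq> 0 \<Longrightarrow> (\<lambda>n. Gs n x) \<longlonglongrightarrow> G x"
  shows "intertwines B F G"
  unfolding intertwines_def
proof (intro conjI b ballI)
  fix f assume f: "f \<in> opdom B"
  have ae: "AE x in \<mu> g. (\<lambda>n. Fs n x) \<longlonglongrightarrow> F x" "AE x in \<mu> g. (\<lambda>n. Gs n x) \<longlonglongrightarrow> G x" for g
    using AE_nonzero[OF ker, of g] by (eventually_elim, simp add: lim)+
  have bs: "\<And>n. bounded_borel (Fs n)" "\<And>n. bounded_borel (Gs n)" using FG by (auto simp: intertwines_def)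
  have d: "\<And>n. calc (Fs n) f \<in> opdom B" "\<And>n. opapp B (calc (Fs n) f) = calc (Gs n) (opapp B f)"
    using FG f by (auto simp: intertwines_def)
  have "(\<lambda>n. calc (Fs n) f) \<longlonglongrightarrow> calc F f"
    by (rule calc_strong_limit[OF bs(1) b(1) K(1) ae(1)])
  moreover have "(\<lambda>n. opapp B (calc (Fs n) f)) \<longlonglongrightarrow> calc G (opapp B f)"
    unfolding d(2) by (rule calc_strong_limit[OF bs(2) b(2) K(2) ae(2)])
  ultimately have "calc F f \<in> opdom B \<and> opapp B (calc F f) = calc G (opapp B f)"
    by (rule selfadjoint_closed[OF B d(1)])
  then show "calc F f \<in> opdom B" "opapp B (calc F f) = calc G (opapp B f)" by blast+
qed

text \<open>Powers and sums of a pair are pairs, so the partial sums intertwine. Absolute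
  convergence at a common bound K of both functions supplies the uniform bound for the passage to
  the limit.\<close>

lemma intertwines_series:
  assumes ker: "op_ker T = {0}" and FG: "intertwines B F G"
    and K: "\<And>x. cmod (F x) \<le> K" "\<And>x. cmod (G x) \<le> K" and c: "summable (\<lambda>k. cmod (c k) * K ^ k)"
    and \<phi>: "\<And>z. cmod z \<le> K \<Longrightarrow> (\<lambda>k. c k * z ^ k) sums \<phi> z"
  shows "intertwines B (\<lambda>x. \<phi> (F x)) (\<lambda>x. \<phi> (G x))"
proof -
  have K0: "0 \<le> K" using K(1)[of 0] norm_ge_zero order_trans by blast
  have s: "intertwines B (\<lambda>x. \<Sum>k<n. c k * F x ^ k) (\<lambda>x. \<Sum>k<n. c k * G x ^ k)" for n
    by (intro intertwines_sum intertwines_scale intertwines_power FG) simp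
  have bound: "cmod (\<Sum>k<n. c k * z ^ k) \<le> (\<Sum>k. cmod (c k) * K ^ k)" if "cmod z \<le> K" for n z
  proof -
    have "cmod (\<Sum>k<n. c k * z ^ k) \<le> (\<Sum>k<n. cmod (c k) * K ^ k)"
      using that by (intro sum_norm_le) (simp add: norm_mult norm_power mult_left_mono power_mono)
    also have "\<dots> \<le> (\<Sum>k. cmod (c k) * K ^ k)" using c K0 by (intro sum_le_suminf) auto
    finally show ?thesis .
  qed
  have lim: "(\<lambda>n. \<Sum>k<n. c k * z ^ k) \<longlonglongrightarrow> \<phi> z" if "cmod z \<le> K" for z
    using \<phi>[OF that] by (simp add: sums_def)
  have bb: "bounded_borel (\<lambda>x. \<Sum>k<n. c k * F x ^ k)" "bounded_borel (\<lambda>x. \<Sum>k<n. c k * G x ^ k)" for n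
    using s by (auto simp: intertwines_def)
  show ?thesis
    by (rule intertwines_limit[OF ker s bounded_borel_limit[OF bb(1) bound[OF K(1)] lim[OF K(1)]]
          bounded_borel_limit[OF bb(2) bound[OF K(2)] lim[OF K(2)]]
          bound[OF K(1)] bound[OF K(2)] lim[OF K(1)] lim[OF K(2)]])
qed

lemma intertwines_exp:
  assumes ker: "op_ker T = {0}" and FG: "intertwines B F G"
  shows "intertwines B (\<lambda>x. exp (F x)) (\<lambda>x. exp (G x))"
proof -
  obtain K L where "0 \<le> K" "\<And>x. cmod (F x) \<le> K" "\<And>x. cmod (G x) \<le> L"
    using FG bounded_borel_bound unfolding intertwines_def by metis
  then have K: "cmod (F x) \<le> max K L" "cmod (G x) \<le> max K L" for x
    by (auto intro: max.coboundedI1 max.coboundedI2)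
  show ?thesis
  proof (rule intertwines_series[OF ker FG K, where c = "\<lambda>k. 1 / fact k"])
    show "summable (\<lambda>k. cmod (1 / fact k) * max K L ^ k)"
    proof -
      have "cmod (1 / fact k) = inverse (fact k)" for k by (simp add: norm_divide inverse_eq_divide)
      then show ?thesis using summable_exp[of "max K L"] by simp
    qed
    show "(\<lambda>k. 1 / fact k * z ^ k) sums exp z" for z :: complex
      using exp_converges[of z] by (simp add: scaleR_conv_of_real divide_inverse)
  qed
qed

text \<open>The radius 1/2 keeps both arguments well inside the disc of convergence of the
  logarithmic series; the ratio of the poles is chosen later to meet it.\<close>

lemma intertwines_Ln:
  assumes ker: "op_ker T = {0}" and FG: "intertwines B F G"
    and K: "\<And>x. cmod (F x) \<le> 1 / 2" "\<And>x. cmod (G x) \<le> 1 / 2"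
  shows "intertwines B (\<lambda>x. Ln (1 + F x)) (\<lambda>x. Ln (1 + G x))"
proof (rule intertwines_series[OF ker FG K, where c = "\<lambda>k. - ((-1) ^ k) / of_nat k"])
  show "summable (\<lambda>k. cmod (- ((-1) ^ k) / of_nat k) * (1 / 2) ^ k)"
  proof (rule summable_comparison_test'[of "\<lambda>k. (1 / 2 :: real) ^ k" 0])
    fix k :: nat
    have "cmod (- ((-1) ^ k) / of_nat k) = 1 / real k" by (simp add: norm_divide norm_power)
    also have "\<dots> \<le> 1" by (cases k) simp_all
    finally show "norm (cmod (- ((-1) ^ k) / of_nat k) * (1 / 2) ^ k) \<le> (1 / 2) ^ k"
      by (simp add: mult_left_le_one_le)
  qed (simp add: summable_geometric)
  show "(\<lambda>k. - ((-1) ^ k) / of_nat k * z ^ k) sums Ln (1 + z)" if "cmod z \<le> 1 / 2" for z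
    using Ln_series'[of z] that by (simp add: power_minus[of z])
qed

end

end

section \<open>Complex powers as limits of rational functions with poles on a line\<close>

text \<open>
  For \<open>Re z > 0\<close> the sum below telescopes to \<open>Ln (z + i \<sigma> r ^ n) - Ln (z + i \<sigma> / r ^ n)\<close>;
  for \<open>Re z < 0\<close> it equals the sum for \<open>-z\<close> and \<open>-\<sigma>\<close>.
\<close>

definition log_sum :: "real \<Rightarrow> real \<Rightarrow> nat \<Rightarrow> complex \<Rightarrow> complex" where
  "log_sum r \<sigma> n z = (\<Sum>k<2 * n. Ln (1 + \<i> * of_real \<sigma> * of_real (r ^ Suc k / r ^ n - r ^ k / r ^ n)
     * (1 / (z + \<i> * of_real \<sigma> * of_real (r ^ k / r ^ n)))))"

lemma log_sum_minus: "log_sum r (- \<sigma>) n (- z) = log_sum r \<sigma> n z"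
proof -
  have "\<i> * of_real (- \<sigma>) * w * (1 / (- z + \<i> * of_real (- \<sigma>) * v)) = \<i> * of_real \<sigma> * w * (1 / (z + \<i> * of_real \<sigma> * v))"
    for w v :: complex
  proof -
    have "- z + \<i> * of_real (- \<sigma>) * v = - (z + \<i> * of_real \<sigma> * v)"
      "\<i> * of_real (- \<sigma>) * w = - (\<i> * of_real \<sigma> * w)" by simp_all
    moreover have "(- a) * (1 / (- d)) = a * (1 / d)" for a d :: complex by simp
    ultimately show ?thesis by (simp only:)
  qed
  then show ?thesis unfolding log_sum_def by (simp only:)
qed

lemma log_sum_telescope:
  assumes z: "0 < Re z" and r: "1 < r"
  shows "log_sum r \<sigma> n z = Ln (z + \<i> * of_real \<sigma> * of_real (r ^ n)) - Ln (z + \<i> * of_real \<sigma> * of_real (1 / r ^ n))"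
proof -
  define L where "L k = Ln (z + \<i> * of_real \<sigma> * of_real (r ^ k / r ^ n))" for k
  have "Ln (1 + \<i> * of_real \<sigma> * of_real (r ^ Suc k / r ^ n - r ^ k / r ^ n) * (1 / (z + \<i> * of_real \<sigma> * of_real (r ^ k / r ^ n))))
     = L (Suc k) - L k" for k
  proof -
    define u where "u = z + \<i> * of_real \<sigma> * of_real (r ^ Suc k / r ^ n)"
    define v where "v = z + \<i> * of_real \<sigma> * of_real (r ^ k / r ^ n)"
    have uv: "0 < Re u" "0 < Re v" using z by (simp_all add: u_def v_def)
    then have "v \<noteq> 0" by auto
    moreover have "\<i> * of_real \<sigma> * of_real (r ^ Suc k / r ^ n - r ^ k / r ^ n) = u - v"
      by (simp add: u_def v_def algebra_simps)
    ultimately have "1 + \<i> * of_real \<sigma> * of_real (r ^ Suc k / r ^ n - r ^ k / r ^ n) * (1 / v) = u / v"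
      by (simp add: field_simps)
    then show ?thesis using Ln_divide_right_half[OF uv] by (simp only: L_def u_def v_def)
  qed
  then have "log_sum r \<sigma> n z = (\<Sum>k<2 * n. L (Suc k) - L k)" unfolding log_sum_def by (simp only:)
  also have "\<dots> = L (2 * n) - L 0" by (rule sum_lessThan_telescope)
  also have "r ^ (2 * n) / r ^ n = r ^ n" using r by (simp add: mult_2 power_add)
  then have "L (2 * n) = Ln (z + \<i> * of_real \<sigma> * of_real (r ^ n))" by (simp only: L_def)
  finally show ?thesis by (simp add: L_def)
qed

lemma abs_Im_Ln_less: "0 < Re z \<Longrightarrow> \<bar>Im (Ln z)\<bar> < pi / 2"
  using Re_Ln_pos_lt[of z] by (cases "z = 0") auto

text \<open>In the right half-plane two arguments below pi/2 are subtracted, and reflection handles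
  the left one. At z = 0 every factor equals the real number r; this case is included because the
  bound has to hold at every real x, also at x = 0.\<close>

lemma log_sum_Im_bound:
  assumes r: "1 < r" and \<sigma>: "\<sigma> = 1 \<or> \<sigma> = -1" and z: "z = 0 \<or> Re z \<noteq> 0"
  shows "\<bar>Im (log_sum r \<sigma> n z)\<bar> \<le> pi"
proof -
  have pos: "\<bar>Im (log_sum r \<tau> n w)\<bar> \<le> pi" if "0 < Re w" for \<tau> w
    using that abs_Im_Ln_less[of "w + \<i> * of_real \<tau> * of_real (r ^ n)"]
      abs_Im_Ln_less[of "w + \<i> * of_real \<tau> * of_real (1 / r ^ n)"]
    by (simp add: log_sum_telescope[OF that r])
  consider "z = 0" | "0 < Re z" | "Re z < 0" using z by linarith
  then show ?thesis
  proof cases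
    case 1
    have "Im (Ln (1 + \<i> * of_real \<sigma> * of_real (r ^ Suc k / r ^ n - r ^ k / r ^ n)
       * (1 / (0 + \<i> * of_real \<sigma> * of_real (r ^ k / r ^ n))))) = 0" for k
    proof -
      have "1 + \<i> * of_real \<sigma> * of_real (r ^ Suc k / r ^ n - r ^ k / r ^ n)
         * (1 / (0 + \<i> * of_real \<sigma> * of_real (r ^ k / r ^ n))) = complex_of_real r"
        using r \<sigma> by (auto simp: field_simps)
      then show ?thesis using r by (simp only:) (rule Im_Ln_of_real, simp)
    qed
    then have "Im (log_sum r \<sigma> n 0) = 0" unfolding log_sum_def Im_sum by (simp only: sum.neutral_const)
    then show ?thesis using 1 by simp
  next
    case 2 then show ?thesis by (rule pos)
  next
    case 3
    then show ?thesis using pos[of "- z" "- \<sigma>"] by (simp add: log_sum_minus)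
  qed
qed

text \<open>The upper end of the telescoped sum behaves like ln (r^n) plus the logarithm of i
  \<sigma>, and the lower end tends to Ln z.\<close>

lemma log_sum_limit:
  assumes z: "0 < Re z" and r: "1 < r" and \<sigma>: "\<sigma> = 1 \<or> \<sigma> = -1"
  shows "(\<lambda>n. log_sum r \<sigma> n z - of_real (ln (r ^ n))) \<longlonglongrightarrow> \<i> * of_real (\<sigma> * pi / 2) - Ln z"
proof -
  have inv: "(\<lambda>n. 1 / r ^ n) \<longlonglongrightarrow> 0"
    using LIMSEQ_realpow_zero[of "1 / r"] r by (simp add: power_one_over)
  have 1: "Ln (z + \<i> * of_real \<sigma> * of_real (r ^ n)) - of_real (ln (r ^ n)) = Ln (z * of_real (1 / r ^ n) + \<i> * of_real \<sigma>)" for n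
  proof -
    have rn: "0 < r ^ n" using r by simp
    have nz: "z * of_real (1 / r ^ n) + \<i> * of_real \<sigma> \<noteq> 0"
    proof
      assume "z * of_real (1 / r ^ n) + \<i> * of_real \<sigma> = 0"
      then have "Re (z * of_real (1 / r ^ n) + \<i> * of_real \<sigma>) = 0" by simp
      then show False using z r by simp
    qed
    have "z + \<i> * of_real \<sigma> * of_real (r ^ n) = of_real (r ^ n) * (z * of_real (1 / r ^ n) + \<i> * of_real \<sigma>)"
      using rn r by (simp add: algebra_simps)
    then show ?thesis using Ln_times_of_real[OF rn nz] rn by (simp only: Ln_of_real) simp
  qed
  have si: "\<i> * of_real \<sigma> \<notin> \<real>\<^sub>\<le>\<^sub>0" using \<sigma> by (auto simp: complex_nonpos_Reals_iff)
  have "(\<lambda>n. z * of_real (1 / r ^ n) + \<i> * of_real \<sigma>) \<longlonglongrightarrow> z * of_real 0 + \<i> * of_real \<sigma>"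
    by (intro tendsto_intros inv)
  then have "(\<lambda>n. Ln (z * of_real (1 / r ^ n) + \<i> * of_real \<sigma>)) \<longlonglongrightarrow> Ln (\<i> * of_real \<sigma>)"
    using si by (intro tendsto_Ln) simp_all
  moreover have "Ln (\<i> * of_real \<sigma>) = \<i> * of_real (\<sigma> * pi / 2)" using \<sigma> by auto
  ultimately have 2: "(\<lambda>n. Ln (z * of_real (1 / r ^ n) + \<i> * of_real \<sigma>)) \<longlonglongrightarrow> \<i> * of_real (\<sigma> * pi / 2)" by simp
  have zn: "z \<notin> \<real>\<^sub>\<le>\<^sub>0" using z by (auto simp: complex_nonpos_Reals_iff)
  have "(\<lambda>n. z + \<i> * of_real \<sigma> * of_real (1 / r ^ n)) \<longlonglongrightarrow> z + \<i> * of_real \<sigma> * of_real 0"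
    by (intro tendsto_intros inv)
  then have 3: "(\<lambda>n. Ln (z + \<i> * of_real \<sigma> * of_real (1 / r ^ n))) \<longlonglongrightarrow> Ln z"
    using zn by (intro tendsto_Ln) simp_all
  have "log_sum r \<sigma> n z - of_real (ln (r ^ n))
     = Ln (z * of_real (1 / r ^ n) + \<i> * of_real \<sigma>) - Ln (z + \<i> * of_real \<sigma> * of_real (1 / r ^ n))" for n
    unfolding log_sum_telescope[OF z r] 1[symmetric] by simp
  then show ?thesis using tendsto_diff[OF 2 3] by (simp only:)
qed

text \<open>For real t, subtracting the divergent real number ln (r^n) changes the exponential only
  by a phase independent of z, so bounds come from the imaginary part of \<open>log_sum\<close>
  alone.\<close>

definition power_approx :: "real \<Rightarrow> real \<Rightarrow> real \<Rightarrow> nat \<Rightarrow> complex \<Rightarrow> complex" where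
  "power_approx r \<sigma> t n z = exp (- \<i> * of_real t * (log_sum r \<sigma> n z - of_real (ln (r ^ n))))"

text \<open>For x > 0 the point \<kappa> x is in the right half-plane; for x < 0 it is reflected
  there and \<sigma> changes sign, which the product of \<sigma> and sgn x records. The remaining
  factors form the power of \<kappa> |x| with exponent i t.\<close>

definition power_limit :: "complex \<Rightarrow> real \<Rightarrow> real \<Rightarrow> real \<Rightarrow> complex" where
  "power_limit \<kappa> \<sigma> t x = of_real (exp (t * \<sigma> * sgn x * pi / 2)) * exp (\<i> * of_real t * Ln \<kappa>) * cis (t * ln \<bar>x\<bar>)"

lemma power_approx_bound:
  assumes "1 < r" "\<sigma> = 1 \<or> \<sigma> = -1" "z = 0 \<or> Re z \<noteq> 0"
  shows "cmod (power_approx r \<sigma> t n z) \<le> exp (\<bar>t\<bar> * pi)"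
proof -
  have "t * Im (log_sum r \<sigma> n z) \<le> \<bar>t * Im (log_sum r \<sigma> n z)\<bar>" by (rule abs_ge_self)
  also have "\<dots> \<le> \<bar>t\<bar> * pi"
    unfolding abs_mult using log_sum_Im_bound[OF assms] by (intro mult_left_mono) auto
  finally show ?thesis by (simp add: power_approx_def)
qed

lemma power_approx_limit_pos:
  assumes z: "0 < Re z" and r: "1 < r" and \<sigma>: "\<sigma> = 1 \<or> \<sigma> = -1"
  shows "(\<lambda>n. power_approx r \<sigma> t n z) \<longlonglongrightarrow> of_real (exp (t * \<sigma> * pi / 2)) * exp (\<i> * of_real t * Ln z)"
proof -
  have "(\<lambda>n. power_approx r \<sigma> t n z) \<longlonglongrightarrow> exp (- \<i> * of_real t * (\<i> * of_real (\<sigma> * pi / 2) - Ln z))"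
    unfolding power_approx_def by (intro tendsto_intros log_sum_limit[OF z r \<sigma>])
  moreover have "- \<i> * of_real t * (\<i> * of_real (\<sigma> * pi / 2) - Ln z) = of_real (t * \<sigma> * pi / 2) + \<i> * of_real t * Ln z"
    by (simp add: algebra_simps)
  ultimately show ?thesis by (simp only: exp_add exp_of_real)
qed

lemma power_approx_limit:
  assumes \<kappa>: "0 < Re \<kappa>" and r: "1 < r" and \<sigma>: "\<sigma> = 1 \<or> \<sigma> = -1" and x: "x \<noteq> 0"
  shows "(\<lambda>n. power_approx r \<sigma> t n (\<kappa> * of_real x)) \<longlonglongrightarrow> power_limit \<kappa> \<sigma> t x"
proof -
  have \<kappa>0: "\<kappa> \<noteq> 0" using \<kappa> by auto
  have e: "exp (\<i> * of_real t * Ln (\<kappa> * of_real a)) = exp (\<i> * of_real t * Ln \<kappa>) * cis (t * ln a)" if a: "0 < a" for a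
  proof -
    have "Ln (\<kappa> * of_real a) = of_real (ln a) + Ln \<kappa>"
      using Ln_times_of_real[OF a \<kappa>0] a by (simp add: mult.commute Ln_of_real)
    then show ?thesis by (simp add: cis_conv_exp exp_add distrib_left mult.commute mult.left_commute)
  qed
  show ?thesis
  proof (cases "0 < x")
    case True
    then show ?thesis
      using power_approx_limit_pos[of "\<kappa> * of_real x" r \<sigma> t] \<kappa> r \<sigma> e[OF True]
      by (simp add: power_limit_def mult.assoc)
  next
    case False
    then have x: "0 < - x" using x by simp
    have "power_approx r \<sigma> t n (\<kappa> * of_real x) = power_approx r (- \<sigma>) t n (\<kappa> * of_real (- x))" for n
      using log_sum_minus[of r \<sigma> n "\<kappa> * of_real x"] by (simp add: power_approx_def)
    moreover have "0 < Re (\<kappa> * of_real (- x))" using \<kappa> x by (simp add: mult_pos_neg)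
    ultimately show ?thesis
      using power_approx_limit_pos[of "\<kappa> * of_real (- x)" r "- \<sigma>" t] r \<sigma> e[OF x] x
      by (auto simp: power_limit_def mult.assoc)
  qed
qed

lemma bounded_borel_cis_ln: "bounded_borel (\<lambda>x. cis (t * ln \<bar>x\<bar>))"
proof (rule bounded_borelI[of _ 1])
  have "cis \<in> borel_measurable borel" by (intro borel_measurable_continuous_onI continuous_intros)
  moreover have "(\<lambda>x. t * ln \<bar>x\<bar>) \<in> borel_measurable borel" by measurable
  ultimately show "(\<lambda>x. cis (t * ln \<bar>x\<bar>)) \<in> borel_measurable borel" by (rule measurable_compose[rotated])
qed simp

lemma bounded_borel_power_limit: "bounded_borel (power_limit \<kappa> \<sigma> t)"
proof -
  have "bounded_borel (\<lambda>x. complex_of_real (exp (t * \<sigma> * sgn x * pi / 2)))"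
  proof (rule bounded_borel_of_real)
    show "(\<lambda>x. exp (t * \<sigma> * sgn x * pi / 2)) \<in> borel_measurable borel" by measurable
    show "\<bar>exp (t * \<sigma> * sgn x * pi / 2)\<bar> \<le> exp \<bar>t * \<sigma> * pi / 2\<bar>" for x :: real
      by (simp add: sgn_if) (use abs_ge_self abs_ge_minus_self in force)
  qed
  then show ?thesis unfolding power_limit_def[abs_def]
    by (intro bounded_borel_mult bounded_borel_const bounded_borel_cis_ln)
qed

text \<open>Multiplying by the conjugate of \<kappa> makes the points \<kappa> x real, and the
  imaginary part that remains is \<sigma> a Re \<kappa>. The result bounds from below the distance
  of the line through \<kappa> from the pole at - i \<sigma> a.\<close>

lemma distance_to_line:
  "a * \<bar>Re \<kappa>\<bar> \<le> cmod (\<kappa> * of_real x + \<i> * of_real \<sigma> * of_real a) * cmod \<kappa>" if "\<sigma> = 1 \<or> \<sigma> = -1" "0 \<le> a"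
proof -
  have "Im ((\<kappa> * of_real x + \<i> * of_real \<sigma> * of_real a) * cnj \<kappa>) = \<sigma> * a * Re \<kappa>"
    by (simp add: algebra_simps)
  then have "a * \<bar>Re \<kappa>\<bar> = \<bar>Im ((\<kappa> * of_real x + \<i> * of_real \<sigma> * of_real a) * cnj \<kappa>)\<bar>"
    using that by (auto simp: abs_mult)
  also have "\<dots> \<le> cmod ((\<kappa> * of_real x + \<i> * of_real \<sigma> * of_real a) * cnj \<kappa>)" by (rule abs_Im_le_cmod)
  finally show ?thesis by (simp add: norm_mult)
qed

text \<open>The function at - \<eta> x is reduced by reflection to the one at \<eta> x with the
  opposite \<sigma>. This change of sign is the source of the anticommutation.\<close>

lemma (in sa_calculus) intertwines_power_limit:
  assumes B: "selfadjoint B" and ker: "op_ker T = {0}" and \<kappa>: "0 < Re \<kappa>" "0 < Re \<eta>"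
    and base: "\<And>s::real. s \<noteq> 0 \<Longrightarrow> intertwines B (\<lambda>x. 1 / (\<kappa> * of_real x + \<i> * of_real s)) (\<lambda>x. 1 / (- \<eta> * of_real x + \<i> * of_real s))"
    and \<sigma>: "\<sigma> = 1 \<or> \<sigma> = -1"
  shows "intertwines B (power_limit \<kappa> \<sigma> t) (power_limit \<eta> (- \<sigma>) t)"
proof -
  \<comment> \<open>The ratio |\<kappa>| / Re \<kappa> compares the height a of a pole with its
    distance to the line through \<kappa>; the sum serves both lines.\<close>
  define C where "C = cmod \<kappa> / Re \<kappa> + cmod \<eta> / Re \<eta>"
  have C: "cmod \<kappa> / Re \<kappa> \<le> C" "cmod \<eta> / Re \<eta> \<le> C" "0 < C"
  proof -
    have "\<kappa> \<noteq> 0" "\<eta> \<noteq> 0" using \<kappa> by auto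
    then have "0 < cmod \<kappa> / Re \<kappa>" "0 < cmod \<eta> / Re \<eta>" using \<kappa> by simp_all
    then show "cmod \<kappa> / Re \<kappa> \<le> C" "cmod \<eta> / Re \<eta> \<le> C" "0 < C" by (simp_all add: C_def)
  qed
  \<comment> \<open>The gap between consecutive poles a and r a is a / (2 C), at most half the
    distance of the pole to either line. This produces the bound 1/2 for the logarithm.\<close>
  define r where "r = 1 + 1 / (2 * C)"
  have r: "1 < r" using C by (simp add: r_def)
  have half: "cmod (\<i> * of_real \<sigma> * of_real (r ^ Suc k / r ^ n - r ^ k / r ^ n)
      * (1 / (\<nu> * of_real x + \<i> * of_real \<sigma> * of_real (r ^ k / r ^ n)))) \<le> 1 / 2"
    if \<nu>: "cmod \<nu> / \<bar>Re \<nu>\<bar> \<le> C" "Re \<nu> \<noteq> 0" for k n \<nu> x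
  proof -
    define a where "a = r ^ k / r ^ n"
    have a: "0 < a" using r by (simp add: a_def)
    define w where "w = \<nu> * of_real x + \<i> * of_real \<sigma> * of_real a"
    have "r ^ Suc k / r ^ n = a * r" by (simp add: a_def mult.commute)
    also have "\<dots> = a + a / (2 * C)" by (simp add: r_def distrib_left)
    finally have d: "r ^ Suc k / r ^ n - a = a / (2 * C)" by simp
    have "a * \<bar>Re \<nu>\<bar> \<le> cmod w * cmod \<nu>" unfolding w_def using \<sigma> a by (intro distance_to_line) auto
    also have "\<dots> \<le> cmod w * (C * \<bar>Re \<nu>\<bar>)" using \<nu> by (intro mult_left_mono) (auto simp: divide_le_eq)
    finally have "a \<le> cmod w * C" using \<nu>(2) by (simp add: mult.assoc[symmetric])
    moreover from this have "0 < cmod w" using a C by (metis linorder_not_le mult_nonpos_nonneg less_imp_le order_less_le_trans)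
    ultimately have "a / (2 * C) * (1 / cmod w) \<le> 1 / 2" using C by (simp add: field_simps)
    moreover have "cmod (\<i> * of_real \<sigma> * of_real (a / (2 * C)) * (1 / w)) = a / (2 * C) * (1 / cmod w)"
      using \<sigma> a C by (auto simp: norm_mult norm_divide)
    ultimately show ?thesis unfolding a_def[symmetric] d w_def[symmetric] by (simp only:)
  qed
  have hF: "cmod (\<i> * of_real \<sigma> * of_real (r ^ Suc k / r ^ n - r ^ k / r ^ n)
      * (1 / (\<kappa> * of_real x + \<i> * of_real \<sigma> * of_real (r ^ k / r ^ n)))) \<le> 1 / 2" for k n x
    using half[of \<kappa> k n x] C \<kappa> by simp
  have hG: "cmod (\<i> * of_real \<sigma> * of_real (r ^ Suc k / r ^ n - r ^ k / r ^ n)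
      * (1 / (- \<eta> * of_real x + \<i> * of_real \<sigma> * of_real (r ^ k / r ^ n)))) \<le> 1 / 2" for k n x
    using half[of "- \<eta>" k n x] C \<kappa> by simp
  have u: "intertwines B (\<lambda>x. \<i> * of_real \<sigma> * of_real (r ^ Suc k / r ^ n - r ^ k / r ^ n)
      * (1 / (\<kappa> * of_real x + \<i> * of_real \<sigma> * of_real (r ^ k / r ^ n))))
    (\<lambda>x. \<i> * of_real \<sigma> * of_real (r ^ Suc k / r ^ n - r ^ k / r ^ n)
      * (1 / (- \<eta> * of_real x + \<i> * of_real \<sigma> * of_real (r ^ k / r ^ n))))" for k n
  proof -
    have "\<sigma> * (r ^ k / r ^ n) \<noteq> 0" using \<sigma> r by auto
    from base[OF this] show ?thesis
      by (intro intertwines_scale[OF B]) (simp only: of_real_mult mult.assoc)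
  qed
  have ls: "intertwines B (\<lambda>x. log_sum r \<sigma> n (\<kappa> * of_real x)) (\<lambda>x. log_sum r \<sigma> n (- \<eta> * of_real x))" for n
    unfolding log_sum_def by (intro intertwines_sum[OF B] intertwines_Ln[OF B ker u hF hG]) simp
  have pa: "intertwines B (\<lambda>x. power_approx r \<sigma> t n (\<kappa> * of_real x)) (\<lambda>x. power_approx r \<sigma> t n (- \<eta> * of_real x))" for n
  proof -
    have "intertwines B (\<lambda>x. - \<i> * of_real t * (log_sum r \<sigma> n (\<kappa> * of_real x) + (- of_real (ln (r ^ n)))))
      (\<lambda>x. - \<i> * of_real t * (log_sum r \<sigma> n (- \<eta> * of_real x) + (- of_real (ln (r ^ n)))))"
      by (intro intertwines_scale[OF B] intertwines_add[OF B] ls intertwines_const[OF B])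
    from intertwines_exp[OF B ker this] show ?thesis unfolding power_approx_def by simp
  qed
  show ?thesis
  proof (rule intertwines_limit[OF B ker pa bounded_borel_power_limit bounded_borel_power_limit, where K = "exp (\<bar>t\<bar> * pi)"])
    show "cmod (power_approx r \<sigma> t n (\<kappa> * of_real x)) \<le> exp (\<bar>t\<bar> * pi)" for n x
      using \<kappa> by (intro power_approx_bound[OF r \<sigma>]) auto
    show "cmod (power_approx r \<sigma> t n (- \<eta> * of_real x)) \<le> exp (\<bar>t\<bar> * pi)" for n x
      using \<kappa> by (intro power_approx_bound[OF r \<sigma>]) auto
    show "(\<lambda>n. power_approx r \<sigma> t n (\<kappa> * of_real x)) \<longlonglongrightarrow> power_limit \<kappa> \<sigma> t x" if "x \<noteq> 0" for x
      by (rule power_approx_limit[OF \<kappa>(1) r \<sigma> that])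
    show "(\<lambda>n. power_approx r \<sigma> t n (- \<eta> * of_real x)) \<longlonglongrightarrow> power_limit \<eta> (- \<sigma>) t x" if "x \<noteq> 0" for x
    proof -
      have "power_approx r \<sigma> t n (- \<eta> * of_real x) = power_approx r (- \<sigma>) t n (\<eta> * of_real x)" for n
        using log_sum_minus[of r \<sigma> n "- \<eta> * of_real x"] by (simp add: power_approx_def)
      then show ?thesis using power_approx_limit[OF \<kappa>(2) r _ that, of "- \<sigma>" t] \<sigma> by auto
    qed
  qed
qed

text \<open>Adding the cases \<sigma> = 1 and \<sigma> = -1 replaces the factor depending on sgn x
  by the nonzero constant 2 cosh (t pi / 2). Subtracting them at t = 1 leaves 2 sinh (pi / 2) sgn x,
  and in the second function \<sigma> enters with the opposite sign.\<close>

lemma (in sa_calculus) intertwines_powers: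
  assumes B: "selfadjoint B" and ker: "op_ker T = {0}" and \<kappa>: "0 < Re \<kappa>" "0 < Re \<eta>"
    and base: "\<And>s::real. s \<noteq> 0 \<Longrightarrow> intertwines B (\<lambda>x. 1 / (\<kappa> * of_real x + \<i> * of_real s)) (\<lambda>x. 1 / (- \<eta> * of_real x + \<i> * of_real s))"
    and \<theta>: "Ln \<eta> = Ln \<kappa> + \<i> * of_real \<theta>"
  shows "intertwines B (\<lambda>x. cis (t * ln \<bar>x\<bar>)) (\<lambda>x. of_real (exp (- \<theta> * t)) * cis (t * ln \<bar>x\<bar>))"
    and "intertwines B (\<lambda>x. of_real (sgn x)) (\<lambda>x. - of_real (sgn x))"
proof -
  define e where "e t = exp (\<i> * of_real t * Ln \<kappa>)" for t :: real
  have e0: "e t \<noteq> 0" for t by (simp add: e_def)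
  have el: "exp (\<i> * of_real t * Ln \<eta>) = e t * of_real (exp (- \<theta> * t))" for t
  proof -
    have "\<i> * of_real t * Ln \<eta> = \<i> * of_real t * Ln \<kappa> + of_real (- \<theta> * t)"
      unfolding \<theta> by (simp add: algebra_simps)
    then show ?thesis by (simp only: exp_add exp_of_real e_def)
  qed
  define c where "c t = exp (t * pi / 2) + exp (- (t * pi / 2))" for t :: real
  define s where "s = exp (pi / 2) - exp (- (pi / 2))"
  have c0: "c t \<noteq> 0" for t :: real unfolding c_def using exp_gt_zero[of "t * pi / 2"] exp_gt_zero[of "- (t * pi / 2)"] by linarith
  have s0: "s \<noteq> 0" unfolding s_def using pi_gt_zero by simp
  note pl = intertwines_power_limit[OF B ker \<kappa> base]
  let ?P = "\<lambda>t. intertwines B (\<lambda>x. cis (t * ln \<bar>x\<bar>)) (\<lambda>x. of_real (exp (- \<theta> * t)) * cis (t * ln \<bar>x\<bar>))"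
  have sg: "exp (t * sgn x * pi / 2) + exp (- (t * sgn x * pi / 2)) = c t" if "x \<noteq> 0" for t x :: real
    using that by (auto simp: c_def sgn_if)
  have ss: "exp (sgn x * pi / 2) - exp (- (sgn x * pi / 2)) = s * sgn x" for x :: real
    by (auto simp: s_def sgn_if)
  \<comment> \<open>A pair may be altered at the single point 0: the limit lemma is applied to a
    constant sequence.\<close>
  have cong: "intertwines B F' G'" if FG: "intertwines B F G" and b: "bounded_borel F'" "bounded_borel G'"
    and eq: "\<And>x. x \<noteq> 0 \<Longrightarrow> F x = F' x" "\<And>x. x \<noteq> 0 \<Longrightarrow> G x = G' x" for F G F' G'
  proof -
    obtain K L where "\<And>x. cmod (F x) \<le> K" "\<And>x. cmod (G x) \<le> L"
      using FG bounded_borel_bound unfolding intertwines_def by metis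
    then have "cmod (F x) \<le> max K L" "cmod (G x) \<le> max K L" for x
      by (auto intro: max.coboundedI1 max.coboundedI2)
    then show ?thesis using eq by (intro intertwines_limit[OF B ker FG b]) auto
  qed
  have P: "?P t" for t
  proof (rule cong)
    show "intertwines B (\<lambda>x. (1 / (of_real (c t) * e t)) * (power_limit \<kappa> 1 t x + power_limit \<kappa> (-1) t x))
      (\<lambda>x. (1 / (of_real (c t) * e t)) * (power_limit \<eta> (-1) t x + power_limit \<eta> (- (-1)) t x))"
      by (intro intertwines_scale[OF B] intertwines_add[OF B] pl) simp_all
    fix x :: real assume x: "x \<noteq> 0"
    have cc: "complex_of_real (exp (t * sgn x * pi / 2)) + complex_of_real (exp (- (t * sgn x * pi / 2))) = of_real (c t)"
      using sg[OF x, of t] by (metis of_real_add)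
    have "power_limit \<kappa> 1 t x + power_limit \<kappa> (-1) t x = of_real (c t) * e t * cis (t * ln \<bar>x\<bar>)"
      unfolding cc[symmetric] power_limit_def e_def by (simp add: distrib_right)
    then show "(1 / (of_real (c t) * e t)) * (power_limit \<kappa> 1 t x + power_limit \<kappa> (-1) t x) = cis (t * ln \<bar>x\<bar>)"
      using c0[of t] e0[of t] by simp
    have "power_limit \<eta> (-1) t x + power_limit \<eta> (- (-1)) t x = of_real (c t) * (e t * of_real (exp (- \<theta> * t))) * cis (t * ln \<bar>x\<bar>)"
      unfolding cc[symmetric] power_limit_def el by (simp add: distrib_right)
    then show "(1 / (of_real (c t) * e t)) * (power_limit \<eta> (-1) t x + power_limit \<eta> (- (-1)) t x)
       = of_real (exp (- \<theta> * t)) * cis (t * ln \<bar>x\<bar>)"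
      using c0[of t] e0[of t] by simp
  qed (intro bounded_borel_mult bounded_borel_const bounded_borel_cis_ln)+
  then show "?P t" .
  show "intertwines B (\<lambda>x. of_real (sgn x)) (\<lambda>x. - of_real (sgn x))"
  proof (rule cong)
    \<comment> \<open>The difference at t = 1 still carries the power |x|^i. Multiplying by the pair
      for t = -1 removes it, and on the second side the factors exp (-\<theta>) and exp \<theta>
      cancel.\<close>
    show "intertwines B (\<lambda>x. (1 / (of_real s * e 1)) * (power_limit \<kappa> 1 1 x + (-1) * power_limit \<kappa> (-1) 1 x) * cis (-1 * ln \<bar>x\<bar>))
      (\<lambda>x. (1 / (of_real s * e 1)) * (power_limit \<eta> (-1) 1 x + (-1) * power_limit \<eta> (- (-1)) 1 x)
         * (of_real (exp (- \<theta> * (-1))) * cis (-1 * ln \<bar>x\<bar>)))"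
      by (intro intertwines_mult[OF B] intertwines_scale[OF B] intertwines_add[OF B] pl P) simp_all
    show "bounded_borel (\<lambda>x. - complex_of_real (sgn x))"
      using bounded_borel_mult[OF bounded_borel_const[of "-1"] bounded_borel_sgn] by simp
    fix x :: real assume x: "x \<noteq> 0"
    have cc: "complex_of_real (exp (sgn x * pi / 2)) - complex_of_real (exp (- (sgn x * pi / 2))) = of_real s * of_real (sgn x)"
      using ss[of x] by (metis of_real_diff of_real_mult)
    have ci: "cis (ln \<bar>x\<bar>) * cis (-1 * ln \<bar>x\<bar>) = 1" by (simp add: cis_mult)
    have "power_limit \<kappa> 1 1 x + (-1) * power_limit \<kappa> (-1) 1 x
       = (complex_of_real (exp (sgn x * pi / 2)) - complex_of_real (exp (- (sgn x * pi / 2)))) * e 1 * cis (ln \<bar>x\<bar>)"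
      by (simp add: power_limit_def e_def algebra_simps)
    then have "(1 / (of_real s * e 1)) * (power_limit \<kappa> 1 1 x + (-1) * power_limit \<kappa> (-1) 1 x) * cis (-1 * ln \<bar>x\<bar>)
      = of_real (sgn x) * (cis (ln \<bar>x\<bar>) * cis (-1 * ln \<bar>x\<bar>))"
      unfolding cc using s0 e0[of 1] by (simp add: mult.assoc)
    then show "(1 / (of_real s * e 1)) * (power_limit \<kappa> 1 1 x + (-1) * power_limit \<kappa> (-1) 1 x) * cis (-1 * ln \<bar>x\<bar>)
      = of_real (sgn x)" unfolding ci by simp
    have ee: "complex_of_real (exp (- \<theta> * 1)) * of_real (exp (- \<theta> * (-1))) = 1"
      by (simp flip: of_real_mult exp_add)
    have "power_limit \<eta> (-1) 1 x + (-1) * power_limit \<eta> (- (-1)) 1 x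
       = - ((complex_of_real (exp (sgn x * pi / 2)) - complex_of_real (exp (- (sgn x * pi / 2)))) * (e 1 * of_real (exp (- \<theta> * 1))) * cis (ln \<bar>x\<bar>))"
      unfolding power_limit_def el by (simp add: algebra_simps)
    then have "(1 / (of_real s * e 1)) * (power_limit \<eta> (-1) 1 x + (-1) * power_limit \<eta> (- (-1)) 1 x)
         * (of_real (exp (- \<theta> * (-1))) * cis (-1 * ln \<bar>x\<bar>))
      = - (of_real (sgn x) * (complex_of_real (exp (- \<theta> * 1)) * of_real (exp (- \<theta> * (-1)))) * (cis (ln \<bar>x\<bar>) * cis (-1 * ln \<bar>x\<bar>)))"
      unfolding cc using s0 e0[of 1] by (simp add: mult_ac)
    then show "(1 / (of_real s * e 1)) * (power_limit \<eta> (-1) 1 x + (-1) * power_limit \<eta> (- (-1)) 1 x)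
         * (of_real (exp (- \<theta> * (-1))) * cis (-1 * ln \<bar>x\<bar>)) = - of_real (sgn x)"
      unfolding ci ee by simp
  qed (rule bounded_borel_sgn)
qed

section \<open>The main theorem\<close>

text \<open>V is a self-adjoint involution mapping the domain into itself, hence onto itself, so V P
  V can be given the domain of P.\<close>

lemma positive_sa_conjugate:
  assumes P: "positive_sa P" and dom: "\<And>f. f \<in> opdom P \<Longrightarrow> V f \<in> opdom P"
    and V: "bounded_op V" "\<And>f. V (V f) = f" "\<And>f g. hinner (V f) g = hinner f (V g)"
  shows "positive_sa (opdom P, \<lambda>f. V (opapp P (V f)))"
proof -
  have sa: "selfadjoint P" and pos: "\<And>f. f \<in> opdom P \<Longrightarrow> 0 \<le> Re (hinner (opapp P f) f)"
    using P by (auto simp: positive_sa_def)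
  define Q where "Q = (opdom P, \<lambda>f. V (opapp P (V f)))"
  have Q: "opdom Q = opdom P" "opapp Q = (\<lambda>f. V (opapp P (V f)))" by (simp_all add: Q_def opdom_def opapp_def)
  have sym: "hinner (V (opapp P (V f))) g = hinner f (V (opapp P (V g)))" if "f \<in> opdom P" "g \<in> opdom P" for f g
    using selfadjoint_symmetric[OF sa dom[OF that(1)] dom[OF that(2)]] V(3) by simp
  have "selfadjoint Q"
    unfolding selfadjoint_def
  proof (intro conjI allI ballI)
    show "linear_op Q"
      unfolding linear_op_def Q
      using selfadjoint_zero[OF sa] selfadjoint_add[OF sa] selfadjoint_scale[OF sa] dom
      by (simp add: bounded_op_add[OF V(1)] bounded_op_scale[OF V(1)])
    show "closure (opdom Q) = UNIV" unfolding Q by (rule selfadjoint_dense[OF sa])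
    show "hinner (opapp Q f) g = hinner f (opapp Q g)" if "f \<in> opdom Q" "g \<in> opdom Q" for f g
      using sym that unfolding Q by blast
    show "g \<in> opdom Q \<longleftrightarrow> (\<exists>h. \<forall>f\<in>opdom Q. hinner (opapp Q f) g = hinner f h)" for g
    proof
      assume "g \<in> opdom Q" then show "\<exists>h. \<forall>f\<in>opdom Q. hinner (opapp Q f) g = hinner f h"
        using sym unfolding Q by blast
    next
      assume "\<exists>h. \<forall>f\<in>opdom Q. hinner (opapp Q f) g = hinner f h"
      then obtain h where h: "\<And>f. f \<in> opdom P \<Longrightarrow> hinner (V (opapp P (V f))) g = hinner f h" unfolding Q by blast
      have "hinner (opapp P f) (V g) = hinner f (V h)" if f: "f \<in> opdom P" for f
        using h[OF dom[OF f]] by (simp add: V(2,3))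
      from selfadjoint_adjoint_domain[OF sa this] have "V g \<in> opdom P" by blast
      from dom[OF this] show "g \<in> opdom Q" by (simp add: V(2) Q)
    qed
  qed
  moreover have "0 \<le> Re (hinner (opapp Q f) f)" if "f \<in> opdom Q" for f
    using pos[OF dom, of f] that by (simp add: Q V(3))
  ultimately show ?thesis unfolding positive_sa_def Q_def by blast
qed

text \<open>With V the unitary part of A, the hypothesis reads B = - V B V. Inserting B = U P gives
  B = (- V U V) (V P V), a second polar decomposition of B, so - V U V = U.\<close>

lemma polar_U_anticommute:
  assumes A: "sa_calculus \<mu> \<G> A" and B: "selfadjoint B" and ker: "op_ker A = {0}" "op_ker B = {0}"
    and anti: "borel_calculus.intertwines \<mu> B (\<lambda>x. of_real (sgn x)) (\<lambda>x. - of_real (sgn x))"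
  shows "polar_U A (polar_U B f) = - polar_U B (polar_U A f)"
proof -
  interpret a: sa_calculus \<mu> \<G> A by fact
  obtain E where "sa_calculus (spec_meas E) borel_indicators B" using sa_calculus_exists[OF B] by blast
  then interpret b: sa_calculus "spec_meas E" borel_indicators B .
  define V where "V = a.calc (\<lambda>x. of_real (sgn x))"
  define U where "U = b.calc (\<lambda>x. of_real (sgn x))"
  have V: "bounded_op V" "\<And>f. V (V f) = f" "\<And>f g. hinner (V f) g = hinner f (V g)"
    unfolding V_def by (rule a.calc_bounded_op[OF bounded_borel_sgn] a.calc_sgn_involution[OF ker(1)] a.calc_sgn_symmetric)+
  have nV: "a.calc (\<lambda>x. - of_real (sgn x)) g = - V g" for g
    using fun_cong[OF a.calc_scale[OF bounded_borel_sgn, of "-1"], of g] by (simp add: V_def hscaleC_minus_one)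
  have VB: "V g \<in> opdom B" "opapp B (V g) = - V (opapp B g)" if "g \<in> opdom B" for g
    using anti that unfolding a.intertwines_def V_def[symmetric] nV by blast+
  have uU: "unitary_op U" unfolding U_def by (rule b.polar_exists(1)[OF ker(2)])
  obtain P where P: "positive_sa P" "op_eq B (op_comp (op_of U) P)"
    unfolding U_def using b.polar_exists(2)[OF ker(2)] by (elim exE conjE)
  have dom: "opdom P = opdom B" and BP: "\<And>f. f \<in> opdom B \<Longrightarrow> opapp B f = U (opapp P f)"
    using P(2) by (auto simp: op_eq_def op_le_def op_comp_def op_of_def opdom_def opapp_def)
  define W where "W g = - V (U (V g))" for g
  have bU: "bounded_op U" and isoU: "\<And>x y. hinner (U x) (U y) = hinner x y" and sU: "surj U"
    using uU by (auto simp: unitary_op_def)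
  have "unitary_op W"
    unfolding unitary_op_def
  proof (intro conjI allI)
    have "bounded_op (\<lambda>g. hscaleC (-1) (V (U (V g))))"
      by (intro bounded_op_scaled bounded_op_comp[OF V(1) bounded_op_comp[OF bU V(1)]])
    then show "bounded_op W" by (simp add: W_def[abs_def] hscaleC_minus_one)
    show "surj W"
    proof (rule surjI)
      fix y
      show "W (V (inv U (V (- y)))) = y"
        by (simp add: W_def V(2) surj_f_inv_f[OF sU] bounded_op_minus[OF V(1)])
    qed
    show "hinner (W x) (W y) = hinner x y" for x y
      by (simp add: W_def hinner_linear V isoU)
  qed
  moreover have "positive_sa (opdom P, \<lambda>f. V (opapp P (V f)))"
    by (rule positive_sa_conjugate[OF P(1) _ V]) (simp add: dom VB)
  moreover have "op_eq B (op_comp (op_of W) (opdom P, \<lambda>f. V (opapp P (V f))))"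
  proof -
    have "W (V (opapp P (V g))) = opapp B g" if g: "g \<in> opdom B" for g
    proof -
      have "U (opapp P (V g)) = - V (opapp B g)" using BP[OF VB(1)[OF g]] VB(2)[OF g] by (rule trans[OF sym])
      then show ?thesis by (simp add: W_def V(2) bounded_op_minus[OF V(1)])
    qed
    then show ?thesis
      by (auto simp: op_eq_def op_le_def op_comp_def op_of_def opdom_def opapp_def dom[unfolded opdom_def])
  qed
  ultimately have "polar_U B = W" by (rule b.polar_U_eqI[OF ker(2)])
  moreover have "polar_U B = U" unfolding U_def by (rule b.polar_U_calc[OF ker(2)])
  ultimately have "U g = - V (U (V g))" for g using W_def by metis
  then have "V (U f) = - U (V f)" by (metis V(2) bounded_op_minus[OF V(1)])
  moreover have "polar_U A = V" unfolding V_def by (rule a.polar_U_calc[OF ker(1)])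
  ultimately show ?thesis using \<open>polar_U B = U\<close> by simp
qed

section \<open>Geometry of the sector and of the logarithm\<close>

lemma in_sector_iff: "p \<in> sector \<theta> \<longleftrightarrow> p \<in> sector_plus \<theta> \<or> - p \<in> sector_plus \<theta>"
proof -
  have "p \<in> uminus ` sector_plus \<theta> \<longleftrightarrow> - p \<in> sector_plus \<theta>"
    by (auto intro: image_eqI[of _ _ "- p"])
  then show ?thesis by (simp add: sector_def)
qed

lemma sector_minus: "- p \<in> sector \<theta> \<longleftrightarrow> p \<in> sector \<theta>"
  by (auto simp: in_sector_iff)

text \<open>The sector contains the real line, so Im p is nonzero. If Im p > 0 and \<phi> is the
  argument of p, avoiding the sector means \<phi> < \<theta> for positive \<theta> and \<phi> >
  \<theta> + pi for negative \<theta>; in both cases \<phi> - \<theta> is the angle of a point of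
  the lower half-plane.\<close>

lemma not_sector_Im:
  assumes \<theta>: "0 < \<bar>\<theta>\<bar>" "\<bar>\<theta>\<bar> < pi" and p: "p \<notin> sector \<theta>"
  shows "Im p \<noteq> 0" "0 < Im p \<Longrightarrow> Im (p * cis (- \<theta>)) < 0"
proof -
  have S: "of_real r * cis \<phi> \<in> sector_plus \<theta>" if "0 \<le> r" "min 0 (theta1 \<theta>) \<le> \<phi>" "\<phi> \<le> max 0 (theta1 \<theta>)" for r \<phi>
    using that unfolding sector_plus_def by blast
  have pS: "p \<notin> sector_plus \<theta>" "- p \<notin> sector_plus \<theta>"
    using p by (simp_all add: in_sector_iff)
  show "Im p \<noteq> 0"
  proof
    assume "Im p = 0"
    then have "p = of_real (Re p) * cis 0" "- p = of_real (- Re p) * cis 0" by (simp_all add: complex_eq_iff)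
    then show False using S[of "Re p" 0] S[of "- Re p" 0] pS by (cases "0 \<le> Re p") auto
  qed
  show "Im (p * cis (- \<theta>)) < 0" if Imp: "0 < Im p"
  proof (rule ccontr)
    assume neg: "\<not> Im (p * cis (- \<theta>)) < 0"
    have p0: "p \<noteq> 0" using Imp by auto
    define \<phi> where "\<phi> = Arg p"
    have \<phi>: "0 < \<phi>" "\<phi> < pi" using Imp Arg_lt_pi[of p] by (auto simp: \<phi>_def)
    have pe: "p = of_real (cmod p) * cis \<phi>"
      using Arg_eq[OF p0] by (simp add: \<phi>_def cis_conv_exp)
    have "Im (p * cis (- \<theta>)) = cmod p * sin (\<phi> - \<theta>)"
      by (subst pe) (simp add: mult.assoc cis_mult)
    then have "0 \<le> cmod p * sin (\<phi> - \<theta>)" using neg by linarith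
    then have sn: "0 \<le> sin (\<phi> - \<theta>)" using p0 by (simp add: zero_le_mult_iff)
    show False
    proof (cases "0 < \<theta>")
      case True
      \<comment> \<open>If \<phi> < \<theta>, the shift by 2 pi brings \<phi> - \<theta> into the
        interval from pi to 2 pi, where the sine is negative.\<close>
      then have "\<theta> \<le> \<phi>" using sin_lt_zero[of "2 * pi + (\<phi> - \<theta>)"] sn \<theta> \<phi>
        by (cases "\<phi> < \<theta>") (auto simp: sin_add)
      moreover have "- p = of_real (cmod p) * cis (\<phi> - pi)"
        by (subst (1) pe) (simp add: complex_eq_iff)
      ultimately show False using S[of "cmod p" "\<phi> - pi"] pS(2) True \<theta> \<phi> by (simp add: theta1_def)
    next
      case False
      then have "\<phi> \<le> \<theta> + pi" using sin_lt_zero[of "\<phi> - \<theta>"] sn \<theta> \<phi> by force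
      then show False using S[of "cmod p" \<phi>] pS(1) pe False \<theta> \<phi> by (simp add: theta1_def)
    qed
  qed
qed

text \<open>The angle \<beta> is less than 3 pi / 2 in absolute value and has positive cosine, so it
  cannot leave the principal strip and no multiple of 2 pi i appears.\<close>

lemma Ln_rotate:
  assumes \<kappa>: "0 < Re \<kappa>" and \<lambda>: "0 < Re (\<kappa> * cis \<theta>)" and \<theta>: "- pi < \<theta>" "\<theta> < pi"
  shows "Ln (\<kappa> * cis \<theta>) = Ln \<kappa> + \<i> * of_real \<theta>"
proof (rule Ln_unique)
  have k0: "\<kappa> \<noteq> 0" using \<kappa> by auto
  show e: "exp (Ln \<kappa> + \<i> * of_real \<theta>) = \<kappa> * cis \<theta>" using k0 by (simp add: exp_add cis_conv_exp)
  define \<beta> where "\<beta> = Im (Ln \<kappa>) + \<theta>"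
  have b: "\<bar>Im (Ln \<kappa>)\<bar> < pi / 2" using abs_Im_Ln_less[OF \<kappa>] .
  have "Re (\<kappa> * cis \<theta>) = exp (Re (Ln \<kappa>)) * cos \<beta>"
    unfolding e[symmetric] by (simp add: Re_exp \<beta>_def)
  then have cpos: "0 < cos \<beta>" using \<lambda> by (simp add: zero_less_mult_iff)
  have "\<not> pi \<le> \<beta>"
  proof
    assume "pi \<le> \<beta>"
    then have "0 < cos (\<beta> - pi)" using b \<theta> by (intro cos_gt_zero_pi) (auto simp: \<beta>_def)
    then show False using cpos by simp
  qed
  moreover have "\<not> \<beta> \<le> - pi"
  proof
    assume "\<beta> \<le> - pi"
    then have "0 < cos (\<beta> + pi)" using b \<theta> by (intro cos_gt_zero_pi) (auto simp: \<beta>_def)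
    then show False using cpos by simp
  qed
  ultimately show "- pi < Im (Ln \<kappa> + \<i> * of_real \<theta>)" "Im (Ln \<kappa> + \<i> * of_real \<theta>) \<le> pi"
    by (auto simp: \<beta>_def)
qed

text \<open>Multiplication by i / p turns the points \<mu> p into points of the imaginary axis and
  the real line into the line through \<kappa>. This brings the resolvent relation into the form
  required for powers, with \<nu> = - \<kappa> / q as the second direction.\<close>

lemma resolvent_relation_imp_class_C1:
  fixes A B :: "('a::chilbert) op"
  assumes \<theta>: "0 < \<bar>\<theta>\<bar>" "\<bar>\<theta>\<bar> < pi" and A: "selfadjoint A" and B: "selfadjoint B"
    and ker: "op_ker A = {0}" "op_ker B = {0}"
    and p: "0 < Im p" "Im (p * cis (- \<theta>)) < 0"
    and rel: "\<And>\<mu>::real. \<mu> \<noteq> 0 \<Longrightarrow>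
       op_le (op_smult (cis (- \<theta>)) (op_comp (resolvent (complex_of_real \<mu> * p * cis (- \<theta>)) A) B))
             (op_comp B (resolvent (complex_of_real \<mu> * p) A))"
  shows "class_C1 (theta1 \<theta>) A B"
proof -
  obtain E where E: "sa_calculus (spec_meas E) borel_indicators A" using sa_calculus_exists[OF A] by blast
  interpret a: sa_calculus "spec_meas E" borel_indicators A by (rule E)
  define q where "q = cis (- \<theta>)"
  have q0: "q \<noteq> 0" by (simp add: q_def)
  have p0: "p \<noteq> 0" using p by auto
  define \<kappa> where "\<kappa> = \<i> / p"
  define \<nu> where "\<nu> = - (\<i> / (p * q))"
  have Re_ii: "Re (\<i> / w) = Im w / (cmod w)\<^sup>2" for w by (simp add: Re_divide cmod_power2)
  have \<kappa>: "0 < Re \<kappa>" using p p0 by (simp add: \<kappa>_def Re_ii)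
  have \<nu>: "0 < Re \<nu>" using p p0 q0 by (simp add: \<nu>_def Re_ii q_def[symmetric] divide_neg_pos)
  have base: "a.intertwines B (\<lambda>x. 1 / (\<kappa> * of_real x + \<i> * of_real s)) (\<lambda>x. 1 / (- \<nu> * of_real x + \<i> * of_real s))"
    if s: "s \<noteq> 0" for s :: real
  proof -
    \<comment> \<open>The parameter \<mu> = - s makes \<kappa> x + i s equal to i / p times x -
      z.\<close>
    define z where "z = complex_of_real (- s) * p"
    have z: "Im z \<noteq> 0" "Im (z * q) \<noteq> 0" using s p by (auto simp: z_def q_def mult.assoc)
    have r: "op_le (op_smult q (op_comp (resolvent (z * q) A) B)) (op_comp B (resolvent z A))"
      using rel[of "- s"] s by (simp add: z_def q_def)
    have bF: "bounded_borel (\<lambda>x. 1 / (of_real x - z))" "bounded_borel (\<lambda>x. 1 / (of_real x - z * q))"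
      using z by (simp_all add: bounded_borel_rational)
    have "a.intertwines B (\<lambda>x. 1 / (of_real x - z)) (\<lambda>x. q * (1 / (of_real x - z * q)))"
      unfolding a.intertwines_def
    proof (intro conjI ballI bF bounded_borel_mult bounded_borel_const)
      fix f assume f: "f \<in> opdom B"
      have "f \<in> opdom (op_smult q (op_comp (resolvent (z * q) A) B))"
        using f a.calc_resolvent(1)[OF z(2)] by (simp add: op_smult_def op_comp_def opdom_def)
      then have "f \<in> opdom (op_comp B (resolvent z A))"
        "opapp (op_smult q (op_comp (resolvent (z * q) A) B)) f = opapp (op_comp B (resolvent z A)) f"
        using r unfolding op_le_def by blast+
      then have "opapp (resolvent z A) f \<in> opdom B"
        "hscaleC q (opapp (resolvent (z * q) A) (opapp B f)) = opapp B (opapp (resolvent z A) f)"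
        by (simp_all add: op_smult_def op_comp_def opdom_def opapp_def)
      then show "a.calc (\<lambda>x. 1 / (of_real x - z)) f \<in> opdom B"
        "opapp B (a.calc (\<lambda>x. 1 / (of_real x - z)) f) = a.calc (\<lambda>x. q * (1 / (of_real x - z * q))) (opapp B f)"
        unfolding a.calc_resolvent(2)[OF z(1)] a.calc_resolvent(2)[OF z(2)] a.calc_scale[OF bF(2)] by simp_all
    qed
    \<comment> \<open>The factor q of the resolvent relation combines with p / i to the reciprocal
      of i / (p q), so the second function also acquires the numerator 1.\<close>
    then have "a.intertwines B (\<lambda>x. (p / \<i>) * (1 / (of_real x - z))) (\<lambda>x. (p / \<i>) * (q * (1 / (of_real x - z * q))))"
      by (rule a.intertwines_scale[OF B])
    moreover have inv: "1 / ((\<i> / a) * w) = (a / \<i>) * (1 / w)" for a w :: complex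
      by (cases "w = 0"; cases "a = 0") (simp_all add: field_simps)
    moreover have "1 / (\<kappa> * of_real x + \<i> * of_real s) = (p / \<i>) * (1 / (of_real x - z))" for x :: real
    proof -
      have "\<kappa> * of_real x + \<i> * of_real s = (\<i> / p) * (of_real x - z)"
        using p0 by (simp add: \<kappa>_def z_def field_simps)
      then show ?thesis by (simp only: inv)
    qed
    moreover have "1 / (- \<nu> * of_real x + \<i> * of_real s) = (p / \<i>) * (q * (1 / (of_real x - z * q)))" for x :: real
    proof -
      have "- \<nu> * of_real x + \<i> * of_real s = (\<i> / (p * q)) * (of_real x - z * q)"
        using p0 q0 by (simp add: \<nu>_def z_def field_simps)
      then have "1 / (- \<nu> * of_real x + \<i> * of_real s) = (p * q / \<i>) * (1 / (of_real x - z * q))"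
        by (simp only: inv)
      then show ?thesis by simp
    qed
    ultimately show ?thesis by (simp only:)
  qed
  have th1: "- pi < theta1 \<theta>" "theta1 \<theta> < pi" using \<theta> by (auto simp: theta1_def)
  \<comment> \<open>The angles \<open>theta1 \<theta>\<close> and \<theta> differ by pi, which
    absorbs the minus sign in -1 / q.\<close>
  have \<nu>\<kappa>: "\<nu> = \<kappa> * cis (theta1 \<theta>)"
  proof -
    have "cis (theta1 \<theta>) = - cis \<theta>" by (auto simp: theta1_def complex_eq_iff)
    moreover have "1 / q = cis \<theta>" by (simp add: q_def cis_divide[of 0 "-\<theta>", simplified])
    ultimately show ?thesis by (simp add: \<nu>_def \<kappa>_def divide_inverse flip: inverse_eq_divide)
  qed
  have Ln\<nu>: "Ln \<nu> = Ln \<kappa> + \<i> * of_real (theta1 \<theta>)"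
    using Ln_rotate[OF \<kappa> _ th1] \<nu> unfolding \<nu>\<kappa> by blast
  note ip = a.intertwines_powers[OF B ker(1) \<kappa> \<nu> base Ln\<nu>]
  have "op_le (op_comp (op_of (abs_pow_it A t)) B)
     (op_smult (complex_of_real (exp (theta1 \<theta> * t))) (op_comp B (op_of (abs_pow_it A t))))" for t
  proof -
    define V where "V = abs_pow_it A t"
    have V: "V = a.calc (\<lambda>x. cis (t * ln \<bar>x\<bar>))"
      unfolding V_def by (rule a.abs_pow_it_calc[OF bounded_borel_cis_ln])
    have W: "a.calc (\<lambda>x. of_real (exp (- theta1 \<theta> * t)) * cis (t * ln \<bar>x\<bar>)) g = hscaleC (of_real (exp (- theta1 \<theta> * t))) (V g)" for g
      unfolding V by (rule fun_cong[OF a.calc_scale[OF bounded_borel_cis_ln]])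
    have "V f \<in> opdom B" "opapp B (V f) = hscaleC (of_real (exp (- theta1 \<theta> * t))) (V (opapp B f))"
      if "f \<in> opdom B" for f
      using ip(1)[of t] that unfolding a.intertwines_def V[symmetric] W by blast+
    moreover have "hscaleC (of_real (exp (theta1 \<theta> * t))) (hscaleC (of_real (exp (- theta1 \<theta> * t))) g) = g" for g :: 'a
      by (simp add: hscaleC_hscaleC hscaleC_one flip: of_real_mult exp_add)
    ultimately show ?thesis
      unfolding V_def[symmetric] op_le_def op_comp_def op_of_def op_smult_def opdom_def opapp_def by auto
  qed
  moreover have "polar_U A (polar_U B f) = - polar_U B (polar_U A f)" for f
    by (rule polar_U_anticommute[OF E B ker ip(2)])
  ultimately show ?thesis unfolding class_C1_def using ker by blast
qed

theorem mainTheorem12: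
  fixes \<theta>0 :: real and A B :: "('a::chilbert) op" and p :: complex
  assumes "0 < \<bar>\<theta>0\<bar>" and "\<bar>\<theta>0\<bar> < pi"
    and "selfadjoint A" and "selfadjoint B"
    and "op_ker A = {0}" and "op_ker B = {0}"
    and "is_core (Dq ((cis (- \<theta>0))\<^sup>2) (op_comp A A) B) B"
    and "is_core (Dq (cis (- \<theta>0)) A B) B"
    and "p \<notin> sector \<theta>0"
    and "\<forall>\<mu>::real. \<mu> \<noteq> 0 \<longrightarrow>
           op_le (op_smult (cis (- \<theta>0)) (op_comp (resolvent (complex_of_real \<mu> * p * cis (- \<theta>0)) A) B))
                 (op_comp B (resolvent (complex_of_real \<mu> * p) A))"
  shows "class_C1 (theta1 \<theta>0) A B"
proof (cases "0 < Im p")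
  case True
  show ?thesis
    using assms(10) not_sector_Im(2)[OF assms(1,2,9) True]
    by (intro resolvent_relation_imp_class_C1[OF assms(1-6) True]) blast+
next
  case False
  have np: "- p \<notin> sector \<theta>0" using assms(9) by (simp add: sector_minus)
  have Im: "0 < Im (- p)" using False not_sector_Im(1)[OF assms(1,2,9)] by simp
  show ?thesis
  proof (rule resolvent_relation_imp_class_C1[OF assms(1-6) Im not_sector_Im(2)[OF assms(1,2) np Im]])
    fix \<mu> :: real assume "\<mu> \<noteq> 0"
    then show "op_le (op_smult (cis (- \<theta>0)) (op_comp (resolvent (complex_of_real \<mu> * - p * cis (- \<theta>0)) A) B))
       (op_comp B (resolvent (complex_of_real \<mu> * - p) A))"
      \<comment> \<open>The number \<mu> times -p is -\<mu> times p, so the relation for -p is the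
        given one at the opposite parameter.\<close>
      using assms(10)[rule_format, of "- \<mu>"] by simp
  qed
qed

end
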